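(* Let $S$ be (i) a non-trivial Boolean formal space, or (ii) a non-trivial De Morgan formal space such that $(\forall x\in S)\ \bigl(x\vartriangleleft\emptyset\ \vee\ \neg(x\vartriangleleft\emptyset)\bigr)$. Then $S$ cannot be proved to be set-presented (inductively generated) in $\mathrm{CZF}^*$ or in $\mathrm{CTT}^*$.
   Context: Systems. CZF is Aczel's constructive set theory; CTT is Martin-Löf's constructive type theory. $\mathrm{CZF}^*$ denotes an arbitrary fixed extension of CZF consistent with the scheme GUP-CZF: for every set $I$, $(\forall x)(\exists y\in I)A(x,y)\to(\exists y\in I)(\forall x)A(x,y)$ ($x$ ranging over all sets). $\mathrm{CTT}^*$ denotes an arbitrary fixed extension of CTT consistent with GUP-CTT: for every set $I$, every $R$ mapping a proposition and an element of $I$ to a proposition, and every $F$ from propositions to $I$ with $R(P,F(P))$ for all $P$, there is $\bar i\in I$ with $R(P,\bar i)$ for all $P$. "$S$ of a given type cannot be proved to have property $Q$ in $T$" is a metamathematical statement: for no $S$ (given by a definition in $T$) that is of the given type in $T$ does $T$ prove that $S$ has property $Q$. Formal spaces. A formal space is a pair $(S,\vartriangleleft)$ with $S$ a set and $\vartriangleleft$ a relation (a class in CZF) between elements and subsets of $S$ such that: $a\in U$ implies $a\vartriangleleft U$; $a\vartriangleleft U$ and $U\vartriangleleft V$ imply $a\vartriangleleft V$; $a\vartriangleleft U$ and $a\vartriangleleft V$ imply $a\vartriangleleft U\downarrow V$; and (in CZF) $\{a\in S:a\vartriangleleft U\}$ is a set for every $U\subseteq S$. Here $U\vartriangleleft V$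 means $(\forall u\in U)\,u\vartriangleleft V$, $U\downarrow V\equiv\{d\in S:(\exists u\in U)\,d\vartriangleleft\{u\}\ \&\ (\exists v\in V)\,d\vartriangleleft\{v\}\}$, and $a\downarrow U$ means $\{a\}\downarrow U$. The pseudocomplement of $U\subseteq S$ is $U^*\equiv\{a\in S:a\downarrow U\vartriangleleft\emptyset\}$. $S$ is non-trivial if $\neg(S\vartriangleleft\emptyset)$; Boolean if $S\vartriangleleft U\cup U^*$ for all $U\subseteq S$ (i.e. its frame of saturated subsets is Boolean); De Morgan if $S\vartriangleleft U^{**}\cup U^*$ for all $U\subseteq S$. (One may always assume that $S$ has a top element $1_S$, i.e. $S\vartriangleleft\{1_S\}$; then $S$ may be replaced by $1_S$ on the left of these conditions.) $S$ is set-presented if there are families of sets $I(x)$, for $x\in S$, and $C(x,i)\subseteq S$, for $x\in S$, $i\in I(x)$, such that $a\vartriangleleft U\iff(\exists i\in I(a))\,C(a,i)\subseteq U$. In CTT, and in CZF with the regular extension axiom REA, being set-presented is equivalent to being inductively generated. *)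

theory Defs
  imports Main
begin

section \<open>Intuitionistic first-order logic in the language of set theory\<close>

text \<open>Formulas are in de Bruijn notation; the only terms are variables. A bound variable is the
  number of quantifiers between its occurrence and its binder.\<close>

datatype fm =
    Falsum
  | Mem nat nat
  | Equ nat nat
  | Conj fm fm
  | Disj fm fm
  | Impl fm fm
  | Forall fm
  | Exists fm

primrec fv :: "fm \<Rightarrow> nat set" where
  "fv Falsum = {}"
| "fv (Mem i j) = {i, j}"
| "fv (Equ i j) = {i, j}"
| "fv (Conj p q) = fv p \<union> fv q"
| "fv (Disj p q) = fv p \<union> fv q"
| "fv (Impl p q) = fv p \<union> fv q"
| "fv (Forall p) = {i. Suc i \<in> fv p}"
| "fv (Exists p) = {i. Suc i \<in> fv p}"

primrec rename :: "(nat \<Rightarrow> nat) \<Rightarrow> fm \<Rightarrow> fm" where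
  "rename r Falsum = Falsum"
| "rename r (Mem i j) = Mem (r i) (r j)"
| "rename r (Equ i j) = Equ (r i) (r j)"
| "rename r (Conj p q) = Conj (rename r p) (rename r q)"
| "rename r (Disj p q) = Disj (rename r p) (rename r q)"
| "rename r (Impl p q) = Impl (rename r p) (rename r q)"
| "rename r (Forall p) = Forall (rename (case_nat 0 (Suc \<circ> r)) p)"
| "rename r (Exists p) = Exists (rename (case_nat 0 (Suc \<circ> r)) p)"

definition inst :: "nat \<Rightarrow> fm \<Rightarrow> fm" where
  "inst i = rename (case_nat i (\<lambda>k. k))"

text \<open>Natural deduction. A theory is a set of formulas whose free variables are read as universally
  quantified; this is why an axiom may be used under an arbitrary renaming, and why the
  rules for the quantifiers shift the context but not the theory.\<close>

inductive prv :: "fm set \<Rightarrow> fm list \<Rightarrow> fm \<Rightarrow> bool" for T :: "fm set" where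
  Axiom: "p \<in> T \<Longrightarrow> prv T H (rename r p)"
| Hyp: "p \<in> set H \<Longrightarrow> prv T H p"
| FalsumE: "prv T H Falsum \<Longrightarrow> prv T H p"
| ConjI: "prv T H p \<Longrightarrow> prv T H q \<Longrightarrow> prv T H (Conj p q)"
| ConjE1: "prv T H (Conj p q) \<Longrightarrow> prv T H p"
| ConjE2: "prv T H (Conj p q) \<Longrightarrow> prv T H q"
| DisjI1: "prv T H p \<Longrightarrow> prv T H (Disj p q)"
| DisjI2: "prv T H q \<Longrightarrow> prv T H (Disj p q)"
| DisjE: "prv T H (Disj p q) \<Longrightarrow> prv T (p # H) s \<Longrightarrow> prv T (q # H) s \<Longrightarrow> prv T H s"
| ImplI: "prv T (p # H) q \<Longrightarrow> prv T H (Impl p q)"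
| ImplE: "prv T H (Impl p q) \<Longrightarrow> prv T H p \<Longrightarrow> prv T H q"
| ForallI: "prv T (map (rename Suc) H) p \<Longrightarrow> prv T H (Forall p)"
| ForallE: "prv T H (Forall p) \<Longrightarrow> prv T H (inst i p)"
| ExistsI: "prv T H (inst i p) \<Longrightarrow> prv T H (Exists p)"
| ExistsE: "prv T H (Exists p) \<Longrightarrow> prv T (p # map (rename Suc) H) (rename Suc q) \<Longrightarrow> prv T H q"
| EquI: "prv T H (Equ i i)"
| EquE: "prv T H (Equ i j) \<Longrightarrow> prv T H (inst i p) \<Longrightarrow> prv T H (inst j p)"

inductive delta0 :: "fm \<Rightarrow> bool" where
  "delta0 Falsum"
| "delta0 (Mem i j)"
| "delta0 (Equ i j)"
| "delta0 p \<Longrightarrow> delta0 q \<Longrightarrow> delta0 (Conj p q)"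
| "delta0 p \<Longrightarrow> delta0 q \<Longrightarrow> delta0 (Disj p q)"
| "delta0 p \<Longrightarrow> delta0 q \<Longrightarrow> delta0 (Impl p q)"
| "delta0 p \<Longrightarrow> delta0 (Forall (Impl (Mem 0 (Suc i)) p))"
| "delta0 p \<Longrightarrow> delta0 (Exists (Conj (Mem 0 (Suc i)) p))"

text \<open>To write concrete formulas with named variables we use functions of the depth, i.e. of the
  number of quantifiers already passed: the variable bound at depth \<open>d\<close> has index
  \<open>d' - Suc d\<close> when it occurs at depth \<open>d'\<close>. The formula denoted by \<open>P :: form\<close> is \<open>P 0\<close>.\<close>

type_synonym var = "nat \<Rightarrow> nat"
type_synonym form = "nat \<Rightarrow> fm"

definition bound :: "nat \<Rightarrow> var" where "bound d = (\<lambda>d'. d' - Suc d)"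
definition param :: "nat \<Rightarrow> var" where "param k = (\<lambda>d'. d' + k)"

definition fmem :: "var \<Rightarrow> var \<Rightarrow> form" (infix "\<^bold>\<in>" 50) where
  "(x \<^bold>\<in> y) = (\<lambda>d. Mem (x d) (y d))"
definition feq :: "var \<Rightarrow> var \<Rightarrow> form" (infix "\<^bold>=" 50) where
  "(x \<^bold>= y) = (\<lambda>d. Equ (x d) (y d))"
definition fand :: "form \<Rightarrow> form \<Rightarrow> form" (infixr "\<^bold>\<and>" 35) where
  "(P \<^bold>\<and> Q) = (\<lambda>d. Conj (P d) (Q d))"
definition f_or :: "form \<Rightarrow> form \<Rightarrow> form" (infixr "\<^bold>\<or>" 30) where
  "(P \<^bold>\<or> Q) = (\<lambda>d. Disj (P d) (Q d))"
definition fimp :: "form \<Rightarrow> form \<Rightarrow> form" (infixr "\<^bold>\<longrightarrow>" 25) where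
  "(P \<^bold>\<longrightarrow> Q) = (\<lambda>d. Impl (P d) (Q d))"
definition fiff :: "form \<Rightarrow> form \<Rightarrow> form" (infixr "\<^bold>\<longleftrightarrow>" 25) where
  "(P \<^bold>\<longleftrightarrow> Q) = ((P \<^bold>\<longrightarrow> Q) \<^bold>\<and> (Q \<^bold>\<longrightarrow> P))"
definition fnot :: "form \<Rightarrow> form" ("\<^bold>\<not> _" [40] 40) where
  "(\<^bold>\<not> P) = (P \<^bold>\<longrightarrow> (\<lambda>d. Falsum))"
definition fall :: "(var \<Rightarrow> form) \<Rightarrow> form" (binder "\<^bold>\<forall>" 10) where
  "fall F = (\<lambda>d. Forall (F (bound d) (Suc d)))"
definition fex :: "(var \<Rightarrow> form) \<Rightarrow> form" (binder "\<^bold>\<exists>" 10) where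
  "fex F = (\<lambda>d. Exists (F (bound d) (Suc d)))"
definition fex1 :: "(var \<Rightarrow> form) \<Rightarrow> form" (binder "\<^bold>\<exists>\<^bold>!" 10) where
  "fex1 F = (\<^bold>\<exists>x. F x \<^bold>\<and> (\<^bold>\<forall>y. F y \<^bold>\<longrightarrow> y \<^bold>= x))"

definition fball :: "var \<Rightarrow> (var \<Rightarrow> form) \<Rightarrow> form" where
  "fball a F = (\<^bold>\<forall>x. x \<^bold>\<in> a \<^bold>\<longrightarrow> F x)"
definition fbex :: "var \<Rightarrow> (var \<Rightarrow> form) \<Rightarrow> form" where
  "fbex a F = (\<^bold>\<exists>x. x \<^bold>\<in> a \<^bold>\<and> F x)"

syntax
  "_fball" :: "pttrn \<Rightarrow> var \<Rightarrow> form \<Rightarrow> form" ("(3\<^bold>\<forall>_\<^bold>\<in>_./ _)" [0, 51, 10] 10)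
  "_fbex" :: "pttrn \<Rightarrow> var \<Rightarrow> form \<Rightarrow> form" ("(3\<^bold>\<exists>_\<^bold>\<in>_./ _)" [0, 51, 10] 10)
translations
  "\<^bold>\<forall>x\<^bold>\<in>a. P" \<rightleftharpoons> "CONST fball a (\<lambda>x. P)"
  "\<^bold>\<exists>x\<^bold>\<in>a. P" \<rightleftharpoons> "CONST fbex a (\<lambda>x. P)"

text \<open>A given formula \<open>p\<close> as a predicate: its first free variables are replaced by the arguments,
  the remaining ones are parameters.\<close>

definition app1 :: "fm \<Rightarrow> var \<Rightarrow> form" where
  "app1 p x = (\<lambda>d. rename (\<lambda>k. case k of 0 \<Rightarrow> x d | Suc j \<Rightarrow> param j d) p)"
definition app2 :: "fm \<Rightarrow> var \<Rightarrow> var \<Rightarrow> form" where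
  "app2 p x y = (\<lambda>d. rename
     (\<lambda>k. case k of 0 \<Rightarrow> x d | Suc 0 \<Rightarrow> y d | Suc (Suc j) \<Rightarrow> param j d) p)"
definition app3 :: "fm \<Rightarrow> var \<Rightarrow> var \<Rightarrow> var \<Rightarrow> form" where
  "app3 p x y z = (\<lambda>d. rename
     (\<lambda>k. case k of 0 \<Rightarrow> x d | Suc 0 \<Rightarrow> y d | Suc (Suc 0) \<Rightarrow> z d
           | Suc (Suc (Suc j)) \<Rightarrow> param j d) p)"

definition proves :: "fm set \<Rightarrow> form \<Rightarrow> bool" where
  "proves T P \<longleftrightarrow> prv T [] (P 0)"

definition fm_consistent :: "fm set \<Rightarrow> bool" where
  "fm_consistent T \<longleftrightarrow> \<not> prv T [] Falsum"


section \<open>CZF and the generalized uniformity principle\<close>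

definition fsub :: "var \<Rightarrow> var \<Rightarrow> form" (infix "\<^bold>\<subseteq>" 50) where
  "(a \<^bold>\<subseteq> b) = (\<^bold>\<forall>x\<^bold>\<in>a. x \<^bold>\<in> b)"

definition is_empty :: "var \<Rightarrow> form" where
  "is_empty a = (\<^bold>\<forall>x. \<^bold>\<not> x \<^bold>\<in> a)"

definition is_succ :: "var \<Rightarrow> var \<Rightarrow> form" where
  "is_succ b a = (\<^bold>\<forall>x. x \<^bold>\<in> b \<^bold>\<longleftrightarrow> x \<^bold>\<in> a \<^bold>\<or> x \<^bold>= a)"

definition is_upair :: "var \<Rightarrow> var \<Rightarrow> var \<Rightarrow> form" where
  "is_upair c a b = (\<^bold>\<forall>x. x \<^bold>\<in> c \<^bold>\<longleftrightarrow> x \<^bold>= a \<^bold>\<or> x \<^bold>= b)"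

definition inductive_set_fm :: "var \<Rightarrow> form" where
  "inductive_set_fm a =
     ((\<^bold>\<forall>x. is_empty x \<^bold>\<longrightarrow> x \<^bold>\<in> a) \<^bold>\<and> (\<^bold>\<forall>x\<^bold>\<in>a. \<^bold>\<forall>y. is_succ y x \<^bold>\<longrightarrow> y \<^bold>\<in> a))"

definition Extensionality :: form where
  "Extensionality = (\<^bold>\<forall>a. \<^bold>\<forall>b. (\<^bold>\<forall>x. x \<^bold>\<in> a \<^bold>\<longleftrightarrow> x \<^bold>\<in> b) \<^bold>\<longrightarrow> a \<^bold>= b)"

definition Pairing :: form where
  "Pairing = (\<^bold>\<forall>a. \<^bold>\<forall>b. \<^bold>\<exists>c. is_upair c a b)"

definition Union_ax :: form where
  "Union_ax = (\<^bold>\<forall>a. \<^bold>\<exists>b. \<^bold>\<forall>x. x \<^bold>\<in> b \<^bold>\<longleftrightarrow> (\<^bold>\<exists>y\<^bold>\<in>a. x \<^bold>\<in> y))"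

definition Strong_Infinity :: form where
  "Strong_Infinity =
     (\<^bold>\<exists>a. inductive_set_fm a \<^bold>\<and> (\<^bold>\<forall>b. inductive_set_fm b \<^bold>\<longrightarrow> a \<^bold>\<subseteq> b))"

definition Set_Induction :: "fm \<Rightarrow> form" where
  "Set_Induction p = ((\<^bold>\<forall>a. (\<^bold>\<forall>x\<^bold>\<in>a. app1 p x) \<^bold>\<longrightarrow> app1 p a) \<^bold>\<longrightarrow> (\<^bold>\<forall>a. app1 p a))"

definition Separation :: "fm \<Rightarrow> form" where
  "Separation p = (\<^bold>\<forall>a. \<^bold>\<exists>b. \<^bold>\<forall>x. x \<^bold>\<in> b \<^bold>\<longleftrightarrow> x \<^bold>\<in> a \<^bold>\<and> app1 p x)"

definition total_rel :: "(var \<Rightarrow> var \<Rightarrow> form) \<Rightarrow> var \<Rightarrow> var \<Rightarrow> form" where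
  "total_rel R a b =
     ((\<^bold>\<forall>x\<^bold>\<in>a. \<^bold>\<exists>y\<^bold>\<in>b. R x y) \<^bold>\<and> (\<^bold>\<forall>y\<^bold>\<in>b. \<^bold>\<exists>x\<^bold>\<in>a. R x y))"

definition Strong_Collection :: "fm \<Rightarrow> form" where
  "Strong_Collection p =
     (\<^bold>\<forall>a. (\<^bold>\<forall>x\<^bold>\<in>a. \<^bold>\<exists>y. app2 p x y) \<^bold>\<longrightarrow> (\<^bold>\<exists>b. total_rel (app2 p) a b))"

definition Subset_Collection :: "fm \<Rightarrow> form" where
  "Subset_Collection p =
     (\<^bold>\<forall>a. \<^bold>\<forall>b. \<^bold>\<exists>c. \<^bold>\<forall>u. (\<^bold>\<forall>x\<^bold>\<in>a. \<^bold>\<exists>y\<^bold>\<in>b. app3 p x y u) \<^bold>\<longrightarrow>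
        (\<^bold>\<exists>e\<^bold>\<in>c. total_rel (\<lambda>x y. app3 p x y u) a e))"

definition CZF :: "fm set" where
  "CZF = {Extensionality 0, Pairing 0, Union_ax 0, Strong_Infinity 0}
     \<union> {Set_Induction p 0 | p. True}
     \<union> {Separation p 0 | p. delta0 p}
     \<union> {Strong_Collection p 0 | p. True}
     \<union> {Subset_Collection p 0 | p. True}"

definition GUP_CZF :: "fm set" where
  "GUP_CZF = {(\<^bold>\<forall>I. (\<^bold>\<forall>x. \<^bold>\<exists>y\<^bold>\<in>I. app2 p x y) \<^bold>\<longrightarrow> (\<^bold>\<exists>y\<^bold>\<in>I. \<^bold>\<forall>x. app2 p x y)) 0 | p. True}"

definition CZF_star :: "fm set \<Rightarrow> bool" where
  "CZF_star T \<longleftrightarrow> CZF \<subseteq> T \<and> fm_consistent (T \<union> GUP_CZF)"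


section \<open>Formal spaces in CZF\<close>

text \<open>The carrier is a set variable \<open>s\<close> and the cover a formula \<open>\<gamma>(a,U)\<close>, only considered for
  \<open>a \<in> s\<close> and \<open>U \<subseteq> s\<close>. Classes are predicates \<open>K :: var \<Rightarrow> form\<close>, and
  \<open>a \<lhd> K\<close> says that \<open>K\<close> is a set covering \<open>a\<close>.\<close>

definition cov_class :: "fm \<Rightarrow> var \<Rightarrow> (var \<Rightarrow> form) \<Rightarrow> form" where
  "cov_class \<gamma> a K = (\<^bold>\<exists>w. (\<^bold>\<forall>x. x \<^bold>\<in> w \<^bold>\<longleftrightarrow> K x) \<^bold>\<and> app2 \<gamma> a w)"

definition cov_empty :: "fm \<Rightarrow> var \<Rightarrow> form" where
  "cov_empty \<gamma> a = cov_class \<gamma> a (\<lambda>x d. Falsum)"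

definition cov_single :: "fm \<Rightarrow> var \<Rightarrow> var \<Rightarrow> form" where
  "cov_single \<gamma> a u = cov_class \<gamma> a (\<lambda>x. x \<^bold>= u)"

definition down :: "fm \<Rightarrow> var \<Rightarrow> (var \<Rightarrow> form) \<Rightarrow> (var \<Rightarrow> form) \<Rightarrow> var \<Rightarrow> form" where
  "down \<gamma> s K L d = (d \<^bold>\<in> s \<^bold>\<and> (\<^bold>\<exists>u. K u \<^bold>\<and> cov_single \<gamma> d u) \<^bold>\<and> (\<^bold>\<exists>v. L v \<^bold>\<and> cov_single \<gamma> d v))"

definition pseudo :: "fm \<Rightarrow> var \<Rightarrow> (var \<Rightarrow> form) \<Rightarrow> var \<Rightarrow> form" where
  "pseudo \<gamma> s K a = (a \<^bold>\<in> s \<^bold>\<and> (\<^bold>\<forall>d. down \<gamma> s (\<lambda>x. x \<^bold>= a) K d \<^bold>\<longrightarrow> cov_empty \<gamma> d))"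

definition formal_space :: "fm \<Rightarrow> var \<Rightarrow> form" where
  "formal_space \<gamma> s =
    ((\<^bold>\<forall>a\<^bold>\<in>s. \<^bold>\<forall>U. U \<^bold>\<subseteq> s \<^bold>\<longrightarrow> a \<^bold>\<in> U \<^bold>\<longrightarrow> app2 \<gamma> a U) \<^bold>\<and>
     (\<^bold>\<forall>a\<^bold>\<in>s. \<^bold>\<forall>U. \<^bold>\<forall>V. U \<^bold>\<subseteq> s \<^bold>\<longrightarrow> V \<^bold>\<subseteq> s \<^bold>\<longrightarrow>
        app2 \<gamma> a U \<^bold>\<longrightarrow> (\<^bold>\<forall>u\<^bold>\<in>U. app2 \<gamma> u V) \<^bold>\<longrightarrow> app2 \<gamma> a V) \<^bold>\<and>
     (\<^bold>\<forall>a\<^bold>\<in>s. \<^bold>\<forall>U. \<^bold>\<forall>V. U \<^bold>\<subseteq> s \<^bold>\<longrightarrow> V \<^bold>\<subseteq> s \<^bold>\<longrightarrow>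
        app2 \<gamma> a U \<^bold>\<longrightarrow> app2 \<gamma> a V \<^bold>\<longrightarrow>
        cov_class \<gamma> a (down \<gamma> s (\<lambda>x. x \<^bold>\<in> U) (\<lambda>x. x \<^bold>\<in> V))) \<^bold>\<and>
     (\<^bold>\<forall>U. U \<^bold>\<subseteq> s \<^bold>\<longrightarrow> (\<^bold>\<exists>w. \<^bold>\<forall>a. a \<^bold>\<in> w \<^bold>\<longleftrightarrow> a \<^bold>\<in> s \<^bold>\<and> app2 \<gamma> a U)))"

definition non_trivial :: "fm \<Rightarrow> var \<Rightarrow> form" where
  "non_trivial \<gamma> s = (\<^bold>\<not> (\<^bold>\<forall>a\<^bold>\<in>s. cov_empty \<gamma> a))"

text \<open>\<open>s \<lhd> U \<union> U\<^sup>*\<close> is spelled out as \<open>a \<lhd> U \<union> U\<^sup>*\<close> for all \<open>a \<in> s\<close>.\<close>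

definition boolean_space :: "fm \<Rightarrow> var \<Rightarrow> form" where
  "boolean_space \<gamma> s = (\<^bold>\<forall>U. U \<^bold>\<subseteq> s \<^bold>\<longrightarrow> (\<^bold>\<forall>a\<^bold>\<in>s.
     cov_class \<gamma> a (\<lambda>x. x \<^bold>\<in> U \<^bold>\<or> pseudo \<gamma> s (\<lambda>y. y \<^bold>\<in> U) x)))"

definition de_morgan_space :: "fm \<Rightarrow> var \<Rightarrow> form" where
  "de_morgan_space \<gamma> s = (\<^bold>\<forall>U. U \<^bold>\<subseteq> s \<^bold>\<longrightarrow> (\<^bold>\<forall>a\<^bold>\<in>s.
     cov_class \<gamma> a (\<lambda>x. pseudo \<gamma> s (pseudo \<gamma> s (\<lambda>y. y \<^bold>\<in> U)) x \<^bold>\<or>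
                        pseudo \<gamma> s (\<lambda>y. y \<^bold>\<in> U) x)))"

definition decidable_empty_cover :: "fm \<Rightarrow> var \<Rightarrow> form" where
  "decidable_empty_cover \<gamma> s = (\<^bold>\<forall>a\<^bold>\<in>s. cov_empty \<gamma> a \<^bold>\<or> (\<^bold>\<not> cov_empty \<gamma> a))"

text \<open>Kuratowski pairs: \<open>p = {{x},{x,y}}\<close>.\<close>

definition is_opair :: "var \<Rightarrow> var \<Rightarrow> var \<Rightarrow> form" where
  "is_opair p x y = (\<^bold>\<forall>z. z \<^bold>\<in> p \<^bold>\<longleftrightarrow> is_upair z x x \<^bold>\<or> is_upair z x y)"

definition maps_to :: "var \<Rightarrow> var \<Rightarrow> var \<Rightarrow> form" where
  "maps_to f x y = (\<^bold>\<exists>p\<^bold>\<in>f. is_opair p x y)"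

definition function_on :: "var \<Rightarrow> var \<Rightarrow> form" where
  "function_on f a =
     ((\<^bold>\<forall>p\<^bold>\<in>f. \<^bold>\<exists>x\<^bold>\<in>a. \<^bold>\<exists>y. is_opair p x y) \<^bold>\<and> (\<^bold>\<forall>x\<^bold>\<in>a. \<^bold>\<exists>\<^bold>!y. maps_to f x y))"

text \<open>The families of sets \<open>I(x)\<close> and \<open>C(x,i)\<close> are set functions \<open>f\<close> and \<open>g\<close>; the domain of \<open>g\<close>
  is the set \<open>e\<close> of pairs \<open>(x,i)\<close> with \<open>x \<in> s\<close> and \<open>i \<in> I(x)\<close>.\<close>

definition set_presented :: "fm \<Rightarrow> var \<Rightarrow> form" where
  "set_presented \<gamma> s =
     (\<^bold>\<exists>f. \<^bold>\<exists>e. \<^bold>\<exists>g.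
        function_on f s \<^bold>\<and>
        (\<^bold>\<forall>q. q \<^bold>\<in> e \<^bold>\<longleftrightarrow> (\<^bold>\<exists>x\<^bold>\<in>s. \<^bold>\<exists>j. maps_to f x j \<^bold>\<and> (\<^bold>\<exists>i\<^bold>\<in>j. is_opair q x i))) \<^bold>\<and>
        function_on g e \<^bold>\<and>
        (\<^bold>\<forall>q\<^bold>\<in>e. \<^bold>\<forall>c. maps_to g q c \<^bold>\<longrightarrow> c \<^bold>\<subseteq> s) \<^bold>\<and>
        (\<^bold>\<forall>a\<^bold>\<in>s. \<^bold>\<forall>U. U \<^bold>\<subseteq> s \<^bold>\<longrightarrow>
           (app2 \<gamma> a U \<^bold>\<longleftrightarrow>
             (\<^bold>\<exists>j. maps_to f a j \<^bold>\<and> (\<^bold>\<exists>i\<^bold>\<in>j. \<^bold>\<exists>q. is_opair q a i \<^bold>\<and>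
                (\<^bold>\<exists>c. maps_to g q c \<^bold>\<and> c \<^bold>\<subseteq> U))))))"

text \<open>A pair given by definitions in \<open>T\<close>: closed formulas-in-context \<open>\<sigma>(x)\<close>, which \<open>T\<close> proves to
  define a unique set, and \<open>\<gamma>(a,U)\<close>.\<close>

definition czf_defined :: "fm set \<Rightarrow> fm \<Rightarrow> fm \<Rightarrow> bool" where
  "czf_defined T \<sigma> \<gamma> \<longleftrightarrow> fv \<sigma> \<subseteq> {0} \<and> fv \<gamma> \<subseteq> {0, 1} \<and> proves T (\<^bold>\<exists>\<^bold>!s. app1 \<sigma> s)"

definition czf_proves_of :: "fm set \<Rightarrow> fm \<Rightarrow> fm \<Rightarrow> (fm \<Rightarrow> var \<Rightarrow> form) \<Rightarrow> bool" where
  "czf_proves_of T \<sigma> \<gamma> Q \<longleftrightarrow> proves T (\<^bold>\<forall>s. app1 \<sigma> s \<^bold>\<longrightarrow> Q \<gamma> s)"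

definition czf_case_i :: "fm set \<Rightarrow> fm \<Rightarrow> fm \<Rightarrow> bool" where
  "czf_case_i T \<sigma> \<gamma> \<longleftrightarrow> czf_defined T \<sigma> \<gamma> \<and>
     czf_proves_of T \<sigma> \<gamma> formal_space \<and> czf_proves_of T \<sigma> \<gamma> non_trivial \<and>
     czf_proves_of T \<sigma> \<gamma> boolean_space"

definition czf_case_ii :: "fm set \<Rightarrow> fm \<Rightarrow> fm \<Rightarrow> bool" where
  "czf_case_ii T \<sigma> \<gamma> \<longleftrightarrow> czf_defined T \<sigma> \<gamma> \<and>
     czf_proves_of T \<sigma> \<gamma> formal_space \<and> czf_proves_of T \<sigma> \<gamma> non_trivial \<and>
     czf_proves_of T \<sigma> \<gamma> de_morgan_space \<and> czf_proves_of T \<sigma> \<gamma> decidable_empty_cover"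


section \<open>Martin-Loef's logical framework\<close>

text \<open>Constants: the sets of type theory (finite sets, \<open>\<nat>\<close>, \<open>\<Pi>\<close>, \<open>\<Sigma>\<close>, \<open>+\<close>, \<open>W\<close>, \<open>Id\<close>) with their
  introductory and eliminatory constants, a universe in the style of Tarski with codes for them, two constants
  for the uniformity principle, and a stock of names for extensions.\<close>

datatype con =
    Empty_C | EmptyRec
  | Unit_C | Star | UnitRec
  | Bool_C | TT | FF | BoolRec
  | Nat_C | Zero_C | Succ_C | NatRec
  | Pi_C | Lambda | Ap
  | Sigma_C | Pair_C | Split
  | Plus_C | Inl_C | Inr_C | When
  | W_C | Sup_C | WRec
  | Id_C | Refl | IdPeel
  | Univ | Dec
  | UEmpty | UUnit | UBool | UNat | UPi | USigma | UPlus | UW | UId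
  | GupWitness | GupProof
  | Extra nat

text \<open>De Bruijn terms; abstraction is domain-free. Types are \<open>Set\<close>, \<open>El A\<close> and \<open>(x : \<alpha>) \<beta>\<close>.\<close>

datatype trm = Var nat | Con con | App trm trm | Lam trm

datatype ty = SetT | El trm | Fun ty ty

primrec ren :: "(nat \<Rightarrow> nat) \<Rightarrow> trm \<Rightarrow> trm" where
  "ren r (Var i) = Var (r i)"
| "ren r (Con c) = Con c"
| "ren r (App t u) = App (ren r t) (ren r u)"
| "ren r (Lam t) = Lam (ren (case_nat 0 (Suc \<circ> r)) t)"

definition lift_sub :: "(nat \<Rightarrow> trm) \<Rightarrow> nat \<Rightarrow> trm" where
  "lift_sub \<theta> = case_nat (Var 0) (ren Suc \<circ> \<theta>)"

primrec sub :: "(nat \<Rightarrow> trm) \<Rightarrow> trm \<Rightarrow> trm" where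
  "sub \<theta> (Var i) = \<theta> i"
| "sub \<theta> (Con c) = Con c"
| "sub \<theta> (App t u) = App (sub \<theta> t) (sub \<theta> u)"
| "sub \<theta> (Lam t) = Lam (sub (lift_sub \<theta>) t)"

primrec sub_ty :: "(nat \<Rightarrow> trm) \<Rightarrow> ty \<Rightarrow> ty" where
  "sub_ty \<theta> SetT = SetT"
| "sub_ty \<theta> (El A) = El (sub \<theta> A)"
| "sub_ty \<theta> (Fun \<alpha> \<beta>) = Fun (sub_ty \<theta> \<alpha>) (sub_ty (lift_sub \<theta>) \<beta>)"

datatype jdg =
    IsCtx
  | IsTy ty
  | EqTy ty ty
  | HasTy trm ty
  | EqTm trm trm ty

primrec sub_jdg :: "(nat \<Rightarrow> trm) \<Rightarrow> jdg \<Rightarrow> jdg" where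
  "sub_jdg \<theta> IsCtx = IsCtx"
| "sub_jdg \<theta> (IsTy \<alpha>) = IsTy (sub_ty \<theta> \<alpha>)"
| "sub_jdg \<theta> (EqTy \<alpha> \<beta>) = EqTy (sub_ty \<theta> \<alpha>) (sub_ty \<theta> \<beta>)"
| "sub_jdg \<theta> (HasTy a \<alpha>) = HasTy (sub \<theta> a) (sub_ty \<theta> \<alpha>)"
| "sub_jdg \<theta> (EqTm a b \<alpha>) = EqTm (sub \<theta> a) (sub \<theta> b) (sub_ty \<theta> \<alpha>)"

definition shift :: "nat \<Rightarrow> nat \<Rightarrow> trm" where
  "shift n = (\<lambda>k. Var (k + n))"
definition single :: "trm \<Rightarrow> nat \<Rightarrow> trm" where
  "single a = case_nat a Var"

text \<open>A theory in the framework is given by typed constants and by equations between closed terms.\<close>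

datatype axm = Decl con ty | Eqn trm trm ty

text \<open>\<open>der T G J\<close>: the judgment \<open>J\<close> is derivable in context \<open>G\<close>, whose head is the most recently
  declared variable.\<close>

inductive der :: "axm set \<Rightarrow> ty list \<Rightarrow> jdg \<Rightarrow> bool" for T :: "axm set" where
  CtxNil: "der T [] IsCtx"
| CtxCons: "der T G (IsTy \<alpha>) \<Longrightarrow> der T (\<alpha> # G) IsCtx"
| Const: "der T G IsCtx \<Longrightarrow> Decl c \<alpha> \<in> T \<Longrightarrow> der T G (HasTy (Con c) \<alpha>)"
| Equation: "der T G IsCtx \<Longrightarrow> Eqn a b \<alpha> \<in> T \<Longrightarrow> der T G (EqTm a b \<alpha>)"
| VarR: "der T G IsCtx \<Longrightarrow> i < length G \<Longrightarrow>
    der T G (HasTy (Var i) (sub_ty (shift (Suc i)) (G ! i)))"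
| SetF: "der T G IsCtx \<Longrightarrow> der T G (IsTy SetT)"
| ElF: "der T G (HasTy A SetT) \<Longrightarrow> der T G (IsTy (El A))"
| ElEq: "der T G (EqTm A B SetT) \<Longrightarrow> der T G (EqTy (El A) (El B))"
| FunF: "der T G (IsTy \<alpha>) \<Longrightarrow> der T (\<alpha> # G) (IsTy \<beta>) \<Longrightarrow> der T G (IsTy (Fun \<alpha> \<beta>))"
| FunEq: "der T G (EqTy \<alpha> \<alpha>') \<Longrightarrow> der T (\<alpha> # G) (EqTy \<beta> \<beta>') \<Longrightarrow>
    der T G (EqTy (Fun \<alpha> \<beta>) (Fun \<alpha>' \<beta>'))"
| TyRefl: "der T G (IsTy \<alpha>) \<Longrightarrow> der T G (EqTy \<alpha> \<alpha>)"
| TySym: "der T G (EqTy \<alpha> \<beta>) \<Longrightarrow> der T G (EqTy \<beta> \<alpha>)"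
| TyTrans: "der T G (EqTy \<alpha> \<beta>) \<Longrightarrow> der T G (EqTy \<beta> \<delta>) \<Longrightarrow> der T G (EqTy \<alpha> \<delta>)"
| TmRefl: "der T G (HasTy a \<alpha>) \<Longrightarrow> der T G (EqTm a a \<alpha>)"
| TmSym: "der T G (EqTm a b \<alpha>) \<Longrightarrow> der T G (EqTm b a \<alpha>)"
| TmTrans: "der T G (EqTm a b \<alpha>) \<Longrightarrow> der T G (EqTm b c \<alpha>) \<Longrightarrow> der T G (EqTm a c \<alpha>)"
| HasConv: "der T G (HasTy a \<alpha>) \<Longrightarrow> der T G (EqTy \<alpha> \<beta>) \<Longrightarrow> der T G (HasTy a \<beta>)"
| EqConv: "der T G (EqTm a b \<alpha>) \<Longrightarrow> der T G (EqTy \<alpha> \<beta>) \<Longrightarrow> der T G (EqTm a b \<beta>)"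
| LamR: "der T (\<alpha> # G) (HasTy b \<beta>) \<Longrightarrow> der T G (HasTy (Lam b) (Fun \<alpha> \<beta>))"
| LamEq: "der T (\<alpha> # G) (EqTm b b' \<beta>) \<Longrightarrow> der T G (EqTm (Lam b) (Lam b') (Fun \<alpha> \<beta>))"
| AppR: "der T G (HasTy f (Fun \<alpha> \<beta>)) \<Longrightarrow> der T G (HasTy a \<alpha>) \<Longrightarrow>
    der T G (HasTy (App f a) (sub_ty (single a) \<beta>))"
| AppEq: "der T G (EqTm f f' (Fun \<alpha> \<beta>)) \<Longrightarrow> der T G (EqTm a a' \<alpha>) \<Longrightarrow>
    der T G (EqTm (App f a) (App f' a') (sub_ty (single a) \<beta>))"
| Beta: "der T (\<alpha> # G) (HasTy b \<beta>) \<Longrightarrow> der T G (HasTy a \<alpha>) \<Longrightarrow>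
    der T G (EqTm (App (Lam b) a) (sub (single a) b) (sub_ty (single a) \<beta>))"
| Eta: "der T G (HasTy f (Fun \<alpha> \<beta>)) \<Longrightarrow>
    der T G (EqTm (Lam (App (sub (shift 1) f) (Var 0))) f (Fun \<alpha> \<beta>))"
| Thin: "der T G J \<Longrightarrow> der T G (IsTy \<alpha>) \<Longrightarrow> der T (\<alpha> # G) (sub_jdg (shift 1) J)"
| Subst: "der T (\<alpha> # G) J \<Longrightarrow> der T G (HasTy a \<alpha>) \<Longrightarrow> der T G (sub_jdg (single a) J)"
| SubstEqTy: "der T (\<alpha> # G) (IsTy \<beta>) \<Longrightarrow> der T G (EqTm a a' \<alpha>) \<Longrightarrow>
    der T G (EqTy (sub_ty (single a) \<beta>) (sub_ty (single a') \<beta>))"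
| SubstEqTm: "der T (\<alpha> # G) (HasTy b \<beta>) \<Longrightarrow> der T G (EqTm a a' \<alpha>) \<Longrightarrow>
    der T G (EqTm (sub (single a) b) (sub (single a') b) (sub_ty (single a) \<beta>))"

text \<open>Every declared type is a type, and both sides of every equation have the stated type.\<close>

definition theory_ok :: "axm set \<Rightarrow> bool" where
  "theory_ok T \<longleftrightarrow>
     (\<forall>c \<alpha>. Decl c \<alpha> \<in> T \<longrightarrow> der T [] (IsTy \<alpha>)) \<and>
     (\<forall>a b \<alpha>. Eqn a b \<alpha> \<in> T \<longrightarrow> der T [] (HasTy a \<alpha>) \<and> der T [] (HasTy b \<alpha>))"

text \<open>Named-variable notation for terms and types, as for formulas above.\<close>

type_synonym term' = "nat \<Rightarrow> trm"
type_synonym type' = "nat \<Rightarrow> ty"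

definition tbound :: "nat \<Rightarrow> term'" where "tbound d = (\<lambda>d'. Var (d' - Suc d))"

text \<open>A closed term is the same at every depth.\<close>

definition closed :: "trm \<Rightarrow> term'" where "closed t = (\<lambda>d. t)"

definition cn :: "con \<Rightarrow> term'" where "cn c = closed (Con c)"
definition tapp :: "term' \<Rightarrow> term' \<Rightarrow> term'" (infixl "\<cdot>" 90) where
  "f \<cdot> a = (\<lambda>d. App (f d) (a d))"
definition tlam :: "(term' \<Rightarrow> term') \<Rightarrow> term'" (binder "\<^bold>\<lambda>" 10) where
  "tlam F = (\<lambda>d. Lam (F (tbound d) (Suc d)))"

definition set' :: type' where "set' = (\<lambda>d. SetT)"
definition el :: "term' \<Rightarrow> type'" where "el A = (\<lambda>d. El (A d))"
definition dep :: "type' \<Rightarrow> (term' \<Rightarrow> type') \<Rightarrow> type'" where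
  "dep \<alpha> F = (\<lambda>d. Fun (\<alpha> d) (F (tbound d) (Suc d)))"
definition arr :: "type' \<Rightarrow> type' \<Rightarrow> type'" (infixr "\<^bold>\<rightarrow>" 15) where
  "(\<alpha> \<^bold>\<rightarrow> \<beta>) = dep \<alpha> (\<lambda>_. \<beta>)"

syntax
  "_dep" :: "pttrn \<Rightarrow> type' \<Rightarrow> type' \<Rightarrow> type'" ("(3\<^bold>\<Pi>_\<^bold>:_./ _)" [0, 16, 10] 10)
translations
  "\<^bold>\<Pi>x\<^bold>:\<alpha>. \<beta>" \<rightleftharpoons> "CONST dep \<alpha> (\<lambda>x. \<beta>)"

definition inhabited :: "axm set \<Rightarrow> type' \<Rightarrow> bool" where
  "inhabited T \<alpha> \<longleftrightarrow> (\<exists>t. der T [] (HasTy t (\<alpha> 0)))"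

definition ctt_consistent :: "axm set \<Rightarrow> bool" where
  "ctt_consistent T \<longleftrightarrow> \<not> inhabited T (el (cn Empty_C))"


section \<open>Constructive type theory\<close>

definition decl :: "con \<Rightarrow> type' \<Rightarrow> axm" where
  "decl c \<alpha> = Decl c (\<alpha> 0)"
definition eqn :: "term' \<Rightarrow> term' \<Rightarrow> type' \<Rightarrow> axm" where
  "eqn a b \<alpha> = Eqn (a 0) (b 0) (\<alpha> 0)"

definition PiS :: "term' \<Rightarrow> (term' \<Rightarrow> term') \<Rightarrow> term'" where
  "PiS A B = cn Pi_C \<cdot> A \<cdot> (\<^bold>\<lambda>x. B x)"
definition SigmaS :: "term' \<Rightarrow> (term' \<Rightarrow> term') \<Rightarrow> term'" where
  "SigmaS A B = cn Sigma_C \<cdot> A \<cdot> (\<^bold>\<lambda>x. B x)"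
definition WS :: "term' \<Rightarrow> (term' \<Rightarrow> term') \<Rightarrow> term'" where
  "WS A B = cn W_C \<cdot> A \<cdot> (\<^bold>\<lambda>x. B x)"
definition IdS :: "term' \<Rightarrow> term' \<Rightarrow> term' \<Rightarrow> term'" where
  "IdS A a b = cn Id_C \<cdot> A \<cdot> a \<cdot> b"

definition ctt_finite :: "axm set" where
  "ctt_finite = {
     decl Empty_C set',
     decl EmptyRec (\<^bold>\<Pi>C\<^bold>:(el (cn Empty_C) \<^bold>\<rightarrow> set'). \<^bold>\<Pi>x\<^bold>:el (cn Empty_C). el (C \<cdot> x)),
     decl Unit_C set',
     decl Star (el (cn Unit_C)),
     decl UnitRec (\<^bold>\<Pi>C\<^bold>:(el (cn Unit_C) \<^bold>\<rightarrow> set').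
       el (C \<cdot> cn Star) \<^bold>\<rightarrow> (\<^bold>\<Pi>x\<^bold>:el (cn Unit_C). el (C \<cdot> x))),
     eqn (\<^bold>\<lambda>C. \<^bold>\<lambda>c. cn UnitRec \<cdot> C \<cdot> c \<cdot> cn Star) (\<^bold>\<lambda>C. \<^bold>\<lambda>c. c)
       (\<^bold>\<Pi>C\<^bold>:(el (cn Unit_C) \<^bold>\<rightarrow> set'). el (C \<cdot> cn Star) \<^bold>\<rightarrow> el (C \<cdot> cn Star)),
     decl Bool_C set',
     decl TT (el (cn Bool_C)),
     decl FF (el (cn Bool_C)),
     decl BoolRec (\<^bold>\<Pi>C\<^bold>:(el (cn Bool_C) \<^bold>\<rightarrow> set').
       el (C \<cdot> cn TT) \<^bold>\<rightarrow> el (C \<cdot> cn FF) \<^bold>\<rightarrow> (\<^bold>\<Pi>x\<^bold>:el (cn Bool_C). el (C \<cdot> x))),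
     eqn (\<^bold>\<lambda>C. \<^bold>\<lambda>c. \<^bold>\<lambda>d. cn BoolRec \<cdot> C \<cdot> c \<cdot> d \<cdot> cn TT) (\<^bold>\<lambda>C. \<^bold>\<lambda>c. \<^bold>\<lambda>d. c)
       (\<^bold>\<Pi>C\<^bold>:(el (cn Bool_C) \<^bold>\<rightarrow> set').
         el (C \<cdot> cn TT) \<^bold>\<rightarrow> el (C \<cdot> cn FF) \<^bold>\<rightarrow> el (C \<cdot> cn TT)),
     eqn (\<^bold>\<lambda>C. \<^bold>\<lambda>c. \<^bold>\<lambda>d. cn BoolRec \<cdot> C \<cdot> c \<cdot> d \<cdot> cn FF) (\<^bold>\<lambda>C. \<^bold>\<lambda>c. \<^bold>\<lambda>d. d)
       (\<^bold>\<Pi>C\<^bold>:(el (cn Bool_C) \<^bold>\<rightarrow> set').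
         el (C \<cdot> cn TT) \<^bold>\<rightarrow> el (C \<cdot> cn FF) \<^bold>\<rightarrow> el (C \<cdot> cn FF))}"

definition natrec_step :: "term' \<Rightarrow> type'" where
  "natrec_step C = (\<^bold>\<Pi>n\<^bold>:el (cn Nat_C). el (C \<cdot> n) \<^bold>\<rightarrow> el (C \<cdot> (cn Succ_C \<cdot> n)))"

definition ctt_nat :: "axm set" where
  "ctt_nat = {
     decl Nat_C set',
     decl Zero_C (el (cn Nat_C)),
     decl Succ_C (el (cn Nat_C) \<^bold>\<rightarrow> el (cn Nat_C)),
     decl NatRec (\<^bold>\<Pi>C\<^bold>:(el (cn Nat_C) \<^bold>\<rightarrow> set').
       el (C \<cdot> cn Zero_C) \<^bold>\<rightarrow> natrec_step C \<^bold>\<rightarrow> (\<^bold>\<Pi>n\<^bold>:el (cn Nat_C). el (C \<cdot> n))),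
     eqn (\<^bold>\<lambda>C. \<^bold>\<lambda>c. \<^bold>\<lambda>e. cn NatRec \<cdot> C \<cdot> c \<cdot> e \<cdot> cn Zero_C) (\<^bold>\<lambda>C. \<^bold>\<lambda>c. \<^bold>\<lambda>e. c)
       (\<^bold>\<Pi>C\<^bold>:(el (cn Nat_C) \<^bold>\<rightarrow> set').
         el (C \<cdot> cn Zero_C) \<^bold>\<rightarrow> natrec_step C \<^bold>\<rightarrow> el (C \<cdot> cn Zero_C)),
     eqn (\<^bold>\<lambda>C. \<^bold>\<lambda>c. \<^bold>\<lambda>e. \<^bold>\<lambda>n. cn NatRec \<cdot> C \<cdot> c \<cdot> e \<cdot> (cn Succ_C \<cdot> n))
       (\<^bold>\<lambda>C. \<^bold>\<lambda>c. \<^bold>\<lambda>e. \<^bold>\<lambda>n. e \<cdot> n \<cdot> (cn NatRec \<cdot> C \<cdot> c \<cdot> e \<cdot> n))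
       (\<^bold>\<Pi>C\<^bold>:(el (cn Nat_C) \<^bold>\<rightarrow> set'). el (C \<cdot> cn Zero_C) \<^bold>\<rightarrow> natrec_step C \<^bold>\<rightarrow>
         (\<^bold>\<Pi>n\<^bold>:el (cn Nat_C). el (C \<cdot> (cn Succ_C \<cdot> n))))}"

definition ctt_pi :: "axm set" where
  "ctt_pi = {
     decl Pi_C (\<^bold>\<Pi>A\<^bold>:set'. (el A \<^bold>\<rightarrow> set') \<^bold>\<rightarrow> set'),
     decl Lambda (\<^bold>\<Pi>A\<^bold>:set'. \<^bold>\<Pi>B\<^bold>:(el A \<^bold>\<rightarrow> set').
       (\<^bold>\<Pi>x\<^bold>:el A. el (B \<cdot> x)) \<^bold>\<rightarrow> el (cn Pi_C \<cdot> A \<cdot> B)),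
     decl Ap (\<^bold>\<Pi>A\<^bold>:set'. \<^bold>\<Pi>B\<^bold>:(el A \<^bold>\<rightarrow> set').
       el (cn Pi_C \<cdot> A \<cdot> B) \<^bold>\<rightarrow> (\<^bold>\<Pi>x\<^bold>:el A. el (B \<cdot> x))),
     eqn (\<^bold>\<lambda>A. \<^bold>\<lambda>B. \<^bold>\<lambda>b. \<^bold>\<lambda>x. cn Ap \<cdot> A \<cdot> B \<cdot> (cn Lambda \<cdot> A \<cdot> B \<cdot> b) \<cdot> x) (\<^bold>\<lambda>A. \<^bold>\<lambda>B. \<^bold>\<lambda>b. \<^bold>\<lambda>x. b \<cdot> x)
       (\<^bold>\<Pi>A\<^bold>:set'. \<^bold>\<Pi>B\<^bold>:(el A \<^bold>\<rightarrow> set').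
         (\<^bold>\<Pi>x\<^bold>:el A. el (B \<cdot> x)) \<^bold>\<rightarrow> (\<^bold>\<Pi>x\<^bold>:el A. el (B \<cdot> x)))}"

definition split_arg :: "term' \<Rightarrow> term' \<Rightarrow> term' \<Rightarrow> type'" where
  "split_arg A B C = (\<^bold>\<Pi>x\<^bold>:el A. \<^bold>\<Pi>y\<^bold>:el (B \<cdot> x). el (C \<cdot> (cn Pair_C \<cdot> A \<cdot> B \<cdot> x \<cdot> y)))"

definition ctt_sigma :: "axm set" where
  "ctt_sigma = {
     decl Sigma_C (\<^bold>\<Pi>A\<^bold>:set'. (el A \<^bold>\<rightarrow> set') \<^bold>\<rightarrow> set'),
     decl Pair_C (\<^bold>\<Pi>A\<^bold>:set'. \<^bold>\<Pi>B\<^bold>:(el A \<^bold>\<rightarrow> set').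
       \<^bold>\<Pi>x\<^bold>:el A. el (B \<cdot> x) \<^bold>\<rightarrow> el (cn Sigma_C \<cdot> A \<cdot> B)),
     decl Split (\<^bold>\<Pi>A\<^bold>:set'. \<^bold>\<Pi>B\<^bold>:(el A \<^bold>\<rightarrow> set').
       \<^bold>\<Pi>C\<^bold>:(el (cn Sigma_C \<cdot> A \<cdot> B) \<^bold>\<rightarrow> set').
       split_arg A B C \<^bold>\<rightarrow> (\<^bold>\<Pi>p\<^bold>:el (cn Sigma_C \<cdot> A \<cdot> B). el (C \<cdot> p))),
     eqn (\<^bold>\<lambda>A. \<^bold>\<lambda>B. \<^bold>\<lambda>C. \<^bold>\<lambda>e. \<^bold>\<lambda>x. \<^bold>\<lambda>y. cn Split \<cdot> A \<cdot> B \<cdot> C \<cdot> e \<cdot> (cn Pair_C \<cdot> A \<cdot> B \<cdot> x \<cdot> y))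
       (\<^bold>\<lambda>A. \<^bold>\<lambda>B. \<^bold>\<lambda>C. \<^bold>\<lambda>e. \<^bold>\<lambda>x. \<^bold>\<lambda>y. e \<cdot> x \<cdot> y)
       (\<^bold>\<Pi>A\<^bold>:set'. \<^bold>\<Pi>B\<^bold>:(el A \<^bold>\<rightarrow> set'). \<^bold>\<Pi>C\<^bold>:(el (cn Sigma_C \<cdot> A \<cdot> B) \<^bold>\<rightarrow> set').
         split_arg A B C \<^bold>\<rightarrow> split_arg A B C)}"

definition when_arg :: "(term' \<Rightarrow> term') \<Rightarrow> term' \<Rightarrow> term' \<Rightarrow> type'" where
  "when_arg j A C = (\<^bold>\<Pi>x\<^bold>:el A. el (C \<cdot> j x))"

definition ctt_plus :: "axm set" where
  "ctt_plus = {
     decl Plus_C (set' \<^bold>\<rightarrow> set' \<^bold>\<rightarrow> set'),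
     decl Inl_C (\<^bold>\<Pi>A\<^bold>:set'. \<^bold>\<Pi>B\<^bold>:set'. el A \<^bold>\<rightarrow> el (cn Plus_C \<cdot> A \<cdot> B)),
     decl Inr_C (\<^bold>\<Pi>A\<^bold>:set'. \<^bold>\<Pi>B\<^bold>:set'. el B \<^bold>\<rightarrow> el (cn Plus_C \<cdot> A \<cdot> B)),
     decl When (\<^bold>\<Pi>A\<^bold>:set'. \<^bold>\<Pi>B\<^bold>:set'. \<^bold>\<Pi>C\<^bold>:(el (cn Plus_C \<cdot> A \<cdot> B) \<^bold>\<rightarrow> set').
       when_arg (\<lambda>x. cn Inl_C \<cdot> A \<cdot> B \<cdot> x) A C \<^bold>\<rightarrow>
       when_arg (\<lambda>x. cn Inr_C \<cdot> A \<cdot> B \<cdot> x) B C \<^bold>\<rightarrow>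
       (\<^bold>\<Pi>p\<^bold>:el (cn Plus_C \<cdot> A \<cdot> B). el (C \<cdot> p))),
     eqn (\<^bold>\<lambda>A. \<^bold>\<lambda>B. \<^bold>\<lambda>C. \<^bold>\<lambda>d. \<^bold>\<lambda>e. \<^bold>\<lambda>x. cn When \<cdot> A \<cdot> B \<cdot> C \<cdot> d \<cdot> e \<cdot> (cn Inl_C \<cdot> A \<cdot> B \<cdot> x))
       (\<^bold>\<lambda>A. \<^bold>\<lambda>B. \<^bold>\<lambda>C. \<^bold>\<lambda>d. \<^bold>\<lambda>e. \<^bold>\<lambda>x. d \<cdot> x)
       (\<^bold>\<Pi>A\<^bold>:set'. \<^bold>\<Pi>B\<^bold>:set'. \<^bold>\<Pi>C\<^bold>:(el (cn Plus_C \<cdot> A \<cdot> B) \<^bold>\<rightarrow> set').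
         when_arg (\<lambda>x. cn Inl_C \<cdot> A \<cdot> B \<cdot> x) A C \<^bold>\<rightarrow>
         when_arg (\<lambda>x. cn Inr_C \<cdot> A \<cdot> B \<cdot> x) B C \<^bold>\<rightarrow>
         when_arg (\<lambda>x. cn Inl_C \<cdot> A \<cdot> B \<cdot> x) A C),
     eqn (\<^bold>\<lambda>A. \<^bold>\<lambda>B. \<^bold>\<lambda>C. \<^bold>\<lambda>d. \<^bold>\<lambda>e. \<^bold>\<lambda>x. cn When \<cdot> A \<cdot> B \<cdot> C \<cdot> d \<cdot> e \<cdot> (cn Inr_C \<cdot> A \<cdot> B \<cdot> x))
       (\<^bold>\<lambda>A. \<^bold>\<lambda>B. \<^bold>\<lambda>C. \<^bold>\<lambda>d. \<^bold>\<lambda>e. \<^bold>\<lambda>x. e \<cdot> x)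
       (\<^bold>\<Pi>A\<^bold>:set'. \<^bold>\<Pi>B\<^bold>:set'. \<^bold>\<Pi>C\<^bold>:(el (cn Plus_C \<cdot> A \<cdot> B) \<^bold>\<rightarrow> set').
         when_arg (\<lambda>x. cn Inl_C \<cdot> A \<cdot> B \<cdot> x) A C \<^bold>\<rightarrow>
         when_arg (\<lambda>x. cn Inr_C \<cdot> A \<cdot> B \<cdot> x) B C \<^bold>\<rightarrow>
         when_arg (\<lambda>x. cn Inr_C \<cdot> A \<cdot> B \<cdot> x) B C)}"

definition wrec_arg :: "term' \<Rightarrow> term' \<Rightarrow> term' \<Rightarrow> type'" where
  "wrec_arg A B C =
     (\<^bold>\<Pi>x\<^bold>:el A. \<^bold>\<Pi>f\<^bold>:(el (B \<cdot> x) \<^bold>\<rightarrow> el (cn W_C \<cdot> A \<cdot> B)).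
        (\<^bold>\<Pi>y\<^bold>:el (B \<cdot> x). el (C \<cdot> (f \<cdot> y))) \<^bold>\<rightarrow> el (C \<cdot> (cn Sup_C \<cdot> A \<cdot> B \<cdot> x \<cdot> f)))"

definition ctt_w :: "axm set" where
  "ctt_w = {
     decl W_C (\<^bold>\<Pi>A\<^bold>:set'. (el A \<^bold>\<rightarrow> set') \<^bold>\<rightarrow> set'),
     decl Sup_C (\<^bold>\<Pi>A\<^bold>:set'. \<^bold>\<Pi>B\<^bold>:(el A \<^bold>\<rightarrow> set'). \<^bold>\<Pi>x\<^bold>:el A.
       (el (B \<cdot> x) \<^bold>\<rightarrow> el (cn W_C \<cdot> A \<cdot> B)) \<^bold>\<rightarrow> el (cn W_C \<cdot> A \<cdot> B)),
     decl WRec (\<^bold>\<Pi>A\<^bold>:set'. \<^bold>\<Pi>B\<^bold>:(el A \<^bold>\<rightarrow> set'). \<^bold>\<Pi>C\<^bold>:(el (cn W_C \<cdot> A \<cdot> B) \<^bold>\<rightarrow> set').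
       wrec_arg A B C \<^bold>\<rightarrow> (\<^bold>\<Pi>p\<^bold>:el (cn W_C \<cdot> A \<cdot> B). el (C \<cdot> p))),
     eqn (\<^bold>\<lambda>A. \<^bold>\<lambda>B. \<^bold>\<lambda>C. \<^bold>\<lambda>e. \<^bold>\<lambda>x. \<^bold>\<lambda>f. cn WRec \<cdot> A \<cdot> B \<cdot> C \<cdot> e \<cdot> (cn Sup_C \<cdot> A \<cdot> B \<cdot> x \<cdot> f))
       (\<^bold>\<lambda>A. \<^bold>\<lambda>B. \<^bold>\<lambda>C. \<^bold>\<lambda>e. \<^bold>\<lambda>x. \<^bold>\<lambda>f. e \<cdot> x \<cdot> f \<cdot> (\<^bold>\<lambda>y. cn WRec \<cdot> A \<cdot> B \<cdot> C \<cdot> e \<cdot> (f \<cdot> y)))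
       (\<^bold>\<Pi>A\<^bold>:set'. \<^bold>\<Pi>B\<^bold>:(el A \<^bold>\<rightarrow> set'). \<^bold>\<Pi>C\<^bold>:(el (cn W_C \<cdot> A \<cdot> B) \<^bold>\<rightarrow> set').
         wrec_arg A B C \<^bold>\<rightarrow>
         (\<^bold>\<Pi>x\<^bold>:el A. \<^bold>\<Pi>f\<^bold>:(el (B \<cdot> x) \<^bold>\<rightarrow> el (cn W_C \<cdot> A \<cdot> B)). el (C \<cdot> (cn Sup_C \<cdot> A \<cdot> B \<cdot> x \<cdot> f))))}"

definition idpeel_fam :: "term' \<Rightarrow> type'" where
  "idpeel_fam A = (\<^bold>\<Pi>x\<^bold>:el A. \<^bold>\<Pi>y\<^bold>:el A. el (IdS A x y) \<^bold>\<rightarrow> set')"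
definition idpeel_arg :: "term' \<Rightarrow> term' \<Rightarrow> type'" where
  "idpeel_arg A C = (\<^bold>\<Pi>x\<^bold>:el A. el (C \<cdot> x \<cdot> x \<cdot> (cn Refl \<cdot> A \<cdot> x)))"

definition ctt_id :: "axm set" where
  "ctt_id = {
     decl Id_C (\<^bold>\<Pi>A\<^bold>:set'. el A \<^bold>\<rightarrow> el A \<^bold>\<rightarrow> set'),
     decl Refl (\<^bold>\<Pi>A\<^bold>:set'. \<^bold>\<Pi>x\<^bold>:el A. el (IdS A x x)),
     decl IdPeel (\<^bold>\<Pi>A\<^bold>:set'. \<^bold>\<Pi>C\<^bold>:idpeel_fam A. idpeel_arg A C \<^bold>\<rightarrow>
       (\<^bold>\<Pi>x\<^bold>:el A. \<^bold>\<Pi>y\<^bold>:el A. \<^bold>\<Pi>p\<^bold>:el (IdS A x y). el (C \<cdot> x \<cdot> y \<cdot> p))),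
     eqn (\<^bold>\<lambda>A. \<^bold>\<lambda>C. \<^bold>\<lambda>e. \<^bold>\<lambda>x. cn IdPeel \<cdot> A \<cdot> C \<cdot> e \<cdot> x \<cdot> x \<cdot> (cn Refl \<cdot> A \<cdot> x))
       (\<^bold>\<lambda>A. \<^bold>\<lambda>C. \<^bold>\<lambda>e. \<^bold>\<lambda>x. e \<cdot> x)
       (\<^bold>\<Pi>A\<^bold>:set'. \<^bold>\<Pi>C\<^bold>:idpeel_fam A. idpeel_arg A C \<^bold>\<rightarrow> idpeel_arg A C)}"

text \<open>One universe, closed under the set formers; larger hierarchies are extensions. Some universe is
  indispensable: without one, everything has a model in which sets are truth values, where the
  uniformity principle and excluded middle both hold.\<close>

definition univ_fam :: "term' \<Rightarrow> type'" where
  "univ_fam a = (el (cn Dec \<cdot> a) \<^bold>\<rightarrow> el (cn Univ))"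

definition ctt_univ :: "axm set" where
  "ctt_univ = {
     decl Univ set',
     decl Dec (el (cn Univ) \<^bold>\<rightarrow> set'),
     decl UEmpty (el (cn Univ)),
     decl UUnit (el (cn Univ)),
     decl UBool (el (cn Univ)),
     decl UNat (el (cn Univ)),
     decl UPi (\<^bold>\<Pi>a\<^bold>:el (cn Univ). univ_fam a \<^bold>\<rightarrow> el (cn Univ)),
     decl USigma (\<^bold>\<Pi>a\<^bold>:el (cn Univ). univ_fam a \<^bold>\<rightarrow> el (cn Univ)),
     decl UW (\<^bold>\<Pi>a\<^bold>:el (cn Univ). univ_fam a \<^bold>\<rightarrow> el (cn Univ)),
     decl UPlus (el (cn Univ) \<^bold>\<rightarrow> el (cn Univ) \<^bold>\<rightarrow> el (cn Univ)),
     decl UId (\<^bold>\<Pi>a\<^bold>:el (cn Univ). el (cn Dec \<cdot> a) \<^bold>\<rightarrow> el (cn Dec \<cdot> a) \<^bold>\<rightarrow> el (cn Univ)),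
     eqn (cn Dec \<cdot> cn UEmpty) (cn Empty_C) set',
     eqn (cn Dec \<cdot> cn UUnit) (cn Unit_C) set',
     eqn (cn Dec \<cdot> cn UBool) (cn Bool_C) set',
     eqn (cn Dec \<cdot> cn UNat) (cn Nat_C) set',
     eqn (\<^bold>\<lambda>a. \<^bold>\<lambda>b. cn Dec \<cdot> (cn UPi \<cdot> a \<cdot> b)) (\<^bold>\<lambda>a. \<^bold>\<lambda>b. PiS (cn Dec \<cdot> a) (\<lambda>x. cn Dec \<cdot> (b \<cdot> x)))
       (\<^bold>\<Pi>a\<^bold>:el (cn Univ). univ_fam a \<^bold>\<rightarrow> set'),
     eqn (\<^bold>\<lambda>a. \<^bold>\<lambda>b. cn Dec \<cdot> (cn USigma \<cdot> a \<cdot> b)) (\<^bold>\<lambda>a. \<^bold>\<lambda>b. SigmaS (cn Dec \<cdot> a) (\<lambda>x. cn Dec \<cdot> (b \<cdot> x)))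
       (\<^bold>\<Pi>a\<^bold>:el (cn Univ). univ_fam a \<^bold>\<rightarrow> set'),
     eqn (\<^bold>\<lambda>a. \<^bold>\<lambda>b. cn Dec \<cdot> (cn UW \<cdot> a \<cdot> b)) (\<^bold>\<lambda>a. \<^bold>\<lambda>b. WS (cn Dec \<cdot> a) (\<lambda>x. cn Dec \<cdot> (b \<cdot> x)))
       (\<^bold>\<Pi>a\<^bold>:el (cn Univ). univ_fam a \<^bold>\<rightarrow> set'),
     eqn (\<^bold>\<lambda>a. \<^bold>\<lambda>b. cn Dec \<cdot> (cn UPlus \<cdot> a \<cdot> b)) (\<^bold>\<lambda>a. \<^bold>\<lambda>b. cn Plus_C \<cdot> (cn Dec \<cdot> a) \<cdot> (cn Dec \<cdot> b))
       (el (cn Univ) \<^bold>\<rightarrow> el (cn Univ) \<^bold>\<rightarrow> set'),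
     eqn (\<^bold>\<lambda>a. \<^bold>\<lambda>x. \<^bold>\<lambda>y. cn Dec \<cdot> (cn UId \<cdot> a \<cdot> x \<cdot> y)) (\<^bold>\<lambda>a. \<^bold>\<lambda>x. \<^bold>\<lambda>y. IdS (cn Dec \<cdot> a) x y)
       (\<^bold>\<Pi>a\<^bold>:el (cn Univ). el (cn Dec \<cdot> a) \<^bold>\<rightarrow> el (cn Dec \<cdot> a) \<^bold>\<rightarrow> set')}"

definition CTT :: "axm set" where
  "CTT = ctt_finite \<union> ctt_nat \<union> ctt_pi \<union> ctt_sigma \<union> ctt_plus \<union> ctt_w \<union> ctt_id \<union> ctt_univ"

text \<open>Propositions are sets. As the quantification over all propositions is not itself a set, the
  principle cannot be a single proposition; it is stated by constants that yield, from \<open>I\<close>, \<open>R\<close>, \<open>F\<close>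
  and a proof of \<open>R(P,F(P))\<close> for all \<open>P\<close>, the element of \<open>I\<close> and the proofs that it works.\<close>

definition GUP_CTT :: "axm set" where
  "GUP_CTT = {
     decl GupWitness (\<^bold>\<Pi>I\<^bold>:set'. \<^bold>\<Pi>R\<^bold>:(set' \<^bold>\<rightarrow> el I \<^bold>\<rightarrow> set'). \<^bold>\<Pi>F\<^bold>:(set' \<^bold>\<rightarrow> el I).
       (\<^bold>\<Pi>P\<^bold>:set'. el (R \<cdot> P \<cdot> (F \<cdot> P))) \<^bold>\<rightarrow> el I),
     decl GupProof (\<^bold>\<Pi>I\<^bold>:set'. \<^bold>\<Pi>R\<^bold>:(set' \<^bold>\<rightarrow> el I \<^bold>\<rightarrow> set'). \<^bold>\<Pi>F\<^bold>:(set' \<^bold>\<rightarrow> el I).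
       \<^bold>\<Pi>r\<^bold>:(\<^bold>\<Pi>P\<^bold>:set'. el (R \<cdot> P \<cdot> (F \<cdot> P))).
       \<^bold>\<Pi>P\<^bold>:set'. el (R \<cdot> P \<cdot> (cn GupWitness \<cdot> I \<cdot> R \<cdot> F \<cdot> r)))}"

definition CTT_star :: "axm set \<Rightarrow> bool" where
  "CTT_star T \<longleftrightarrow> CTT \<subseteq> T \<and> theory_ok T \<and> ctt_consistent (T \<union> GUP_CTT)"


section \<open>Formal spaces in CTT\<close>

text \<open>Propositions as sets; subsets of \<open>S\<close> are propositional functions on \<open>S\<close>.\<close>

definition imp_S :: "term' \<Rightarrow> term' \<Rightarrow> term'" where
  "imp_S A B = PiS A (\<lambda>_. B)"
definition and_S :: "term' \<Rightarrow> term' \<Rightarrow> term'" where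
  "and_S A B = SigmaS A (\<lambda>_. B)"
definition or_S :: "term' \<Rightarrow> term' \<Rightarrow> term'" where
  "or_S A B = cn Plus_C \<cdot> A \<cdot> B"
definition not_S :: "term' \<Rightarrow> term'" where
  "not_S A = imp_S A (cn Empty_C)"
definition iff_S :: "term' \<Rightarrow> term' \<Rightarrow> term'" where
  "iff_S A B = and_S (imp_S A B) (imp_S B A)"

definition subset_ty :: "term' \<Rightarrow> type'" where
  "subset_ty S = (el S \<^bold>\<rightarrow> set')"

definition sub_S :: "term' \<Rightarrow> term' \<Rightarrow> term' \<Rightarrow> term'" where
  "sub_S S U V = PiS S (\<lambda>x. imp_S (U \<cdot> x) (V \<cdot> x))"

definition empty_S :: term' where
  "empty_S = (\<^bold>\<lambda>x. cn Empty_C)"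
definition single_S :: "term' \<Rightarrow> term' \<Rightarrow> term'" where
  "single_S S a = (\<^bold>\<lambda>x. IdS S x a)"
definition union_S :: "term' \<Rightarrow> term' \<Rightarrow> term'" where
  "union_S U V = (\<^bold>\<lambda>x. or_S (U \<cdot> x) (V \<cdot> x))"

definition cov_S :: "term' \<Rightarrow> term' \<Rightarrow> term' \<Rightarrow> term' \<Rightarrow> term'" where
  "cov_S S R U V = PiS S (\<lambda>u. imp_S (U \<cdot> u) (R \<cdot> u \<cdot> V))"

definition down_S :: "term' \<Rightarrow> term' \<Rightarrow> term' \<Rightarrow> term' \<Rightarrow> term'" where
  "down_S S R U V = (\<^bold>\<lambda>d. and_S
     (SigmaS S (\<lambda>u. and_S (U \<cdot> u) (R \<cdot> d \<cdot> single_S S u)))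
     (SigmaS S (\<lambda>v. and_S (V \<cdot> v) (R \<cdot> d \<cdot> single_S S v))))"

definition pseudo_S :: "term' \<Rightarrow> term' \<Rightarrow> term' \<Rightarrow> term'" where
  "pseudo_S S R U = (\<^bold>\<lambda>a. cov_S S R (down_S S R (single_S S a) U) empty_S)"

definition ctt_formal_space :: "axm set \<Rightarrow> trm \<Rightarrow> trm \<Rightarrow> bool" where
  "ctt_formal_space T s r \<longleftrightarrow> (let S = closed s; R = closed r in
     der T [] (HasTy s SetT) \<and>
     der T [] (HasTy r ((el S \<^bold>\<rightarrow> subset_ty S \<^bold>\<rightarrow> set') 0)) \<and>
     inhabited T (\<^bold>\<Pi>a\<^bold>:el S. \<^bold>\<Pi>U\<^bold>:subset_ty S. el (imp_S (U \<cdot> a) (R \<cdot> a \<cdot> U))) \<and>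
     inhabited T (\<^bold>\<Pi>a\<^bold>:el S. \<^bold>\<Pi>U\<^bold>:subset_ty S. \<^bold>\<Pi>V\<^bold>:subset_ty S.
       el (imp_S (R \<cdot> a \<cdot> U) (imp_S (cov_S S R U V) (R \<cdot> a \<cdot> V)))) \<and>
     inhabited T (\<^bold>\<Pi>a\<^bold>:el S. \<^bold>\<Pi>U\<^bold>:subset_ty S. \<^bold>\<Pi>V\<^bold>:subset_ty S.
       el (imp_S (R \<cdot> a \<cdot> U) (imp_S (R \<cdot> a \<cdot> V) (R \<cdot> a \<cdot> down_S S R U V)))))"

definition ctt_non_trivial :: "axm set \<Rightarrow> trm \<Rightarrow> trm \<Rightarrow> bool" where
  "ctt_non_trivial T s r \<longleftrightarrow> (let S = closed s; R = closed r in
     inhabited T (el (not_S (PiS S (\<lambda>a. R \<cdot> a \<cdot> empty_S)))))"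

definition ctt_boolean :: "axm set \<Rightarrow> trm \<Rightarrow> trm \<Rightarrow> bool" where
  "ctt_boolean T s r \<longleftrightarrow> (let S = closed s; R = closed r in
     inhabited T (\<^bold>\<Pi>U\<^bold>:subset_ty S. el (PiS S (\<lambda>a. R \<cdot> a \<cdot> union_S U (pseudo_S S R U)))))"

definition ctt_de_morgan :: "axm set \<Rightarrow> trm \<Rightarrow> trm \<Rightarrow> bool" where
  "ctt_de_morgan T s r \<longleftrightarrow> (let S = closed s; R = closed r in
     inhabited T (\<^bold>\<Pi>U\<^bold>:subset_ty S. el (PiS S
       (\<lambda>a. R \<cdot> a \<cdot> union_S (pseudo_S S R (pseudo_S S R U)) (pseudo_S S R U)))))"

definition ctt_decidable_empty_cover :: "axm set \<Rightarrow> trm \<Rightarrow> trm \<Rightarrow> bool" where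
  "ctt_decidable_empty_cover T s r \<longleftrightarrow> (let S = closed s; R = closed r in
     inhabited T (el (PiS S (\<lambda>a. or_S (R \<cdot> a \<cdot> empty_S) (not_S (R \<cdot> a \<cdot> empty_S))))))"

definition ctt_set_presented :: "axm set \<Rightarrow> trm \<Rightarrow> trm \<Rightarrow> bool" where
  "ctt_set_presented T s r \<longleftrightarrow> (\<exists>i c. let S = closed s; R = closed r; I = closed i; C = closed c in
     der T [] (HasTy i ((el S \<^bold>\<rightarrow> set') 0)) \<and>
     der T [] (HasTy c ((\<^bold>\<Pi>a\<^bold>:el S. el (I \<cdot> a) \<^bold>\<rightarrow> subset_ty S) 0)) \<and>
     inhabited T (\<^bold>\<Pi>a\<^bold>:el S. \<^bold>\<Pi>U\<^bold>:subset_ty S.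
       el (iff_S (R \<cdot> a \<cdot> U) (SigmaS (I \<cdot> a) (\<lambda>j. sub_S S (C \<cdot> a \<cdot> j) U)))))"

definition ctt_case_i :: "axm set \<Rightarrow> trm \<Rightarrow> trm \<Rightarrow> bool" where
  "ctt_case_i T s r \<longleftrightarrow>
     ctt_formal_space T s r \<and> ctt_non_trivial T s r \<and> ctt_boolean T s r"

definition ctt_case_ii :: "axm set \<Rightarrow> trm \<Rightarrow> trm \<Rightarrow> bool" where
  "ctt_case_ii T s r \<longleftrightarrow>
     ctt_formal_space T s r \<and> ctt_non_trivial T s r \<and> ctt_de_morgan T s r \<and>
     ctt_decidable_empty_cover T s r"

end

(* Non-triviality is a negated statement, so it suffices to show that every a is covered by the empty
   set.  For every x let U_x be the trace of x on the space (in type theory, the subset {a | P} for a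
   proposition P).  Either hypothesis covers a by U_x** \<union> U_x*, as U_x \<subseteq> U_x**.  In a
   set-presented space this means that some axiom C(a,i) is contained in U_x** \<union> U_x*, and the
   uniformity principle yields an i that works for all x.  Every c in C(a,i) then satisfies
   c \<in> U_x** or c \<in> U_x* for all x, and the uniformity principle for a set with two
   distinguishable elements makes the choice of the disjunct uniform in x.  The first disjunct for
   empty U_x, as well as the second one for c \<in> U_x, says that the empty set covers c.  Hence it
   covers C(a,i) and, by transitivity, a. *)

theory Submission
  imports Defs
begin

section \<open>Provability as forcing over contexts\<close>

text \<open>No models are used on either side. \<open>CZF_star\<close> and \<open>CTT_star\<close>
  provide nothing but consistency with the uniformity principle, so a contradiction has to be
  derived inside the formal system, for an arbitrary extension. The obstacle is the length of such
  derivations. In set theory it is met by reading \<open>prv\<close> as forcing, with contexts as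
  stages and variables as individuals: the argument is then carried out in HOL about forced
  statements. In type theory its counterpart is inhabitation in an arbitrary context, with derived
  rules for the connectives; the price is that simultaneous substitution has to be shown admissible
  first.

  The uniformity principle is applied twice because the axiom must be fixed before one of its
  elements c can be named, and the disjunct depends on c. Traces appear because the principle
  quantifies over all sets, whereas the hypotheses concern subsets of the space; the instances that
  are finally compared are the empty trace and the full one.

  In type theory the universe itself is the index set of the second application: even the two
  booleans could be told apart only by means of a universe.\<close>

abbreviation lift_ren :: "(nat \<Rightarrow> nat) \<Rightarrow> nat \<Rightarrow> nat" where
  "lift_ren r \<equiv> case_nat 0 (Suc \<circ> r)"

lemma rename_cong: "\<forall>k\<in>fv p. r k = r' k \<Longrightarrow> rename r p = rename r' p"
proof (induction p arbitrary: r r')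
  case (Forall p)
  from Forall.prems have "\<forall>k\<in>fv p. lift_ren r k = lift_ren r' k" by (auto split: nat.split)
  from Forall.IH[OF this] show ?case by simp
next
  case (Exists p)
  from Exists.prems have "\<forall>k\<in>fv p. lift_ren r k = lift_ren r' k" by (auto split: nat.split)
  from Exists.IH[OF this] show ?case by simp
next
  case (Conj p q)
  then show ?case by (metis UnI1 UnI2 fv.simps(4) rename.simps(4))
next
  case (Disj p q)
  then show ?case by (metis UnI1 UnI2 fv.simps(5) rename.simps(5))
next
  case (Impl p q)
  then show ?case by (metis UnI1 UnI2 fv.simps(6) rename.simps(6))
qed auto

lemma rename_id [simp]: "rename (\<lambda>k. k) p = p"
proof (induction p)
  case (Forall p)
  have "lift_ren (\<lambda>k. k) = (\<lambda>k. k)" by (auto simp: fun_eq_iff split: nat.split)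
  then show ?case using Forall by simp
next
  case (Exists p)
  have "lift_ren (\<lambda>k. k) = (\<lambda>k. k)" by (auto simp: fun_eq_iff split: nat.split)
  then show ?case using Exists by simp
qed auto

lemma rename_rename: "rename r (rename r' p) = rename (r \<circ> r') p"
proof (induction p arbitrary: r r')
  case (Forall p)
  have "lift_ren r \<circ> lift_ren r' = lift_ren (r \<circ> r')" by (auto simp: fun_eq_iff split: nat.split)
  then show ?case by (simp only: rename.simps Forall)
next
  case (Exists p)
  have "lift_ren r \<circ> lift_ren r' = lift_ren (r \<circ> r')" by (auto simp: fun_eq_iff split: nat.split)
  then show ?case by (simp only: rename.simps Exists)
qed auto

lemma finite_fv: "finite (fv p)"
proof -
  have "finite {i. Suc i \<in> A}" if "finite A" for A
    using finite_vimageI[OF that inj_Suc] by (simp add: vimage_def)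
  then show ?thesis by (induction p) auto
qed

lemma rename_inst: "rename r (inst i p) = inst (r i) (rename (lift_ren r) p)"
proof -
  have "r \<circ> case_nat i (\<lambda>k. k) = case_nat (r i) (\<lambda>k. k) \<circ> lift_ren r"
    by (auto simp: fun_eq_iff split: nat.split)
  then show ?thesis by (simp add: inst_def rename_rename)
qed

text \<open>Instantiating after renaming is the same as adding one entry to the renaming. This
  allows renamings to play the role of environments in the forcing clauses.\<close>

lemma inst_rename_lift: "inst i (rename (lift_ren e) p) = rename (case_nat i e) p"
proof -
  have "case_nat i (\<lambda>k. k) \<circ> lift_ren e = case_nat i e"
    by (auto simp: fun_eq_iff split: nat.split)
  then show ?thesis by (simp add: inst_def rename_rename)
qed

lemma rename_lift_Suc: "rename (lift_ren r) (rename Suc p) = rename Suc (rename r p)"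
proof -
  have "lift_ren r \<circ> Suc = Suc \<circ> r" by (auto simp: fun_eq_iff)
  then show ?thesis by (simp add: rename_rename)
qed

section \<open>Structural rules and generic variables in natural deduction\<close>

lemma prv_weaken: "prv T H p \<Longrightarrow> set H \<subseteq> set H' \<Longrightarrow> prv T H' p"
proof (induction arbitrary: H' rule: prv.induct)
  case (DisjE H p q s)
  show ?case
    by (rule prv.DisjE[OF DisjE.IH(1)[OF DisjE.prems] DisjE.IH(2,3)]) (use DisjE.prems in auto)
next
  case (ImplI p H q)
  show ?case
    by (rule prv.ImplI[OF ImplI.IH]) (use ImplI.prems in auto)
next
  case (ForallI H p)
  show ?case
    by (rule prv.ForallI[OF ForallI.IH]) (use ForallI.prems in auto)
next
  case (ExistsE H p q)
  show ?case
    by (rule prv.ExistsE[OF ExistsE.IH(1)[OF ExistsE.prems] ExistsE.IH(2)]) (use ExistsE.prems in auto)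
qed (blast intro: prv.intros)+

text \<open>Axioms may be used under any renaming, so this holds without assuming them
  closed.\<close>

lemma prv_rename: "prv T H p \<Longrightarrow> prv T (map (rename r) H) (rename r p)"
proof (induction arbitrary: r rule: prv.induct)
  case (Axiom p H r')
  then show ?case using prv.Axiom by (simp add: rename_rename)
next
  case (ForallI H p)
  have "map (rename (lift_ren r)) (map (rename Suc) H) = map (rename Suc) (map (rename r) H)"
    by (simp add: rename_lift_Suc)
  from ForallI.IH[of "lift_ren r", unfolded this] show ?case by (simp add: prv.ForallI)
next
  case (ForallE H p i)
  then show ?case using prv.ForallE by (simp add: rename_inst)
next
  case (ExistsI H i p)
  then show ?case
    using prv.ExistsI[of T "map (rename r) H" "r i" "rename (lift_ren r) p"] by (simp add: rename_inst)
next
  case (ExistsE H p q)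
  have "map (rename (lift_ren r)) (p # map (rename Suc) H)
      = rename (lift_ren r) p # map (rename Suc) (map (rename r) H)"
    by (simp add: rename_lift_Suc)
  from prv.ExistsE[OF ExistsE.IH(1)[of r, unfolded rename.simps]
      ExistsE.IH(2)[of "lift_ren r", unfolded this rename_lift_Suc]]
  show ?case .
next
  case (EquE H i j p)
  then show ?case using prv.EquE[of T "map (rename r) H" "r i" "r j" "rename (lift_ren r) p"]
    by (simp add: rename_inst)
next
  case (DisjE H p q s)
  from prv.DisjE[OF DisjE.IH(1-3)[of r, unfolded rename.simps list.map]] show ?case .
next
  case (ConjE1 H p q)
  then show ?case using prv.ConjE1 by simp blast
next
  case (ConjE2 H p q)
  then show ?case using prv.ConjE2 by simp blast
next
  case (ImplE H p q)
  then show ?case using prv.ImplE by simp blast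
qed (simp_all add: prv.Hyp prv.FalsumE prv.ConjI prv.DisjI1 prv.DisjI2 prv.ImplI prv.EquI)

lemma fresh_var: "finite A \<Longrightarrow> \<exists>i::nat. i \<notin> A"
  using ex_new_if_finite infinite_UNIV_nat by blast

text \<open>This renaming abstracts the variable \<open>i\<close>: it becomes the bound variable 0
  and the others are shifted. Where \<open>i\<close> does not occur it acts as the shift, and it
  undoes the instantiation by \<open>i\<close>.\<close>

lemma rename_fresh:
  assumes "r = (\<lambda>k. if k = i then 0 else Suc k)"
  shows "i \<notin> fv q \<Longrightarrow> rename r q = rename Suc q"
    and "i \<notin> fv (Forall p) \<Longrightarrow> rename r (inst i p) = p"
proof -
  show "i \<notin> fv q \<Longrightarrow> rename r q = rename Suc q"
    by (rule rename_cong) (auto simp: assms)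
  assume "i \<notin> fv (Forall p)"
  then have "rename (r \<circ> case_nat i (\<lambda>k. k)) p = rename (\<lambda>k. k) p"
    by (intro rename_cong) (auto simp: assms split: nat.split)
  then show "rename r (inst i p) = p" by (simp add: inst_def rename_rename)
qed

text \<open>A context has finitely many free variables, so one of the instances is at a fresh
  variable, and that instance is generic. Hence a universal formula can be forced by a quantifier of
  HOL over a fixed domain, the variables.\<close>

lemma prv_ForallI:
  assumes "\<And>i. prv T H (inst i p)"
  shows "prv T H (Forall p)"
proof -
  obtain i where i: "i \<notin> \<Union>(fv ` set H) \<union> fv (Forall p)"
    using fresh_var finite_fv by (metis finite_UN_I finite_Un finite_set)
  let ?r = "\<lambda>k. if k = i then 0 else Suc k"
  have "map (rename ?r) H = map (rename Suc) H"
    using i rename_fresh(1)[of ?r i] by (intro map_cong) auto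
  then have "prv T (map (rename Suc) H) p"
    using prv_rename[OF assms[of i], of ?r] rename_fresh(2)[of ?r i p] i by (metis UnCI)
  then show ?thesis by (rule prv.ForallI)
qed

lemma prv_ExistsE:
  assumes "prv T H (Exists p)" "\<And>i. prv T (inst i p # H) q"
  shows "prv T H q"
proof -
  obtain i where i: "i \<notin> \<Union>(fv ` set H) \<union> fv (Forall p) \<union> fv q"
    using fresh_var finite_fv by (metis finite_UN_I finite_Un finite_set)
  let ?r = "\<lambda>k. if k = i then 0 else Suc k"
  have 1: "map (rename ?r) H = map (rename Suc) H" "rename ?r q = rename Suc q"
    using i rename_fresh(1)[of ?r i] by (auto intro!: map_cong)
  have 2: "rename ?r (inst i p) = p"
    using rename_fresh(2)[of ?r i p] i by blast
  have "prv T (p # map (rename Suc) H) (rename Suc q)"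
    using prv_rename[OF assms(2)[of i], of ?r] unfolding list.map 1 2 .
  then show ?thesis by (rule prv.ExistsE[OF assms(1)])
qed

text \<open>An environment is just a renaming: the individuals are the variables of the calculus,
  the same ones at every stage.\<close>

definition frc :: "fm set \<Rightarrow> (nat \<Rightarrow> nat) \<Rightarrow> fm \<Rightarrow> fm list \<Rightarrow> bool" where
  "frc T e p H \<longleftrightarrow> prv T H (rename e p)"

text \<open>The local modality of Kripke--Joyal forcing over contexts. As its eliminations range over all
  formulas, it turns \<open>\<or>\<close> and \<open>\<exists>\<close> of the calculus into those of the metalanguage.\<close>

definition locally :: "fm set \<Rightarrow> (fm list \<Rightarrow> bool) \<Rightarrow> fm list \<Rightarrow> bool" where
  "locally T X H \<longleftrightarrow> (\<forall>\<phi> H'. set H \<subseteq> set H' \<longrightarrow>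
     (\<forall>H''. set H' \<subseteq> set H'' \<longrightarrow> X H'' \<longrightarrow> prv T H'' \<phi>) \<longrightarrow> prv T H' \<phi>)"

text \<open>The formula itself is an admissible target in the definition of \<open>locally\<close>.
  Thus the modality disappears once the goal is a formula of the calculus.\<close>

lemma locally_prv: "locally T (\<lambda>H. prv T H \<phi>) H \<longleftrightarrow> prv T H \<phi>"
  unfolding locally_def using prv_weaken by blast

lemma locally_bind:
  "locally T X H \<Longrightarrow> (\<And>H'. set H \<subseteq> set H' \<Longrightarrow> X H' \<Longrightarrow> locally T Y H') \<Longrightarrow> locally T Y H"
  unfolding locally_def by (meson order.trans order.refl)

lemma frc_Forall: "frc T e (Forall p) H \<longleftrightarrow> (\<forall>i. frc T (case_nat i e) p H)"
  using prv.ForallE[of T H "rename (lift_ren e) p"] prv_ForallI[of T H "rename (lift_ren e) p"]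
  by (auto simp: frc_def inst_rename_lift)

text \<open>For the backward direction the decisive later stage is the context extended by the
  antecedent.\<close>

lemma frc_Impl:
  "frc T e (Impl p q) H \<longleftrightarrow> (\<forall>H'. set H \<subseteq> set H' \<longrightarrow> frc T e p H' \<longrightarrow> frc T e q H')"
proof
  show "\<forall>H'. set H \<subseteq> set H' \<longrightarrow> frc T e p H' \<longrightarrow> frc T e q H'" if "frc T e (Impl p q) H"
    using that prv_weaken prv.ImplE unfolding frc_def rename.simps by blast
  assume "\<forall>H'. set H \<subseteq> set H' \<longrightarrow> frc T e p H' \<longrightarrow> frc T e q H'"
  then have "prv T (rename e p # H) (rename e q)"
    using prv.Hyp unfolding frc_def by (metis list.set_intros(1) set_subset_Cons)
  then show "frc T e (Impl p q) H" unfolding frc_def by (simp add: prv.ImplI)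
qed

lemma frc_Conj: "frc T e (Conj p q) H \<longleftrightarrow> frc T e p H \<and> frc T e q H"
  unfolding frc_def by (auto intro: prv.ConjI prv.ConjE1 prv.ConjE2)

lemma frc_Disj: "frc T e (Disj p q) H \<longleftrightarrow> locally T (\<lambda>H. frc T e p H \<or> frc T e q H) H"
proof
  assume d: "frc T e (Disj p q) H"
  show "locally T (\<lambda>H. frc T e p H \<or> frc T e q H) H"
    unfolding locally_def
  proof (intro allI impI)
    fix \<phi> H'
    assume s: "set H \<subseteq> set H'"
      and *: "\<forall>H''. set H' \<subseteq> set H'' \<longrightarrow> frc T e p H'' \<or> frc T e q H'' \<longrightarrow> prv T H'' \<phi>"
    have "prv T (rename e p # H') \<phi>" "prv T (rename e q # H') \<phi>"
      using * prv.Hyp unfolding frc_def by (meson list.set_intros(1) set_subset_Cons)+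
    then show "prv T H' \<phi>"
      using d prv_weaken[OF _ s] prv.DisjE unfolding frc_def rename.simps by blast
  qed
next
  assume "locally T (\<lambda>H. frc T e p H \<or> frc T e q H) H"
  then show "frc T e (Disj p q) H"
    unfolding locally_def frc_def rename.simps by (blast intro: prv.DisjI1 prv.DisjI2)
qed

lemma frc_Exists: "frc T e (Exists p) H \<longleftrightarrow> locally T (\<lambda>H. \<exists>i. frc T (case_nat i e) p H) H"
proof
  assume d: "frc T e (Exists p) H"
  show "locally T (\<lambda>H. \<exists>i. frc T (case_nat i e) p H) H"
    unfolding locally_def
  proof (intro allI impI)
    fix \<phi> H'
    assume s: "set H \<subseteq> set H'"
      and *: "\<forall>H''. set H' \<subseteq> set H'' \<longrightarrow> (\<exists>i. frc T (case_nat i e) p H'') \<longrightarrow> prv T H'' \<phi>"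
    have "prv T (inst i (rename (lift_ren e) p) # H') \<phi>" for i
      using * prv.Hyp unfolding frc_def inst_rename_lift by (meson list.set_intros(1) set_subset_Cons)
    then show "prv T H' \<phi>"
      using d prv_weaken[OF _ s] prv_ExistsE unfolding frc_def rename.simps by blast
  qed
next
  assume "locally T (\<lambda>H. \<exists>i. frc T (case_nat i e) p H) H"
  moreover have "prv T H'' (rename e (Exists p))" if "frc T (case_nat i e) p H''" for i H''
    using that prv.ExistsI[of T H'' i "rename (lift_ren e) p"] by (simp add: frc_def inst_rename_lift)
  ultimately show "frc T e (Exists p) H"
    unfolding locally_def frc_def by blast
qed

lemma frc_rename: "frc T e (rename r p) H \<longleftrightarrow> frc T (e \<circ> r) p H"
  by (simp add: frc_def rename_rename)

lemma frc_weaken: "frc T e p H \<Longrightarrow> set H \<subseteq> set H' \<Longrightarrow> frc T e p H'"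
  unfolding frc_def by (rule prv_weaken)

lemma frc_Equ_subst:
  "prv T H (Equ i j) \<Longrightarrow> frc T (case_nat i e) p H \<Longrightarrow> frc T (case_nat j e) p H"
  using prv.EquE[of T H i j "rename (lift_ren e) p"] by (simp add: frc_def inst_rename_lift)

lemma frc_cong: "\<forall>k\<in>fv p. e k = e' k \<Longrightarrow> frc T e p H \<longleftrightarrow> frc T e' p H"
  unfolding frc_def using rename_cong by metis

text \<open>At depth \<open>d\<close> the first \<open>d\<close> entries of the environment belong
  to the quantifiers already passed; the parameters of \<open>p\<close> come after them.\<close>

lemma frc_app1: "frc T e (app1 p x d) H \<longleftrightarrow> frc T (case_nat (e (x d)) (\<lambda>j. e (d + j))) p H"
proof -
  have "e \<circ> (\<lambda>k. case k of 0 \<Rightarrow> x d | Suc j \<Rightarrow> param j d) = case_nat (e (x d)) (\<lambda>j. e (d + j))"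
    by (auto simp: fun_eq_iff param_def split: nat.split)
  then show ?thesis by (simp add: app1_def frc_rename)
qed

lemma frc_app2:
  "frc T e (app2 p x y d) H \<longleftrightarrow> frc T (case_nat (e (x d)) (case_nat (e (y d)) (\<lambda>j. e (d + j)))) p H"
proof -
  have "e \<circ> (\<lambda>k. case k of 0 \<Rightarrow> x d | Suc 0 \<Rightarrow> y d | Suc (Suc j) \<Rightarrow> param j d)
      = case_nat (e (x d)) (case_nat (e (y d)) (\<lambda>j. e (d + j)))"
    by (auto simp: fun_eq_iff param_def split: nat.split)
  then show ?thesis by (simp add: app2_def frc_rename)
qed

section \<open>Persistence and the local modality\<close>

abbreviation extends :: "fm list \<Rightarrow> fm list \<Rightarrow> bool" (infix "\<preceq>" 50) where
  "H \<preceq> H' \<equiv> set H \<subseteq> set H'"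

definition persistent :: "(fm list \<Rightarrow> bool) \<Rightarrow> bool" where
  "persistent X \<longleftrightarrow> (\<forall>H H'. H \<preceq> H' \<longrightarrow> X H \<longrightarrow> X H')"

lemma locally_prv_fun: "locally T (\<lambda>H. prv T H \<phi>) = (\<lambda>H. prv T H \<phi>)"
  by (simp add: fun_eq_iff locally_prv)

lemma persistentD: "persistent X \<Longrightarrow> H \<preceq> H' \<Longrightarrow> X H \<Longrightarrow> X H'"
  unfolding persistent_def by blast

lemma locallyI: "persistent X \<Longrightarrow> X H \<Longrightarrow> locally T X H"
  unfolding persistent_def locally_def by blast

lemma locally_mono:
  "locally T X H \<Longrightarrow> (\<And>H'. H \<preceq> H' \<Longrightarrow> X H' \<Longrightarrow> Y H') \<Longrightarrow> locally T Y H"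
  unfolding locally_def by (meson order.trans)

text \<open>The contrapositive of \<open>locally_bind\<close>. Assuming that the goal is not forced
  locally, one can open one local existence statement after another and keep this assumption,
  instead of nesting binds.\<close>

lemma locally_obtain:
  assumes "locally T X H" "\<not> locally T Y H"
  obtains H' where "H \<preceq> H'" "X H'" "\<not> locally T Y H'"
  using locally_bind assms by blast

lemma persistent_prv: "persistent (\<lambda>H. prv T H p)"
  unfolding persistent_def using prv_weaken by blast
lemma persistent_frc: "persistent (frc T e p)"
  unfolding persistent_def using frc_weaken by blast
lemma persistent_locally: "persistent (locally T X)"
  unfolding persistent_def locally_def by blast
lemma persistent_conj: "persistent X \<Longrightarrow> persistent Y \<Longrightarrow> persistent (\<lambda>H. X H \<and> Y H)"
  unfolding persistent_def by blast
lemma persistent_disj: "persistent X \<Longrightarrow> persistent Y \<Longrightarrow> persistent (\<lambda>H. X H \<or> Y H)"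
  unfolding persistent_def by blast
lemma persistent_ex: "(\<And>x. persistent (X x)) \<Longrightarrow> persistent (\<lambda>H. \<exists>x. X x H)"
  unfolding persistent_def by blast
lemma persistent_all: "(\<And>x. persistent (X x)) \<Longrightarrow> persistent (\<lambda>H. \<forall>x. X x H)"
  unfolding persistent_def by blast
lemma persistent_imp: "persistent (\<lambda>H. \<forall>H'. H \<preceq> H' \<longrightarrow> X H')"
  unfolding persistent_def by blast
lemmas persistent_intros = persistent_prv persistent_frc persistent_locally persistent_conj
  persistent_disj persistent_ex persistent_imp persistent_all

lemmas frc_clauses = frc_Forall frc_Impl frc_Conj frc_Disj frc_Exists frc_app1 frc_app2
lemma frc_atoms:
  "frc T e Falsum H \<longleftrightarrow> prv T H Falsum"
  "frc T e (Mem i j) H \<longleftrightarrow> prv T H (Mem (e i) (e j))"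
  "frc T e (Equ i j) H \<longleftrightarrow> prv T H (Equ (e i) (e j))"
  by (simp_all add: frc_def)

lemmas form_defs = bound_def param_def fmem_def feq_def fand_def f_or_def fimp_def fiff_def fnot_def
  fall_def fex_def fex1_def fball_def fbex_def fsub_def
lemmas frc_unfold = frc_clauses frc_atoms form_defs

section \<open>Formal spaces in set theory\<close>

text \<open>The theory meant here is the given extension together with the uniformity principle; its
  consistency is what the final derivation contradicts.\<close>

locale czf_gup =
  fixes T :: "fm set"
  assumes CZF: "CZF \<subseteq> T" and GUP: "GUP_CZF \<subseteq> T"
begin

abbreviation mem :: "nat \<Rightarrow> nat \<Rightarrow> fm list \<Rightarrow> bool" where "mem x y H \<equiv> prv T H (Mem x y)"
abbreviation equ :: "nat \<Rightarrow> nat \<Rightarrow> fm list \<Rightarrow> bool" where "equ x y H \<equiv> prv T H (Equ x y)"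
abbreviation absurd :: "fm list \<Rightarrow> bool" where "absurd H \<equiv> prv T H Falsum"
abbreviation loc :: "(fm list \<Rightarrow> bool) \<Rightarrow> fm list \<Rightarrow> bool" where "loc \<equiv> locally T"

text \<open>This has the shape that the forcing clauses give to "the elements of \<open>w\<close>
  are exactly the \<open>x\<close> with \<open>K x\<close>", so that unfolding a formula produces it
  directly.\<close>

definition comprises :: "nat \<Rightarrow> (nat \<Rightarrow> fm list \<Rightarrow> bool) \<Rightarrow> fm list \<Rightarrow> bool" where
  "comprises w K H \<longleftrightarrow> (\<forall>x. (\<forall>H'. H \<preceq> H' \<longrightarrow> mem x w H' \<longrightarrow> K x H') \<and>
     (\<forall>H'. H \<preceq> H' \<longrightarrow> K x H' \<longrightarrow> mem x w H'))"

lemma persistent_comprises: "persistent (comprises w K)"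
  unfolding comprises_def by (intro persistent_intros)

lemma absurd_loc: "absurd H \<Longrightarrow> loc X H"
  unfolding locally_def using prv_weaken prv.FalsumE by blast

lemma axiom: "p \<in> T \<Longrightarrow> frc T e p H"
  unfolding frc_def by (rule prv.Axiom)

section \<open>Equality and the axioms of set theory in forced form\<close>

lemma equ_refl: "equ x x H" by (rule prv.EquI)
lemma equ_sym: "equ x y H \<Longrightarrow> equ y x H"
  using frc_Equ_subst[of T H x y "\<lambda>_. x" "Equ 0 (Suc 0)"] by (simp add: frc_atoms equ_refl)
lemma mem_equ: "equ x y H \<Longrightarrow> mem x z H \<Longrightarrow> mem y z H"
  using frc_Equ_subst[of T H x y "\<lambda>_. z" "Mem 0 (Suc 0)"] by (simp add: frc_atoms)
lemma mem_equ_right: "equ x y H \<Longrightarrow> mem z x H \<Longrightarrow> mem z y H"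
  using frc_Equ_subst[of T H x y "\<lambda>_. z" "Mem (Suc 0) 0"] by (simp add: frc_atoms)

lemma separation:
  assumes "delta0 p"
  shows "loc (\<lambda>H. \<exists>b. comprises b (\<lambda>x H. mem x a H \<and> frc T (case_nat x e) p H) H) H"
proof -
  have "Separation p 0 \<in> T" using CZF assms unfolding CZF_def by blast
  from axiom[OF this, of e H]
  have "\<forall>a. loc (\<lambda>H. \<exists>b. comprises b (\<lambda>x H. mem x a H \<and> frc T (case_nat x e) p H) H) H"
    by (simp add: Separation_def frc_unfold comprises_def)
  then show ?thesis by blast
qed

lemma empty_exists: "loc (\<lambda>H. \<exists>z. comprises z (\<lambda>_. absurd) H) H"
proof -
  \<comment> \<open>Every variable denotes a set, so the variable 0 can be the set to separate
    from.\<close>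
  have "(\<lambda>x H. mem x 0 H \<and> absurd H) = (\<lambda>_. absurd)"
    using FalsumE by (auto simp: fun_eq_iff)
  then show ?thesis using separation[OF delta0.intros(1), of 0] by (simp add: frc_atoms)
qed

text \<open>The trace of a set on the space is separated by an atomic formula, so bounded separation
  makes it a set for every \<open>x\<close>.\<close>

lemma inter_exists: "loc (\<lambda>H. \<exists>u. comprises u (\<lambda>z H. mem z a H \<and> mem z x H) H) H"
  using separation[OF delta0.intros(2)[of 0 "Suc 0"], of a "\<lambda>_. x"] by (simp add: frc_atoms)

lemma pair_exists: "loc (\<lambda>H. \<exists>c. comprises c (\<lambda>x. loc (\<lambda>H. equ x a H \<or> equ x b H)) H) H"
proof -
  have "Pairing 0 \<in> T" using CZF by (auto simp: CZF_def)
  from axiom[OF this, of "\<lambda>k. k" H]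
  show ?thesis
    by (simp add: Pairing_def is_upair_def frc_unfold comprises_def)
qed

text \<open>The principle is a scheme, so the relation has to be given by a formula \<open>p\<close>
  with parameters in \<open>e\<close>. This is why explicit formulas are written out below and then
  identified with the intended predicates.\<close>

lemma gup:
  assumes "\<And>x. loc (\<lambda>H. \<exists>y. mem y I H \<and> frc T (case_nat x (case_nat y e)) p H) H"
  shows "loc (\<lambda>H. \<exists>y. mem y I H \<and> (\<forall>x. frc T (case_nat x (case_nat y e)) p H)) H"
proof -
  have "(\<^bold>\<forall>I. (\<^bold>\<forall>x. \<^bold>\<exists>y\<^bold>\<in>I. app2 p x y) \<^bold>\<longrightarrow> (\<^bold>\<exists>y\<^bold>\<in>I. \<^bold>\<forall>x. app2 p x y)) 0 \<in> T"
    using GUP by (auto simp: GUP_CZF_def)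
  from axiom[OF this, of e H]
  have "(\<forall>x. loc (\<lambda>H. \<exists>y. mem y I H \<and> frc T (case_nat x (case_nat y e)) p H) H) \<longrightarrow> ?thesis"
    by (simp add: frc_unfold)
  with assms show ?thesis by blast
qed

end

locale czf_space = czf_gup +
  fixes \<gamma> :: fm and s :: nat
  assumes fv: "fv \<gamma> \<subseteq> {0, 1}"
begin

definition cov :: "nat \<Rightarrow> nat \<Rightarrow> fm list \<Rightarrow> bool" where
  "cov a U = frc T (case_nat a (case_nat U (\<lambda>k. k))) \<gamma>"

text \<open>The cover has no parameters: the environment matters only at its two arguments.\<close>

lemma frc_cov: "frc T (case_nat a (case_nat U e)) \<gamma> H \<longleftrightarrow> cov a U H"
  unfolding cov_def using fv by (intro frc_cong) (auto split: nat.split)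

definition cover :: "nat \<Rightarrow> (nat \<Rightarrow> fm list \<Rightarrow> bool) \<Rightarrow> fm list \<Rightarrow> bool" where
  "cover a K = loc (\<lambda>H. \<exists>w. comprises w K H \<and> cov a w H)"
abbreviation negligible :: "nat \<Rightarrow> fm list \<Rightarrow> bool" where
  "negligible a \<equiv> cover a (\<lambda>_. absurd)"
abbreviation leq :: "nat \<Rightarrow> nat \<Rightarrow> fm list \<Rightarrow> bool" where
  "leq a u \<equiv> cover a (\<lambda>x. equ x u)"
definition ps :: "(nat \<Rightarrow> fm list \<Rightarrow> bool) \<Rightarrow> nat \<Rightarrow> fm list \<Rightarrow> bool" where
  "ps K a H \<longleftrightarrow> mem a s H \<and> (\<forall>d H'. H \<preceq> H' \<longrightarrow> mem d s H' \<and>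
     loc (\<lambda>H. \<exists>u. equ u a H \<and> leq d u H) H' \<and> loc (\<lambda>H. \<exists>v. K v H \<and> leq d v H) H' \<longrightarrow> negligible d H')"

definition subs :: "nat \<Rightarrow> fm list \<Rightarrow> bool" where
  "subs U H \<longleftrightarrow> (\<forall>x H'. H \<preceq> H' \<longrightarrow> mem x U H' \<longrightarrow> mem x s H')"

lemmas space_defs = cov_class_def cov_empty_def cov_single_def down_def pseudo_def
lemmas unfold_space = frc_unfold frc_cov space_defs comprises_def cover_def ps_def subs_def

section \<open>The hypotheses on the space in forced form\<close>

lemma frc_formal_space_refl:
  assumes "frc T (case_nat s e) (formal_space \<gamma> (bound 0) (Suc 0)) H"
    "mem a s H" "subs U H" "mem a U H"
  shows "cov a U H"
proof -
  have "\<forall>a H'. H \<preceq> H' \<longrightarrow> mem a s H' \<longrightarrow> (\<forall>U H''. H' \<preceq> H'' \<longrightarrow> subs U H'' \<longrightarrow>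
     (\<forall>H'''. H'' \<preceq> H''' \<longrightarrow> mem a U H''' \<longrightarrow> cov a U H'''))"
    using assms(1) by (simp add: formal_space_def unfold_space)
  then show ?thesis using assms by blast
qed

lemma frc_formal_space_trans:
  assumes "frc T (case_nat s e) (formal_space \<gamma> (bound 0) (Suc 0)) H"
    "mem a s H" "subs U H" "subs V H" "cov a U H" "\<forall>u H'. H \<preceq> H' \<longrightarrow> mem u U H' \<longrightarrow> cov u V H'"
  shows "cov a V H"
proof -
  have "\<forall>a H'. H \<preceq> H' \<longrightarrow> mem a s H' \<longrightarrow> (\<forall>U V H''. H' \<preceq> H'' \<longrightarrow> subs U H'' \<longrightarrow>
     (\<forall>H'''. H'' \<preceq> H''' \<longrightarrow> subs V H''' \<longrightarrow> (\<forall>H''''. H''' \<preceq> H'''' \<longrightarrow> cov a U H'''' \<longrightarrow>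
      (\<forall>H'. H'''' \<preceq> H' \<longrightarrow> (\<forall>u H''. H' \<preceq> H'' \<longrightarrow> mem u U H'' \<longrightarrow> cov u V H'') \<longrightarrow> cov a V H'))))"
    using assms(1) by (simp add: formal_space_def unfold_space)
  then show ?thesis using assms by blast
qed

lemma frc_non_trivial:
  assumes "frc T (case_nat s e) (non_trivial \<gamma> (bound 0) (Suc 0)) H"
    "\<forall>a H'. H \<preceq> H' \<longrightarrow> mem a s H' \<longrightarrow> negligible a H'"
  shows "absurd H"
  using assms by (simp add: non_trivial_def unfold_space)

lemma frc_boolean:
  assumes "frc T (case_nat s e) (boolean_space \<gamma> (bound 0) (Suc 0)) H"
    "subs U H" "mem a s H"
  shows "cover a (\<lambda>x. loc (\<lambda>H. mem x U H \<or> ps (\<lambda>y. mem y U) x H)) H"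
proof -
  have "\<forall>U H'. H \<preceq> H' \<longrightarrow> subs U H' \<longrightarrow> (\<forall>a H''. H' \<preceq> H'' \<longrightarrow> mem a s H'' \<longrightarrow>
    cover a (\<lambda>x. loc (\<lambda>H. mem x U H \<or> ps (\<lambda>y. mem y U) x H)) H'')"
    using assms(1) by (simp add: boolean_space_def unfold_space)
  then show ?thesis using assms by blast
qed

lemma frc_de_morgan:
  assumes "frc T (case_nat s e) (de_morgan_space \<gamma> (bound 0) (Suc 0)) H"
    "subs U H" "mem a s H"
  shows "cover a (\<lambda>x. loc (\<lambda>H. ps (ps (\<lambda>y. mem y U)) x H \<or> ps (\<lambda>y. mem y U) x H)) H"
proof -
  have "\<forall>U H'. H \<preceq> H' \<longrightarrow> subs U H' \<longrightarrow> (\<forall>a H''. H' \<preceq> H'' \<longrightarrow> mem a s H'' \<longrightarrow>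
    cover a (\<lambda>x. loc (\<lambda>H. ps (ps (\<lambda>y. mem y U)) x H \<or> ps (\<lambda>y. mem y U) x H)) H'')"
    using assms(1) by (simp add: de_morgan_space_def unfold_space)
  then show ?thesis using assms by blast
qed

text \<open>Pairs and functions are kept as unopened formulas. Their coding never enters; what
  matters about a function is that its values exist and are unique.\<close>

definition opair :: "nat \<Rightarrow> nat \<Rightarrow> nat \<Rightarrow> fm list \<Rightarrow> bool" where
  "opair q x y = frc T (case_nat q (case_nat x (case_nat y (\<lambda>k. k))))
     (is_opair (param 0) (param (Suc 0)) (param (Suc (Suc 0))) 0)"
definition maps :: "nat \<Rightarrow> nat \<Rightarrow> nat \<Rightarrow> fm list \<Rightarrow> bool" where
  "maps f x y = frc T (case_nat f (case_nat x (case_nat y (\<lambda>k. k))))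
     (maps_to (param 0) (param (Suc 0)) (param (Suc (Suc 0))) 0)"
definition func :: "nat \<Rightarrow> nat \<Rightarrow> fm list \<Rightarrow> bool" where
  "func f a = frc T (case_nat f (case_nat a (\<lambda>k. k))) (function_on (param 0) (param (Suc 0)) 0)"

text \<open>Such a \<open>q\<close> is the name of an axiom for \<open>a\<close>, namely the pair of
  \<open>a\<close> and an index in I(a).\<close>

definition index :: "nat \<Rightarrow> nat \<Rightarrow> nat \<Rightarrow> fm list \<Rightarrow> bool" where
  "index f a q = loc (\<lambda>H. \<exists>j. maps f a j H \<and> loc (\<lambda>H. \<exists>i. mem i j H \<and> opair q a i H) H)"

lemma func_unique:
  assumes "func g e H" "mem q e H"
  shows "loc (\<lambda>H. \<exists>c. maps g q c H \<and> (\<forall>c' H'. H \<preceq> H' \<longrightarrow> maps g q c' H' \<longrightarrow> equ c' c H')) H"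
proof -
  have "\<forall>q H'. H \<preceq> H' \<longrightarrow> mem q e H' \<longrightarrow>
    loc (\<lambda>H. \<exists>c. maps g q c H \<and> (\<forall>c' H'. H \<preceq> H' \<longrightarrow> maps g q c' H' \<longrightarrow> equ c' c H')) H'"
    using assms(1) by (simp add: func_def maps_def function_on_def maps_to_def is_opair_def is_upair_def frc_unfold)
  then show ?thesis using assms(2) by blast
qed

text \<open>Written in the form in which unfolding leaves the body of \<open>set_presented\<close>,
  so that one simplification proves \<open>frc_set_presented\<close>.\<close>

definition presentation :: "nat \<Rightarrow> nat \<Rightarrow> nat \<Rightarrow> fm list \<Rightarrow> bool" where
  "presentation f e g H \<longleftrightarrow> func f s H \<and>
     comprises e (\<lambda>q. loc (\<lambda>H. \<exists>x. mem x s H \<and> index f x q H)) H \<and>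
     func g e H \<and>
     (\<forall>q H'. H \<preceq> H' \<longrightarrow> mem q e H' \<longrightarrow> (\<forall>c H''. H' \<preceq> H'' \<longrightarrow> maps g q c H'' \<longrightarrow> subs c H'')) \<and>
     (\<forall>a H'. H \<preceq> H' \<longrightarrow> mem a s H' \<longrightarrow> (\<forall>U H''. H' \<preceq> H'' \<longrightarrow> subs U H'' \<longrightarrow>
       (\<forall>H'. H'' \<preceq> H' \<longrightarrow> cov a U H' \<longrightarrow>
          loc (\<lambda>H. \<exists>j. maps f a j H \<and> loc (\<lambda>H. \<exists>i. mem i j H \<and> loc (\<lambda>H. \<exists>q. opair q a i H \<and>
            loc (\<lambda>H. \<exists>c. maps g q c H \<and> (\<forall>x H'. H \<preceq> H' \<longrightarrow> mem x c H' \<longrightarrow> mem x U H')) H) H) H) H') \<and>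
       (\<forall>H'. H'' \<preceq> H' \<longrightarrow>
          loc (\<lambda>H. \<exists>j. maps f a j H \<and> loc (\<lambda>H. \<exists>i. mem i j H \<and> loc (\<lambda>H. \<exists>q. opair q a i H \<and>
            loc (\<lambda>H. \<exists>c. maps g q c H \<and> (\<forall>x H'. H \<preceq> H' \<longrightarrow> mem x c H' \<longrightarrow> mem x U H')) H) H) H) H' \<longrightarrow>
          cov a U H')))"

lemma frc_set_presented:
  assumes "frc T (case_nat s e) (set_presented \<gamma> (bound 0) (Suc 0)) H"
  shows "loc (\<lambda>H. \<exists>f. loc (\<lambda>H. \<exists>e. loc (\<lambda>H. \<exists>g. presentation f e g H) H) H) H"
  using assms
  by (simp add: set_presented_def unfold_space presentation_def index_def opair_def maps_def func_def
      function_on_def maps_to_def is_opair_def is_upair_def)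

lemma persistent_maps: "persistent (maps f x y)" and persistent_opair: "persistent (opair f x y)"
  and persistent_index: "persistent (index f x y)" and persistent_cov: "persistent (cov x y)"
  and persistent_cover: "persistent (cover x K)"
  and persistent_subs: "persistent (subs x)"
  unfolding maps_def opair_def index_def cov_def cover_def subs_def by (intro persistent_intros)+
lemma persistent_ps: "persistent (ps K x)"
  unfolding ps_def by (intro persistent_intros)
lemma persistent_presentation: "persistent (presentation f e g)"
  unfolding presentation_def func_def by (intro persistent_intros persistent_comprises)

lemmas persist = persistent_intros persistent_comprises persistent_maps persistent_opair
  persistent_index persistent_cov persistent_cover persistent_subs persistent_ps persistent_presentation
lemmas weaken_prv = persistentD[OF persistent_prv]
lemmas weaken_loc = persistentD[OF persistent_locally]
lemmas weaken_comprises = persistentD[OF persistent_comprises]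

abbreviation trace :: "nat \<Rightarrow> nat \<Rightarrow> fm list \<Rightarrow> bool" where
  "trace x y H \<equiv> mem y s H \<and> mem y x H"
text \<open>The pseudocomplements are those of the class \<open>trace x\<close>, not of a set with
  these elements. The condition is then directly a formula in \<open>x\<close> and \<open>c\<close>,
  as the uniformity principle requires.\<close>

definition decided :: "nat \<Rightarrow> nat \<Rightarrow> fm list \<Rightarrow> bool" where
  "decided x c = loc (\<lambda>H. ps (ps (trace x)) c H \<or> ps (trace x) c H)"

lemma ps_mono:
  assumes "ps K a H" "\<And>y H'. H \<preceq> H' \<Longrightarrow> K' y H' \<Longrightarrow> K y H'"
  shows "ps K' a H"
  unfolding ps_def
proof (intro conjI allI impI)
  show "mem a s H" using assms(1) by (simp add: ps_def)
  fix d H'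
  assume H': "H \<preceq> H'" and d: "mem d s H' \<and> loc (\<lambda>H. \<exists>u. equ u a H \<and> leq d u H) H' \<and>
    loc (\<lambda>H. \<exists>v. K' v H \<and> leq d v H) H'"
  then have L: "loc (\<lambda>H. \<exists>v. K' v H \<and> leq d v H) H'" by blast
  have "loc (\<lambda>H. \<exists>v. K v H \<and> leq d v H) H'"
    by (rule locally_mono[OF L]) (use assms(2) order.trans[OF H'] in blast)
  then show "negligible d H'" using assms(1) H' d unfolding ps_def by blast
qed

end

text \<open>\<open>W\<close> is a stage at which \<open>s\<close> satisfies its defining formula.
  The properties of the space are provable under this hypothesis and hence are available from
  \<open>W\<close> on.\<close>

locale czf_space_world = czf_space +
  fixes W :: "fm list"
  assumes reflW: "\<And>a U H. W \<preceq> H \<Longrightarrow> mem a s H \<Longrightarrow> subs U H \<Longrightarrow> mem a U H \<Longrightarrow> cov a U H"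
    and transW: "\<And>a U V H. W \<preceq> H \<Longrightarrow> mem a s H \<Longrightarrow> subs U H \<Longrightarrow> subs V H \<Longrightarrow> cov a U H \<Longrightarrow>
      (\<And>u H'. H \<preceq> H' \<Longrightarrow> mem u U H' \<Longrightarrow> cov u V H') \<Longrightarrow> cov a V H"
begin

section \<open>Pseudocomplements and the uniform choice of a disjunct\<close>

lemma subs_empty: "comprises w (\<lambda>_. absurd) H \<Longrightarrow> subs w H"
  unfolding comprises_def subs_def using FalsumE by blast

lemma leq_refl:
  assumes W: "W \<preceq> H" and c: "mem c s H"
  shows "leq c c H"
  unfolding cover_def
\<comment> \<open>The singleton of \<open>c\<close> is obtained by pairing \<open>c\<close> with
  itself.\<close>
proof (rule locally_bind[OF pair_exists[of c c H]])
  fix H' assume H': "H \<preceq> H'" and "\<exists>w. comprises w (\<lambda>x. loc (\<lambda>H. equ x c H \<or> equ x c H)) H'"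
  then obtain w where w: "comprises w (\<lambda>x. equ x c) H'" by (auto simp: locally_prv_fun)
  note c' = weaken_prv[OF H' c]
  have "subs w H'"
    using w weaken_prv[OF _ c'] equ_sym mem_equ unfolding subs_def comprises_def by blast
  moreover have "mem c w H'" using w equ_refl unfolding comprises_def by blast
  ultimately have "cov c w H'" using reflW c' W H' by blast
  with w show "loc (\<lambda>H. \<exists>w. comprises w (\<lambda>x. equ x c) H \<and> cov c w H) H'"
    by (intro locallyI persist) blast
qed

text \<open>Since \<open>c\<close> is covered by its own singleton, it belongs to the common
  refinement of \<open>c\<close> and \<open>K\<close>, all of whose elements are covered by the
  empty set.\<close>

lemma ps_disjoint:
  assumes W: "W \<preceq> H" and 1: "ps K c H" and 2: "K c H" and K: "\<And>v. persistent (K v)"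
  shows "negligible c H"
proof -
  have c: "mem c s H" using 1 by (simp add: ps_def)
  note l = leq_refl[OF W c]
  have "loc (\<lambda>H. \<exists>u. equ u c H \<and> leq c u H) H"
    using l equ_refl by (intro locallyI persist) blast
  moreover have "loc (\<lambda>H. \<exists>v. K v H \<and> leq c v H) H"
    using l 2 by (intro locallyI persist K) blast
  ultimately show ?thesis using 1 c unfolding ps_def by blast
qed

lemma ps_absurd:
  assumes c: "mem c s H" and K: "\<And>v H'. H \<preceq> H' \<Longrightarrow> K v H' \<Longrightarrow> absurd H'"
  shows "ps K c H"
  unfolding ps_def
proof (intro conjI allI impI c)
  fix d H' assume H': "H \<preceq> H'" and d: "mem d s H' \<and> loc (\<lambda>H. \<exists>u. equ u c H \<and> leq d u H) H' \<and>
    loc (\<lambda>H. \<exists>v. K v H \<and> leq d v H) H'"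
  then have L: "loc (\<lambda>H. \<exists>v. K v H \<and> leq d v H) H'" by blast
  have "loc absurd H'"
    by (rule locally_mono[OF L]) (use K order.trans[OF H'] in blast)
  then have "absurd H'" unfolding locally_prv .
  then show "negligible d H'" unfolding cover_def by (rule absurd_loc)
qed

text \<open>The index set of the uniformity principle is \<open>{\<emptyset>,{\<emptyset>}}\<close>; that its elements differ is
  used in the form that one is empty and the other one inhabited.\<close>

lemma uniform_split:
  assumes W: "W \<preceq> H" and c: "mem c s H" and h: "\<And>x. decided x c H"
  shows "negligible c H"
proof (rule ccontr)
  assume "\<not> negligible c H"
  \<comment> \<open>The negated goal is carried from stage to stage, which lets
    \<open>locally_obtain\<close> produce the sets needed: \<open>z\<close> is empty,
    \<open>o'\<close> is its singleton and \<open>I\<close> consists of these two.\<close>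
  then have n: "\<not> loc (\<lambda>H. \<exists>w. comprises w (\<lambda>_. absurd) H \<and> cov c w H) H" by (simp add: cover_def)
  obtain H1 z where H1: "H \<preceq> H1" and z: "comprises z (\<lambda>_. absurd) H1"
    and n: "\<not> loc (\<lambda>H. \<exists>w. comprises w (\<lambda>_. absurd) H \<and> cov c w H) H1"
    by (rule locally_obtain[OF empty_exists n]) blast
  obtain H2 o' where H2: "H1 \<preceq> H2" and o': "comprises o' (\<lambda>x. loc (\<lambda>H. equ x z H \<or> equ x z H)) H2"
    and n: "\<not> loc (\<lambda>H. \<exists>w. comprises w (\<lambda>_. absurd) H \<and> cov c w H) H2"
    by (rule locally_obtain[OF pair_exists n]) blast
  obtain H3 I where H3: "H2 \<preceq> H3" and I: "comprises I (\<lambda>x. loc (\<lambda>H. equ x z H \<or> equ x o' H)) H3"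
    and n: "\<not> loc (\<lambda>H. \<exists>w. comprises w (\<lambda>_. absurd) H \<and> cov c w H) H3"
    by (rule locally_obtain[OF pair_exists n]) blast
  note s3 = order.trans[OF H1 order.trans[OF H2 H3]]
  note z3 = weaken_comprises[OF order.trans[OF H2 H3] z]
  have o3: "mem z o' H3"
    using o' H3 equ_refl unfolding comprises_def by (simp add: locally_prv_fun)
  have zI: "mem z I H3" and oI: "mem o' I H3"
    using I locallyI[OF persistent_disj[OF persistent_prv persistent_prv]] equ_refl
    unfolding comprises_def by blast+
  \<comment> \<open>Variable 0 is \<open>x\<close>, 1 the tag \<open>y\<close>, 2 the carrier and 3
    the element \<open>c\<close>; the last two come from \<open>e\<close>. An empty tag selects the
    double pseudocomplement, an inhabited one the pseudocomplement.\<close>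
  define p where "p = (((\<^bold>\<forall>v. \<^bold>\<not> v \<^bold>\<in> param (Suc 0)) \<^bold>\<and>
      pseudo \<gamma> (param (Suc (Suc 0))) (pseudo \<gamma> (param (Suc (Suc 0)))
        (\<lambda>y. y \<^bold>\<in> param (Suc (Suc 0)) \<^bold>\<and> y \<^bold>\<in> param 0)) (param (Suc (Suc (Suc 0))))) \<^bold>\<or>
    ((\<^bold>\<exists>v. v \<^bold>\<in> param (Suc 0)) \<^bold>\<and>
      pseudo \<gamma> (param (Suc (Suc 0)))
        (\<lambda>y. y \<^bold>\<in> param (Suc (Suc 0)) \<^bold>\<and> y \<^bold>\<in> param 0) (param (Suc (Suc (Suc 0)))))) 0"
  define e where "e = case_nat s (case_nat c (\<lambda>k. k))"
  define P where "P x y = loc (\<lambda>H. ((\<forall>v H'. H \<preceq> H' \<longrightarrow> mem v y H' \<longrightarrow> absurd H') \<and> ps (ps (trace x)) c H) \<or>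
      (loc (\<lambda>H. \<exists>v. mem v y H) H \<and> ps (trace x) c H))" for x y
  have p: "frc T (case_nat x (case_nat y e)) p H = P x y H" for x y H
    unfolding p_def e_def P_def by (simp add: unfold_space)
  have "loc (\<lambda>H. \<exists>y. mem y I H \<and> P x y H) H3" for x
  proof (rule locally_bind)
    show "loc (\<lambda>H. ps (ps (trace x)) c H \<or> ps (trace x) c H) H3"
      using weaken_loc[OF s3] h unfolding decided_def by blast
    fix H' assume H': "H3 \<preceq> H'" and "ps (ps (trace x)) c H' \<or> ps (trace x) c H'"
    then consider "ps (ps (trace x)) c H'" | "ps (trace x) c H'" by blast
    then have "\<exists>y. mem y I H' \<and> P x y H'"
    proof cases
      case 1
      have "\<forall>v H''. H' \<preceq> H'' \<longrightarrow> mem v z H'' \<longrightarrow> absurd H''"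
        using z3 order.trans[OF H'] unfolding comprises_def by blast
      with 1 have "P x z H'"
        unfolding P_def by (intro locallyI[OF _ disjI1[OF conjI]] persist)
      then show ?thesis using weaken_prv[OF H' zI] by blast
    next
      case 2
      have "loc (\<lambda>H. \<exists>v. mem v o' H) H'"
        using weaken_prv[OF H' o3] by (intro locallyI persist) blast
      with 2 have "P x o' H'"
        unfolding P_def by (intro locallyI[OF _ disjI2[OF conjI]] persist)
      then show ?thesis using weaken_prv[OF H' oI] by blast
    qed
    then show "loc (\<lambda>H. \<exists>y. mem y I H \<and> P x y H) H'"
      unfolding P_def by (intro locallyI persist)
  qed
  then have "loc (\<lambda>H. \<exists>y. mem y I H \<and> (\<forall>x. P x y H)) H3"
    using gup[of I e p H3] unfolding p by blast
  then obtain H4 y where H4: "H3 \<preceq> H4" and y: "\<And>x. P x y H4"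
    and n: "\<not> loc (\<lambda>H. \<exists>w. comprises w (\<lambda>_. absurd) H \<and> cov c w H) H4"
    by (rule locally_obtain[OF _ n]) blast
  \<comment> \<open>The empty \<open>z\<close> has an empty trace, whose pseudocomplement is the
    whole space; an element of the double pseudocomplement is therefore negligible.\<close>
  have neg: "negligible c H'" if "H4 \<preceq> H'" "ps (ps (trace z)) c H'" for H'
  proof (rule ps_disjoint[OF _ that(2)])
    show "W \<preceq> H'" using W s3 H4 that by blast
    show "ps (trace z) c H'"
    proof (rule ps_absurd)
      show "mem c s H'" using weaken_prv[OF _ c] s3 H4 that(1) by blast
      show "absurd H''" if "H' \<preceq> H''" "trace z v H''" for v H''
        using that z3 H4 \<open>H4 \<preceq> H'\<close> unfolding comprises_def by blast
    qed
  qed (rule persist)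
  \<comment> \<open>At \<open>z\<close> the first alternative would give the goal, so the second
    holds and the common tag \<open>y\<close> is inhabited.\<close>
  obtain H5 where H5: "H4 \<preceq> H5" and y0: "loc (\<lambda>H. \<exists>v. mem v y H) H5"
    and n: "\<not> loc (\<lambda>H. \<exists>w. comprises w (\<lambda>_. absurd) H \<and> cov c w H) H5"
    by (rule locally_obtain[OF y[of z, unfolded P_def] n]) (use neg in \<open>auto simp: cover_def\<close>)
  \<comment> \<open>Now the same tag is used with the carrier itself as the set: its trace contains
    \<open>c\<close>. An inhabited tag excludes the first alternative, and the second makes
    \<open>c\<close> negligible by disjointness.\<close>
  have ys: "P s y H5" using y weaken_loc[OF H5] unfolding P_def by blast
  show False
  proof (rule locally_obtain[OF ys[unfolded P_def] n])
    fix H' assume H': "H5 \<preceq> H'" and n': "\<not> loc (\<lambda>H. \<exists>w. comprises w (\<lambda>_. absurd) H \<and> cov c w H) H'"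
      and "((\<forall>v H''. H' \<preceq> H'' \<longrightarrow> mem v y H'' \<longrightarrow> absurd H'') \<and> ps (ps (trace s)) c H') \<or>
        (loc (\<lambda>H. \<exists>v. mem v y H) H' \<and> ps (trace s) c H')"
    then consider "\<forall>v H''. H' \<preceq> H'' \<longrightarrow> mem v y H'' \<longrightarrow> absurd H''" | "ps (trace s) c H'" by blast
    then show False
    proof cases
      case 1
      have "loc absurd H'"
        by (rule locally_mono[OF weaken_loc[OF H' y0]]) (use 1 in blast)
      then show False using n' absurd_loc unfolding locally_prv by blast
    next
      case 2
      have sH: "H \<preceq> H'" using s3 H4 H5 H' by blast
      have "negligible c H'"
      proof (rule ps_disjoint[OF _ 2])
        show "W \<preceq> H'" using W sH by blast
        show "trace s c H'" using weaken_prv[OF sH c] by blast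
      qed (intro persist)
      then show False using n' by (simp add: cover_def)
    qed
  qed
qed

end

section \<open>From a presentation to a cover by the empty set\<close>

context czf_space_world begin

lemma cov_local: "loc (cov a U) H \<Longrightarrow> cov a U H"
  unfolding cov_def frc_def locally_prv .

text \<open>The set hidden in \<open>negligible\<close> and the given \<open>z\<close> are both
  empty, so transitivity leads from one to the other with a vacuous premise.\<close>

lemma negligible_cov:
  assumes W: "W \<preceq> H" and a: "mem a s H" and z: "comprises z (\<lambda>_. absurd) H" and n: "negligible a H"
  shows "cov a z H"
proof (rule cov_local, rule locally_mono[OF n[unfolded cover_def]])
  fix H' assume H': "H \<preceq> H'" and "\<exists>w. comprises w (\<lambda>_. absurd) H' \<and> cov a w H'"
  then obtain w where w: "comprises w (\<lambda>_. absurd) H'" and aw: "cov a w H'" by blast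
  note z' = weaken_comprises[OF H' z]
  show "cov a z H'"
  proof (rule transW[OF _ weaken_prv[OF H' a] subs_empty[OF w] subs_empty[OF z'] aw])
    show "W \<preceq> H'" using W H' by blast
    show "cov u z H''" if "H' \<preceq> H''" "mem u w H''" for u H''
      using w that FalsumE unfolding comprises_def cov_def frc_def by blast
  qed
qed

text \<open>A bridge between two readings: the hypotheses on the space speak of a set
  \<open>u\<close>, the uniformity principle of the class of its elements.\<close>

lemma decided_comprised:
  assumes u: "comprises u (trace x) H"
    and d: "loc (\<lambda>H. ps (ps (\<lambda>y. mem y u)) z H \<or> ps (\<lambda>y. mem y u) z H) H"
  shows "decided x z H"
proof -
  have eq: "trace x y H' \<longleftrightarrow> mem y u H'" if "H \<preceq> H'" for y H'
    using u that unfolding comprises_def by blast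
  have mono: "ps (trace x) y H' \<longleftrightarrow> ps (\<lambda>y. mem y u) y H'" if H': "H \<preceq> H'" for y H'
  proof
    show "ps (\<lambda>y. mem y u) y H'" if "ps (trace x) y H'"
      by (rule ps_mono[OF that]) (simp only: eq[OF order.trans[OF H']])
    show "ps (trace x) y H'" if "ps (\<lambda>y. mem y u) y H'"
      by (rule ps_mono[OF that]) (simp only: eq[OF order.trans[OF H']])
  qed
  show ?thesis
    unfolding decided_def
  proof (rule locally_mono[OF d])
    fix H' assume H': "H \<preceq> H'" and "ps (ps (\<lambda>y. mem y u)) z H' \<or> ps (\<lambda>y. mem y u) z H'"
    then show "ps (ps (trace x)) z H' \<or> ps (trace x) z H'"
      using ps_mono[of "ps (\<lambda>y. mem y u)" z H' "ps (trace x)"] mono[OF H'] mono[OF order.trans[OF H']]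
      by blast
  qed
qed

text \<open>The uniformity principle is applied to the pairs \<open>q = (a,i)\<close> rather than to the indices \<open>i\<close>,
  which are not needed once \<open>q\<close> is given.\<close>

lemma presented_negligible:
  assumes W: "W \<preceq> H" and a: "mem a s H" and P: "presentation f e g H"
    and split: "\<And>U H'. H \<preceq> H' \<Longrightarrow> subs U H' \<Longrightarrow> loc (\<lambda>H. \<exists>w. subs w H \<and> cov a w H \<and>
      (\<forall>z H'. H \<preceq> H' \<longrightarrow> mem z w H' \<longrightarrow>
        loc (\<lambda>H. ps (ps (\<lambda>y. mem y U)) z H \<or> ps (\<lambda>y. mem y U) z H) H')) H'"
  shows "negligible a H"
proof -
  \<comment> \<open>The relation for the first use of uniformity: \<open>q\<close> names an axiom
    for \<open>a\<close> all of whose elements are decided by \<open>x\<close>.\<close>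
  define A where "A x q H \<longleftrightarrow> index f a q H \<and> loc (\<lambda>H. \<exists>c. maps g q c H \<and>
    (\<forall>z H'. H \<preceq> H' \<longrightarrow> mem z c H' \<longrightarrow> decided x z H')) H" for x q H
  have persA: "persistent (\<lambda>H. \<exists>q. mem q e H \<and> A x q H)" for x
    unfolding A_def by (intro persist)
  let ?R = "\<lambda>U. loc (\<lambda>H. \<exists>j. maps f a j H \<and> loc (\<lambda>H. \<exists>i. mem i j H \<and> loc (\<lambda>H. \<exists>q. opair q a i H \<and>
            loc (\<lambda>H. \<exists>c. maps g q c H \<and> (\<forall>x H'. H \<preceq> H' \<longrightarrow> mem x c H' \<longrightarrow> mem x U H')) H) H) H)"
  have pres: "cov a U H' \<longleftrightarrow> ?R U H'" if "H \<preceq> H'" "subs U H'" for U H'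
    using P a that unfolding presentation_def by blast
  have dom: "mem q e H'" if "H \<preceq> H'" "index f a q H'" for q H'
  proof -
    have "loc (\<lambda>H. \<exists>x. mem x s H \<and> index f x q H) H'"
      using that(2) weaken_prv[OF that(1) a] by (intro locallyI persist) blast
    then show ?thesis using P that(1) unfolding presentation_def comprises_def by blast
  qed
  have "loc (\<lambda>H. \<exists>q. mem q e H \<and> A x q H) H" for x
  proof (rule locally_bind[OF inter_exists[of s x]])
    fix H1 assume s1: "H \<preceq> H1" and "\<exists>u. comprises u (trace x) H1"
    then obtain u where u: "comprises u (trace x) H1" by blast
    then have "subs u H1" unfolding comprises_def subs_def by blast
    from split[OF s1 this]
    show "loc (\<lambda>H. \<exists>q. mem q e H \<and> A x q H) H1"
    proof (rule locally_bind)
      fix H2 assume s2: "H1 \<preceq> H2" and "\<exists>w. subs w H2 \<and> cov a w H2 \<and> (\<forall>z H'. H2 \<preceq> H' \<longrightarrow> mem z w H' \<longrightarrow>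
        loc (\<lambda>H. ps (ps (\<lambda>y. mem y u)) z H \<or> ps (\<lambda>y. mem y u) z H) H')"
      then obtain w where w: "subs w H2" "cov a w H2" and d: "\<And>z H'. H2 \<preceq> H' \<Longrightarrow> mem z w H' \<Longrightarrow> decided x z H'"
        using decided_comprised[OF weaken_comprises[OF _ u]] by (meson order.trans)
      have "?R w H2" using pres[OF _ w(1)] w(2) s1 s2 by blast
      then show "loc (\<lambda>H. \<exists>q. mem q e H \<and> A x q H) H2"
      \<comment> \<open>The four eliminations open the set I(a), an index in it, the pair
        \<open>q\<close> and the value \<open>c\<close> of \<open>g\<close> at
        \<open>q\<close>.\<close>
      proof (rule locally_bind, elim exE conjE, elim locally_bind, elim exE conjE,
          elim locally_bind, elim exE conjE, elim locally_bind, elim exE conjE)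
        fix H3 j H4 i H5 q H6 c
        assume s3: "H2 \<preceq> H3" and j: "maps f a j H3" and s4: "H3 \<preceq> H4" and i: "mem i j H4"
          and s5: "H4 \<preceq> H5" and q: "opair q a i H5" and s6: "H5 \<preceq> H6" and c: "maps g q c H6"
          and cw: "\<forall>x H'. H6 \<preceq> H' \<longrightarrow> mem x c H' \<longrightarrow> mem x w H'"
        have "loc (\<lambda>H. \<exists>i. mem i j H \<and> opair q a i H) H6"
          using persistentD[OF persistent_opair s6 q] weaken_prv[OF order.trans[OF s5 s6] i]
          by (intro locallyI persist) blast
        then have ix: "index f a q H6"
          using persistentD[OF persistent_maps order.trans[OF s4 order.trans[OF s5 s6]] j]
          unfolding index_def by (intro locallyI persist) blast
        have s26: "H2 \<preceq> H6" using s3 s4 s5 s6 by blast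
        have "\<forall>z H'. H6 \<preceq> H' \<longrightarrow> mem z c H' \<longrightarrow> decided x z H'"
          using d order.trans[OF s26] cw by blast
        with c have "loc (\<lambda>H. \<exists>c. maps g q c H \<and> (\<forall>z H'. H \<preceq> H' \<longrightarrow> mem z c H' \<longrightarrow> decided x z H')) H6"
          by - (rule locallyI, (intro persist)[1], intro exI conjI)
        then have "mem q e H6 \<and> A x q H6"
          using dom[OF _ ix] ix s1 s2 s26 unfolding A_def by blast
        then show "loc (\<lambda>H. \<exists>q. mem q e H \<and> A x q H) H6"
          by (rule locallyI[OF persA exI])
      qed
    qed
  qed
  \<comment> \<open>Variable 0 is \<open>x\<close> and 1 is \<open>q\<close>; the parameters 2 to 5
    are the carrier, \<open>a\<close>, \<open>f\<close> and \<open>g\<close>, in the order of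
    \<open>\<rho>\<close>.\<close>
  define p where "p = ((\<^bold>\<exists>j. maps_to (param (Suc (Suc (Suc (Suc 0))))) (param (Suc (Suc (Suc 0)))) j \<^bold>\<and>
      (\<^bold>\<exists>i\<^bold>\<in>j. is_opair (param (Suc 0)) (param (Suc (Suc (Suc 0)))) i)) \<^bold>\<and>
    (\<^bold>\<exists>c. maps_to (param (Suc (Suc (Suc (Suc (Suc 0)))))) (param (Suc 0)) c \<^bold>\<and>
      (\<^bold>\<forall>z\<^bold>\<in>c. pseudo \<gamma> (param (Suc (Suc 0))) (pseudo \<gamma> (param (Suc (Suc 0)))
          (\<lambda>y. y \<^bold>\<in> param (Suc (Suc 0)) \<^bold>\<and> y \<^bold>\<in> param 0)) z \<^bold>\<or>
        pseudo \<gamma> (param (Suc (Suc 0))) (\<lambda>y. y \<^bold>\<in> param (Suc (Suc 0)) \<^bold>\<and> y \<^bold>\<in> param 0) z))) 0"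
  define \<rho> where "\<rho> = case_nat s (case_nat a (case_nat f (case_nat g (\<lambda>k. k))))"
  have p: "frc T (case_nat x (case_nat q \<rho>)) p H \<longleftrightarrow> A x q H" for x q H
    unfolding p_def \<rho>_def A_def index_def decided_def maps_def opair_def maps_to_def is_opair_def is_upair_def
    by (simp add: unfold_space)
  have "loc (\<lambda>H. \<exists>q. mem q e H \<and> (\<forall>x. A x q H)) H"
    using gup[of e \<rho> p H] unfolding p using \<open>\<And>x. loc (\<lambda>H. \<exists>q. mem q e H \<and> A x q H) H\<close> by blast
  then show ?thesis
    unfolding cover_def
  proof (rule locally_bind, elim exE conjE)
    fix H7 q assume s7: "H \<preceq> H7" and q: "mem q e H7" and A: "\<forall>x. A x q H7"
    \<comment> \<open>The value of \<open>g\<close> at \<open>q\<close> occurs in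
      \<open>A x q\<close> under a quantifier and so might vary with \<open>x\<close>. Fixing one
      value, with its uniqueness, makes it common to all \<open>x\<close>.\<close>
    have "loc (\<lambda>H. \<exists>c. maps g q c H \<and> (\<forall>c' H'. H \<preceq> H' \<longrightarrow> maps g q c' H' \<longrightarrow> equ c' c H')) H7"
      using func_unique[of g e H7 q] q persistentD[OF persistent_presentation s7 P] unfolding presentation_def by blast
    then show "loc (\<lambda>H. \<exists>w. comprises w (\<lambda>_. absurd) H \<and> cov a w H) H7"
    proof (rule locally_bind, elim exE conjE)
      fix H8 c assume s8: "H7 \<preceq> H8" and c: "maps g q c H8"
        and uniq: "\<forall>c' H'. H8 \<preceq> H' \<longrightarrow> maps g q c' H' \<longrightarrow> equ c' c H'"
      have s08: "H \<preceq> H8" using s7 s8 by blast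
      have sc: "subs c H8"
        using P s08 weaken_prv[OF s8 q] c unfolding presentation_def by blast
      have cc: "loc (\<lambda>H. \<exists>c'. maps g q c' H \<and> (\<forall>x H'. H \<preceq> H' \<longrightarrow> mem x c' H' \<longrightarrow> mem x c H')) H'"
        if "H8 \<preceq> H'" for H'
        using persistentD[OF persistent_maps that c] by (intro locallyI persist) blast
      have "index f a q H8"
        using A persistentD[OF persistent_index s8] unfolding A_def by blast
      \<comment> \<open>The axiom named by \<open>q\<close> covers \<open>a\<close>, because
        \<open>c\<close> is contained in itself.\<close>
      then have "?R c H8"
        unfolding index_def
      proof (elim locally_mono exE conjE, intro exI conjI)
        fix H9 j assume s9: "H8 \<preceq> H9" and "loc (\<lambda>H. \<exists>i. mem i j H \<and> opair q a i H) H9"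
        from this(2) show "loc (\<lambda>H. \<exists>i. mem i j H \<and> loc (\<lambda>H. \<exists>q. opair q a i H \<and>
            loc (\<lambda>H. \<exists>c'. maps g q c' H \<and> (\<forall>x H'. H \<preceq> H' \<longrightarrow> mem x c' H' \<longrightarrow> mem x c H')) H) H) H9"
        proof (elim locally_mono exE conjE, intro exI conjI)
          fix H10 i assume s10: "H9 \<preceq> H10" and o: "opair q a i H10"
          have "H8 \<preceq> H10" using s9 s10 by blast
          from cc[OF this] o show "loc (\<lambda>H. \<exists>q. opair q a i H \<and>
            loc (\<lambda>H. \<exists>c'. maps g q c' H \<and> (\<forall>x H'. H \<preceq> H' \<longrightarrow> mem x c' H' \<longrightarrow> mem x c H')) H) H10"
            by - (rule locallyI, (intro persist)[1], intro exI conjI)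
        qed
      qed
      then have ac: "cov a c H8" using pres[OF s08 sc] by blast
      show "loc (\<lambda>H. \<exists>w. comprises w (\<lambda>_. absurd) H \<and> cov a w H) H8"
      proof (rule locally_mono[OF empty_exists], elim exE, intro exI conjI)
        fix H9 z assume s9: "H8 \<preceq> H9" and z: "comprises z (\<lambda>_. absurd) H9"
        have W9: "W \<preceq> H9" using W s08 s9 by blast
        \<comment> \<open>Transitivity from \<open>c\<close> to the empty set: each element
          \<open>u\<close> of \<open>c\<close> is decided by every \<open>x\<close>, hence
          negligible.\<close>
        show "cov a z H9"
        proof (rule transW[OF W9 weaken_prv[OF order.trans[OF s08 s9] a]
              persistentD[OF persistent_subs s9 sc] subs_empty[OF z] persistentD[OF persistent_cov s9 ac]])
          fix u H' assume H': "H9 \<preceq> H'" and u: "mem u c H'"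
          have s8': "H8 \<preceq> H'" using s9 H' by blast
          have us: "mem u s H'" using sc s8' u unfolding subs_def by blast
          have "decided x u H'" for x
          proof -
            have "loc (\<lambda>H. \<exists>c. maps g q c H \<and> (\<forall>z H'. H \<preceq> H' \<longrightarrow> mem z c H' \<longrightarrow> decided x z H')) H'"
              using A weaken_loc[of H7 H'] s8 s8' unfolding A_def by blast
            then show ?thesis
              unfolding decided_def
            proof (rule locally_bind, elim exE conjE)
              fix H'' c' assume s': "H' \<preceq> H''" and c': "maps g q c' H''"
                and d: "\<forall>z H'. H'' \<preceq> H' \<longrightarrow> mem z c' H' \<longrightarrow> loc (\<lambda>H. ps (ps (trace x)) z H \<or> ps (trace x) z H) H'"
              have "equ c' c H''" using uniq c' s8' s' by blast
              then have "mem u c' H''" using mem_equ_right[OF equ_sym] weaken_prv[OF s' u] by blast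
              then show "loc (\<lambda>H. ps (ps (trace x)) u H \<or> ps (trace x) u H) H''" using d by blast
            qed
          qed
          then have "negligible u H'" using uniform_split[OF _ us] W9 H' by blast
          then show "cov u z H'"
            using negligible_cov[OF _ us weaken_comprises[OF H' z]] W9 H' by blast
        qed
      qed
    qed
  qed
qed

text \<open>Serves both cases: \<open>K\<close> is membership in \<open>U\<close> for a Boolean
  space and in its double pseudocomplement for a De Morgan space. The bound of \<open>K\<close> by
  the carrier makes the covering set a subset of the space.\<close>

lemma cover_decided:
  assumes c: "cover a (\<lambda>x. loc (\<lambda>H. K x H \<or> ps (\<lambda>y. mem y U) x H)) H" and U: "subs U H"
    and K: "\<And>x H'. H \<preceq> H' \<Longrightarrow> K x H' \<Longrightarrow> mem x s H' \<and> ps (ps (\<lambda>y. mem y U)) x H'"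
  shows "loc (\<lambda>H. \<exists>w. subs w H \<and> cov a w H \<and> (\<forall>z H'. H \<preceq> H' \<longrightarrow> mem z w H' \<longrightarrow>
    loc (\<lambda>H. ps (ps (\<lambda>y. mem y U)) z H \<or> ps (\<lambda>y. mem y U) z H) H')) H"
proof (rule locally_mono[OF c[unfolded cover_def]], elim exE conjE, intro exI conjI)
  fix H' w assume H': "H \<preceq> H'"
    and w: "comprises w (\<lambda>x. loc (\<lambda>H. K x H \<or> ps (\<lambda>y. mem y U) x H)) H'"
  have *: "loc (\<lambda>H. K z H \<or> ps (\<lambda>y. mem y U) z H) H''" if "H' \<preceq> H''" "mem z w H''" for z H''
    using w that unfolding comprises_def by blast
  show "subs w H'"
    unfolding subs_def
  proof (intro allI impI)
    fix z H'' assume z: "H' \<preceq> H''" "mem z w H''"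
    have "loc (\<lambda>H. mem z s H) H''"
    proof (rule locally_mono[OF *[OF z]])
      fix H1 assume "H'' \<preceq> H1" and "K z H1 \<or> ps (\<lambda>y. mem y U) z H1"
      moreover from this have "H \<preceq> H1" using H' z by blast
      ultimately show "mem z s H1" using K unfolding ps_def by blast
    qed
    then show "mem z s H''" unfolding locally_prv .
  qed
  show "\<forall>z H''. H' \<preceq> H'' \<longrightarrow> mem z w H'' \<longrightarrow>
    loc (\<lambda>H. ps (ps (\<lambda>y. mem y U)) z H \<or> ps (\<lambda>y. mem y U) z H) H''"
  proof (intro allI impI)
    fix z H'' assume z: "H' \<preceq> H''" "mem z w H''"
    show "loc (\<lambda>H. ps (ps (\<lambda>y. mem y U)) z H \<or> ps (\<lambda>y. mem y U) z H) H''"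
    proof (rule locally_mono[OF *[OF z]])
      fix H1 assume "H'' \<preceq> H1" and "K z H1 \<or> ps (\<lambda>y. mem y U) z H1"
      moreover from this have "H \<preceq> H1" using H' z by blast
      ultimately show "ps (ps (\<lambda>y. mem y U)) z H1 \<or> ps (\<lambda>y. mem y U) z H1" using K by blast
    qed
  qed
qed

text \<open>A \<open>d\<close> below \<open>x\<close> is also below an element of \<open>U\<close>.
  If it is moreover below some \<open>v\<close> in the pseudocomplement of \<open>U\<close>, it
  refines both \<open>v\<close> and \<open>U\<close> and is thus negligible.\<close>

lemma ps_ps_mem:
  assumes x: "mem x U H" and U: "subs U H"
  shows "ps (ps (\<lambda>y. mem y U)) x H"
  unfolding ps_def[of "ps _"]
proof (intro conjI allI impI)
  show "mem x s H" using x U unfolding subs_def by blast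
  fix d H' assume H': "H \<preceq> H'" and d: "mem d s H' \<and> loc (\<lambda>H. \<exists>u. equ u x H \<and> leq d u H) H' \<and>
    loc (\<lambda>H. \<exists>v. ps (\<lambda>y. mem y U) v H \<and> leq d v H) H'"
  have "loc (\<lambda>H. \<exists>w. comprises w (\<lambda>_. absurd) H \<and> cov d w H) H'"
  proof (rule locally_bind[OF conjunct2[OF conjunct2[OF d]]], elim exE conjE)
    fix H1 v assume s1: "H' \<preceq> H1" and v: "ps (\<lambda>y. mem y U) v H1" and dv: "leq d v H1"
    have "loc (\<lambda>H. \<exists>u. equ u v H \<and> leq d u H) H1"
      using dv equ_refl by (intro locallyI persist) blast
    moreover have "loc (\<lambda>H. \<exists>u. mem u U H \<and> leq d u H) H1"
    proof (rule locally_mono[OF weaken_loc[OF s1 conjunct1[OF conjunct2[OF d]]]], elim exE conjE, intro exI conjI)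
      fix H2 u assume "H1 \<preceq> H2" "equ u x H2"
      then show "mem u U H2" using mem_equ[OF equ_sym] weaken_prv[OF _ x] H' s1 by blast
    qed
    moreover have "mem d s H1" using d weaken_prv[OF s1] by blast
    ultimately have "negligible d H1" using v unfolding ps_def by blast
    then show "loc (\<lambda>H. \<exists>w. comprises w (\<lambda>_. absurd) H \<and> cov d w H) H1" unfolding cover_def .
  qed
  then show "negligible d H'" unfolding cover_def .
qed

end

lemma prv_mono: "prv T H p \<Longrightarrow> T \<subseteq> T' \<Longrightarrow> prv T' H p"
  by (induction rule: prv.induct) (blast intro: prv.intros)+

lemma czf_proves_of_frc:
  assumes "czf_proves_of T \<sigma> \<gamma> Q" "T \<subseteq> T'" "frc T' (case_nat s (\<lambda>k. k)) (app1 \<sigma> (bound 0) (Suc 0)) H"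
  shows "frc T' (case_nat s (\<lambda>k. k)) (Q \<gamma> (bound 0) (Suc 0)) H"
proof -
  have "prv T' [] ((\<^bold>\<forall>s. app1 \<sigma> s \<^bold>\<longrightarrow> Q \<gamma> s) 0)"
    using assms(1,2) prv_mono unfolding czf_proves_of_def proves_def by blast
  then have "frc T' (\<lambda>k. k) ((\<^bold>\<forall>s. app1 \<sigma> s \<^bold>\<longrightarrow> Q \<gamma> s) 0) []"
    by (simp add: frc_def)
  then show ?thesis
    using assms(3) by (simp add: fall_def fimp_def frc_Forall frc_Impl)
qed

theorem czf_not_set_presented:
  assumes T: "CZF_star T" and S: "czf_case_i T \<sigma> \<gamma> \<or> czf_case_ii T \<sigma> \<gamma>"
  shows "\<not> czf_proves_of T \<sigma> \<gamma> set_presented"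
proof
  assume P: "czf_proves_of T \<sigma> \<gamma> set_presented"
  let ?T = "T \<union> GUP_CZF"
  interpret czf_gup ?T
    using T by unfold_locales (auto simp: CZF_star_def)
  have def: "czf_defined T \<sigma> \<gamma>" and fs: "czf_proves_of T \<sigma> \<gamma> formal_space"
    and nt: "czf_proves_of T \<sigma> \<gamma> non_trivial"
    using S by (auto simp: czf_case_i_def czf_case_ii_def)
  have "prv ?T [] ((\<^bold>\<exists>\<^bold>!s. app1 \<sigma> s) 0)"
    using def prv_mono unfolding czf_defined_def proves_def by blast
  then have "frc ?T (\<lambda>k. k) ((\<^bold>\<exists>\<^bold>!s. app1 \<sigma> s) 0) []" by (simp add: frc_def)
  \<comment> \<open>The defining formula provides, locally, a variable \<open>s\<close> for the
    carrier; the stage \<open>W\<close> below is where it does so.\<close>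
  then have ex: "loc (\<lambda>H. \<exists>s. frc ?T (case_nat s (\<lambda>k. k)) (app1 \<sigma> (bound 0) (Suc 0)) H) []"
    by (simp add: fex1_def fex_def fand_def frc_Exists frc_Conj) (elim locally_mono; blast)
  \<comment> \<open>Absurdity is a formula, so deriving it locally, where the carrier has a name, is
    enough.\<close>
  have "loc absurd []"
  proof (rule locally_mono[OF ex], elim exE)
    fix W s assume \<sigma>: "frc ?T (case_nat s (\<lambda>k. k)) (app1 \<sigma> (bound 0) (Suc 0)) W"
    interpret czf_space ?T \<gamma> s
      using def by unfold_locales (simp add: czf_defined_def)
    have Q: "frc ?T (case_nat s (\<lambda>k. k)) (Q \<gamma> (bound 0) (Suc 0)) H"
      if "czf_proves_of T \<sigma> \<gamma> Q" "W \<preceq> H" for Q H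
      by (rule czf_proves_of_frc[OF that(1) _ frc_weaken[OF \<sigma> that(2)]]) blast
    interpret czf_space_world ?T \<gamma> s W
    proof unfold_locales
      show "cov a U H" if "W \<preceq> H" "mem a s H" "subs U H" "mem a U H" for a U H
        by (rule frc_formal_space_refl[OF Q[OF fs that(1)] that(2-4)])
      show "cov a V H" if "W \<preceq> H" "mem a s H" "subs U H" "subs V H" "cov a U H"
        "\<And>u H'. H \<preceq> H' \<Longrightarrow> mem u U H' \<Longrightarrow> cov u V H'" for a U V H
        by (rule frc_formal_space_trans[OF Q[OF fs that(1)] that(2-5)]) (use that(6) in blast)
    qed
    have split: "loc (\<lambda>H. \<exists>w. subs w H \<and> cov a w H \<and> (\<forall>z H'. H \<preceq> H' \<longrightarrow> mem z w H' \<longrightarrow>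
        loc (\<lambda>H. ps (ps (\<lambda>y. mem y U)) z H \<or> ps (\<lambda>y. mem y U) z H) H')) H"
      if H: "W \<preceq> H" and U: "subs U H" and a: "mem a s H" for a U H
      using S
    proof
      assume "czf_case_i T \<sigma> \<gamma>"
      then have b: "czf_proves_of T \<sigma> \<gamma> boolean_space" by (simp add: czf_case_i_def)
      show ?thesis
      proof (rule cover_decided[OF frc_boolean[OF Q[OF b H] U a] U])
        fix x H' assume "H \<preceq> H'" "mem x U H'"
        then show "mem x s H' \<and> ps (ps (\<lambda>y. mem y U)) x H'"
          using ps_ps_mem[OF _ persistentD[OF persistent_subs _ U]] U unfolding subs_def by blast
      qed
    next
      assume "czf_case_ii T \<sigma> \<gamma>"
      then have b: "czf_proves_of T \<sigma> \<gamma> de_morgan_space" by (simp add: czf_case_ii_def)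
      show ?thesis
        by (rule cover_decided[OF frc_de_morgan[OF Q[OF b H] U a] U]) (simp add: ps_def[of "ps _"])
    qed
    show "absurd W"
    proof (rule frc_non_trivial[OF Q[OF nt]])
      show "\<forall>a H. W \<preceq> H \<longrightarrow> mem a s H \<longrightarrow> negligible a H"
      proof (intro allI impI)
        fix a H assume H: "W \<preceq> H" and a: "mem a s H"
        have "loc (\<lambda>H. \<exists>w. comprises w (\<lambda>_. absurd) H \<and> cov a w H) H"
        proof (rule locally_bind[OF frc_set_presented[OF Q[OF P H]]], elim exE, elim locally_bind,
            elim exE, elim locally_bind, elim exE)
          fix H1 f H2 e H3 g
          assume "H \<preceq> H1" "H1 \<preceq> H2" "H2 \<preceq> H3" and p: "presentation f e g H3"
          then have s3: "H \<preceq> H3" by blast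
          have W3: "W \<preceq> H3" using H s3 by blast
          show "loc (\<lambda>H. \<exists>w. comprises w (\<lambda>_. absurd) H \<and> cov a w H) H3"
            unfolding cover_def[symmetric]
            by (rule presented_negligible[OF W3 weaken_prv[OF s3 a] p])
              (use split W3 weaken_prv[OF _ a] s3 in \<open>meson order.trans\<close>)
        qed
        then show "negligible a H" unfolding cover_def .
      qed
    qed blast
  qed
  then have "absurd []" unfolding locally_prv .
  with T show False by (simp add: CZF_star_def fm_consistent_def)
qed

section \<open>Substitution in the logical framework\<close>

lemma lift_sub_simps [simp]:
  "lift_sub \<theta> 0 = Var 0" "lift_sub \<theta> (Suc k) = ren Suc (\<theta> k)"
  by (simp_all add: lift_sub_def)

lemma lift_sub_Var [simp]: "lift_sub Var = Var"
  by (auto simp: lift_sub_def fun_eq_iff split: nat.split)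

lemma sub_Var [simp]: "sub Var t = t"
  by (induction t) auto

lemma ren_eq_sub: "ren \<rho> t = sub (Var \<circ> \<rho>) t"
proof (induction t arbitrary: \<rho>)
  case (Lam t)
  have "Var \<circ> case_nat 0 (Suc \<circ> \<rho>) = lift_sub (Var \<circ> \<rho>)"
    by (auto simp: fun_eq_iff split: nat.split)
  with Lam.IH show ?case by (simp only: ren.simps sub.simps)
qed auto

lemma sub_ren: "sub \<theta> (ren \<rho> t) = sub (\<theta> \<circ> \<rho>) t"
proof (induction t arbitrary: \<theta> \<rho>)
  case (Lam t)
  have "lift_sub \<theta> \<circ> case_nat 0 (Suc \<circ> \<rho>) = lift_sub (\<theta> \<circ> \<rho>)"
    by (auto simp: fun_eq_iff lift_sub_def split: nat.split)
  with Lam.IH show ?case by (simp only: ren.simps sub.simps)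
qed auto

lemma ren_ren: "ren \<rho> (ren \<eta> t) = ren (\<rho> \<circ> \<eta>) t"
  by (simp only: ren_eq_sub[of \<rho>] sub_ren ren_eq_sub[of "\<rho> \<circ> \<eta>"] comp_assoc)

lemma ren_sub: "ren \<rho> (sub \<theta> t) = sub (ren \<rho> \<circ> \<theta>) t"
proof (induction t arbitrary: \<theta> \<rho>)
  case (Lam t)
  have "ren (case_nat 0 (Suc \<circ> \<rho>)) \<circ> lift_sub \<theta> = lift_sub (ren \<rho> \<circ> \<theta>)"
    by (auto simp: fun_eq_iff lift_sub_def ren_ren comp_def split: nat.split)
  with Lam.IH show ?case by (simp only: ren.simps sub.simps)
qed auto

lemma sub_sub: "sub \<theta> (sub \<eta> t) = sub (sub \<theta> \<circ> \<eta>) t"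
proof (induction t arbitrary: \<theta> \<eta>)
  case (Lam t)
  have "sub (lift_sub \<theta>) \<circ> lift_sub \<eta> = lift_sub (sub \<theta> \<circ> \<eta>)"
    by (auto simp: fun_eq_iff lift_sub_def sub_ren ren_sub comp_def split: nat.split)
  with Lam.IH show ?case by (simp only: ren.simps sub.simps)
qed auto

lemma sub_lift_comp: "sub (lift_sub \<theta>) \<circ> lift_sub \<eta> = lift_sub (sub \<theta> \<circ> \<eta>)"
  by (auto simp: fun_eq_iff lift_sub_def sub_ren ren_sub comp_def split: nat.split)

lemma sub_ty_sub_ty: "sub_ty \<theta> (sub_ty \<eta> \<alpha>) = sub_ty (sub \<theta> \<circ> \<eta>) \<alpha>"
  by (induction \<alpha> arbitrary: \<theta> \<eta>) (auto simp: sub_sub sub_lift_comp)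

lemma sub_ty_Var [simp]: "sub_ty Var \<alpha> = \<alpha>"
  by (induction \<alpha>) auto

abbreviation wk :: "trm \<Rightarrow> trm" where "wk \<equiv> sub (shift (Suc 0))"

lemma ren_Suc [simp]: "ren Suc = wk"
  by (auto simp: fun_eq_iff ren_eq_sub shift_def comp_def)

lemma sub_single_wk [simp]: "sub (single a) (wk t) = t"
  by (simp add: sub_ren single_def comp_def flip: ren_Suc)

lemma sub_lift_wk [simp]: "sub (lift_sub \<theta>) (wk t) = wk (sub \<theta> t)"
  by (simp add: sub_ren ren_sub lift_sub_def comp_def flip: ren_Suc)

lemma single_simps [simp]: "single a 0 = a" "single a (Suc k) = Var k"
  by (simp_all add: single_def)

lemma shift_Suc_0 [simp]: "shift (Suc 0) k = Var (Suc k)"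
  by (simp add: shift_def)

lemma sub_single_sub: "sub \<theta> (sub (single a) t) = sub (single (sub \<theta> a)) (sub (lift_sub \<theta>) t)"
proof -
  have "sub \<theta> \<circ> single a = sub (single (sub \<theta> a)) \<circ> lift_sub \<theta>"
    by (auto simp: fun_eq_iff single_def lift_sub_def split: nat.split)
       (simp_all flip: single_def)
  then show ?thesis by (simp add: sub_sub)
qed

lemma sub_ty_single_sub:
  "sub_ty \<theta> (sub_ty (single a) \<alpha>) = sub_ty (single (sub \<theta> a)) (sub_ty (lift_sub \<theta>) \<alpha>)"
proof -
  have "sub \<theta> \<circ> single a = sub (single (sub \<theta> a)) \<circ> lift_sub \<theta>"
    by (auto simp: fun_eq_iff single_def lift_sub_def split: nat.split)
       (simp_all flip: single_def)
  then show ?thesis by (simp add: sub_ty_sub_ty)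
qed

lemma sub_single_Var0 [simp]: "sub (single (Var 0)) (sub (lift_sub (shift (Suc 0))) t) = t"
proof -
  have "sub (single (Var 0)) \<circ> lift_sub (shift (Suc 0)) = Var"
    by (auto simp: fun_eq_iff lift_sub_def single_def split: nat.split)
  then show ?thesis by (simp add: sub_sub)
qed

lemma sub_ty_single_Var0 [simp]:
  "sub_ty (single (Var 0)) (sub_ty (lift_sub (shift (Suc 0))) t) = t"
proof -
  have "sub (single (Var 0)) \<circ> lift_sub (shift (Suc 0)) = Var"
    by (auto simp: fun_eq_iff lift_sub_def single_def split: nat.split)
  then show ?thesis by (simp add: sub_ty_sub_ty)
qed

lemma sub_jdg_sub_jdg: "sub_jdg \<theta> (sub_jdg \<eta> J) = sub_jdg (sub \<theta> \<circ> \<eta>) J"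
  by (cases J) (auto simp: sub_sub sub_ty_sub_ty)

text \<open>Scoping is expressed by the behaviour under substitution instead of by free variables,
  since that behaviour is what closed terms are needed for.\<close>

definition scoped :: "nat \<Rightarrow> trm \<Rightarrow> bool" where
  "scoped n t \<longleftrightarrow> (\<forall>\<theta> \<eta>. (\<forall>k<n. \<theta> k = \<eta> k) \<longrightarrow> sub \<theta> t = sub \<eta> t)"
definition scoped_ty :: "nat \<Rightarrow> ty \<Rightarrow> bool" where
  "scoped_ty n \<alpha> \<longleftrightarrow> (\<forall>\<theta> \<eta>. (\<forall>k<n. \<theta> k = \<eta> k) \<longrightarrow> sub_ty \<theta> \<alpha> = sub_ty \<eta> \<alpha>)"

text \<open>A typing judgment is only asked to have a scoped subject. Its type may be that of a
  constant, about which nothing is known for an arbitrary set of axioms.\<close>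

primrec scoped_jdg :: "nat \<Rightarrow> jdg \<Rightarrow> bool" where
  "scoped_jdg n IsCtx = True"
| "scoped_jdg n (IsTy \<alpha>) = scoped_ty n \<alpha>"
| "scoped_jdg n (EqTy \<alpha> \<beta>) = True"
| "scoped_jdg n (HasTy a \<alpha>) = scoped n a"
| "scoped_jdg n (EqTm a b \<alpha>) = True"

lemma lift_sub_cong: "\<forall>k<n. \<theta> k = \<eta> k \<Longrightarrow> \<forall>k<Suc n. lift_sub \<theta> k = lift_sub \<eta> k"
  by (auto simp: lift_sub_def split: nat.split)

lemma der_scoped: "der T G J \<Longrightarrow> scoped_jdg (length G) J"
proof (induction rule: der.induct)
  case (Thin G J \<alpha>)
  then show ?case
    by (cases J) (auto simp: scoped_def scoped_ty_def sub_sub sub_ty_sub_ty)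
next
  case (Subst \<alpha> G J a)
  have *: "(\<forall>k<Suc (length G). (sub \<theta> \<circ> single a) k = (sub \<eta> \<circ> single a) k)"
    if "\<forall>k<length G. \<theta> k = \<eta> k" for \<theta> \<eta>
    using Subst that by (auto simp: scoped_def single_def split: nat.split)
  show ?case
    using Subst.IH(1) *
    by (cases J) (simp_all add: scoped_def scoped_ty_def sub_sub sub_ty_sub_ty)
next
  case (FunF G \<alpha> \<beta>)
  then show ?case using lift_sub_cong by (auto simp: scoped_ty_def)
next
  case (LamR \<alpha> G b \<beta>)
  then show ?case using lift_sub_cong by (auto simp: scoped_def)
next
  case (AppR G f \<alpha> \<beta> a)
  then show ?case by (simp add: scoped_def)
qed (auto simp: scoped_def scoped_ty_def)

lemma scoped_0: "scoped 0 t \<Longrightarrow> sub \<theta> t = t"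
  unfolding scoped_def by (metis not_less0 sub_Var)
lemma scoped_ty_0: "scoped_ty 0 t \<Longrightarrow> sub_ty \<theta> t = t"
  unfolding scoped_ty_def by (metis not_less0 sub_ty_Var)

lemma der_closed: "der T [] (HasTy t \<alpha>) \<Longrightarrow> sub \<theta> t = t"
  using der_scoped scoped_0 by fastforce

definition closed_theory :: "axm set \<Rightarrow> bool" where
  "closed_theory T \<longleftrightarrow>
     (\<forall>c \<alpha>. Decl c \<alpha> \<in> T \<longrightarrow> (\<forall>\<theta>. sub_ty \<theta> \<alpha> = \<alpha>)) \<and>
     (\<forall>a b \<alpha>. Eqn a b \<alpha> \<in> T \<longrightarrow> (\<forall>\<theta>. sub \<theta> a = a \<and> sub \<theta> b = b \<and> sub_ty \<theta> \<alpha> = \<alpha>))"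

primrec scoped_ctx :: "ty list \<Rightarrow> bool" where
  "scoped_ctx [] = True"
| "scoped_ctx (\<alpha> # G) \<longleftrightarrow> scoped_ty (length G) \<alpha> \<and> scoped_ctx G"

lemma scoped_ctx_nth: "scoped_ctx G \<Longrightarrow> i < length G \<Longrightarrow> scoped_ty (length G - Suc i) (G ! i)"
  by (induction G arbitrary: i) (auto simp: nth_Cons split: nat.split)

primrec scoped_all :: "nat \<Rightarrow> jdg \<Rightarrow> bool" where
  "scoped_all n IsCtx = True"
| "scoped_all n (IsTy \<alpha>) = scoped_ty n \<alpha>"
| "scoped_all n (EqTy \<alpha> \<beta>) = (scoped_ty n \<alpha> \<and> scoped_ty n \<beta>)"
| "scoped_all n (HasTy a \<alpha>) = (scoped n a \<and> scoped_ty n \<alpha>)"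
| "scoped_all n (EqTm a b \<alpha>) = (scoped n a \<and> scoped n b)"

lemma scoped_simps [simp]:
  "scoped n (Con c)" "i < n \<Longrightarrow> scoped n (Var i)"
  "scoped_ty n SetT" "scoped_ty n (El A) \<longleftrightarrow> scoped n A"
  by (auto simp: scoped_def scoped_ty_def)

lemma scoped_App: "scoped n f \<Longrightarrow> scoped n a \<Longrightarrow> scoped n (App f a)"
  unfolding scoped_def sub.simps by metis
lemma scoped_Lam: "scoped (Suc n) b \<Longrightarrow> scoped n (Lam b)"
  using lift_sub_cong by (auto simp: scoped_def)

lemma scoped_Fun: "scoped_ty n (Fun \<alpha> \<beta>) \<longleftrightarrow> scoped_ty n \<alpha> \<and> scoped_ty (Suc n) \<beta>"
proof -
  \<comment> \<open>\<open>Fun\<close> passes only lifted substitutions on to its codomain. An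
    arbitrary one is recovered by lifting its tail and then replacing variable 0 by its
    head.\<close>
  have *: "sub_ty \<theta> \<beta> = sub_ty (single (\<theta> 0)) (sub_ty (lift_sub (\<theta> \<circ> Suc)) \<beta>)" for \<theta>
  proof -
    have "sub (single (\<theta> 0)) \<circ> lift_sub (\<theta> \<circ> Suc) = \<theta>"
      by (auto simp: fun_eq_iff lift_sub_def split: nat.split)
    then show ?thesis by (simp add: sub_ty_sub_ty)
  qed
  have "scoped_ty (Suc n) \<beta>" if "scoped_ty n (Fun \<alpha> \<beta>)"
    unfolding scoped_ty_def
  proof (intro allI impI)
    fix \<theta> \<eta> :: "nat \<Rightarrow> trm" assume eq: "\<forall>k<Suc n. \<theta> k = \<eta> k"
    then have "\<forall>k<n. (\<theta> \<circ> Suc) k = (\<eta> \<circ> Suc) k" by simp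
    then have "sub_ty (lift_sub (\<theta> \<circ> Suc)) \<beta> = sub_ty (lift_sub (\<eta> \<circ> Suc)) \<beta>"
      using that unfolding scoped_ty_def sub_ty.simps ty.inject by blast
    with eq * [of \<theta>] * [of \<eta>] show "sub_ty \<theta> \<beta> = sub_ty \<eta> \<beta>" by simp
  qed
  moreover have "scoped_ty n \<alpha>" if "scoped_ty n (Fun \<alpha> \<beta>)"
    using that by (auto simp: scoped_ty_def)
  moreover have "scoped_ty n (Fun \<alpha> \<beta>)" if "scoped_ty n \<alpha>" "scoped_ty (Suc n) \<beta>"
    unfolding scoped_ty_def sub_ty.simps
  proof (intro allI impI, rule arg_cong2[of _ _ _ _ Fun])
    fix \<theta> \<eta> :: "nat \<Rightarrow> trm" assume eq: "\<forall>k<n. \<theta> k = \<eta> k"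
    show "sub_ty \<theta> \<alpha> = sub_ty \<eta> \<alpha>" using that(1) eq by (simp add: scoped_ty_def)
    show "sub_ty (lift_sub \<theta>) \<beta> = sub_ty (lift_sub \<eta>) \<beta>"
      using that(2) lift_sub_cong[OF eq] by (simp add: scoped_ty_def)
  qed
  ultimately show ?thesis by blast
qed

lemma scoped_sub: "scoped n t \<Longrightarrow> \<forall>k<n. scoped m (\<theta> k) \<Longrightarrow> scoped m (sub \<theta> t)"
  by (auto simp: scoped_def sub_sub)
lemma scoped_ty_sub: "scoped_ty n t \<Longrightarrow> \<forall>k<n. scoped m (\<theta> k) \<Longrightarrow> scoped_ty m (sub_ty \<theta> t)"
  by (auto simp: scoped_def scoped_ty_def sub_ty_sub_ty)
lemma scoped_all_sub:
  "scoped_all n J \<Longrightarrow> \<forall>k<n. scoped m (\<theta> k) \<Longrightarrow> scoped_all m (sub_jdg \<theta> J)"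
  by (cases J) (auto intro: scoped_sub scoped_ty_sub)
lemma scoped_single: "scoped n a \<Longrightarrow> k < Suc n \<Longrightarrow> scoped n (single a k)"
  by (cases k) auto

text \<open>The type of an equational axiom is closed because its sides have that type; but their typing may
  use the axiom itself. Therefore \<open>der_scoped\<close> does not speak about equations at all, and here
  nothing is claimed about the type of an equation.\<close>

lemma der_scoped_all:
  assumes "\<And>c \<alpha>. Decl c \<alpha> \<in> T \<Longrightarrow> scoped_ty 0 \<alpha>"
    "\<And>a b \<alpha>. Eqn a b \<alpha> \<in> T \<Longrightarrow> scoped 0 a \<and> scoped 0 b"
    "der T G J"
  shows "scoped_ctx G \<and> scoped_all (length G) J"
proof -
  have mono: "scoped n t" if "scoped 0 t" for n t using that by (auto simp: scoped_def)
  have mono': "scoped_ty n t" if "scoped_ty 0 t" for n t using that by (auto simp: scoped_ty_def)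
  show ?thesis
    using assms(3)
  proof (induction rule: der.induct)
    case (VarR G i)
    then show ?case
      using scoped_ctx_nth[of G i] by (auto intro!: scoped_ty_sub simp: shift_def)
  next
    case (Thin G J \<alpha>)
    then show ?case by (auto intro!: scoped_all_sub simp: shift_def)
  next
    case (Subst \<alpha> G J a)
    then show ?case
      using scoped_all_sub[of "Suc (length G)" J "length G" "single a"] scoped_single by simp
  next
    case (Eta G f \<alpha> \<beta>)
    then show ?case by (auto intro!: scoped_Lam scoped_App scoped_sub simp: shift_def)
  qed (auto simp: scoped_Fun assms(1,2) mono mono'
      intro!: scoped_App scoped_Lam scoped_sub scoped_ty_sub scoped_single)
qed

text \<open>Proceeds in two rounds: \<open>der_scoped\<close> closes the declared types and the
  sides of equations, and with these \<open>der_scoped_all\<close> closes the types of the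
  equations.\<close>

lemma theory_ok_closed:
  assumes "theory_ok T" shows "closed_theory T"
proof -
  have d: "scoped_ty 0 \<alpha>" if "Decl c \<alpha> \<in> T" for c \<alpha>
    using that assms der_scoped[of T "[]" "IsTy \<alpha>"] by (auto simp: theory_ok_def)
  have e: "scoped 0 a" if "der T [] (HasTy a \<alpha>)" for a \<alpha>
    using der_scoped[OF that] by simp
  have e': "scoped 0 a \<and> scoped 0 b" if "Eqn a b \<alpha> \<in> T" for a b \<alpha>
    using that assms e unfolding theory_ok_def by blast
  have "scoped_ty 0 \<alpha>" if "der T [] (HasTy a \<alpha>)" for a \<alpha>
  proof -
    have "scoped_ctx [] \<and> scoped_all (length ([] :: ty list)) (HasTy a \<alpha>)"
      using that by (rule der_scoped_all[rotated 2]) (use d e' in auto)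
    then show ?thesis by simp
  qed
  with d e assms show ?thesis
    unfolding theory_ok_def closed_theory_def by (meson scoped_0 scoped_ty_0)
qed

text \<open>\<open>theory_ok\<close> is assumed of \<open>T\<close> alone; the two declarations of
  the principle are concrete, and substitution into them is simply computed.\<close>

lemma closed_theory_Un_GUP:
  assumes "theory_ok T" shows "closed_theory (T \<union> GUP_CTT)"
proof -
  have "\<forall>\<theta>. sub_ty \<theta> \<alpha> = \<alpha>" if "Decl c \<alpha> \<in> GUP_CTT" for c \<alpha>
    using that by (auto simp: GUP_CTT_def decl_def dep_def arr_def el_def set'_def tapp_def
        cn_def closed_def tbound_def eval_nat_numeral)
  moreover have "Eqn a b \<alpha> \<notin> GUP_CTT" for a b \<alpha>
    by (simp add: GUP_CTT_def decl_def)
  ultimately show ?thesis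
    using theory_ok_closed[OF assms] unfolding closed_theory_def by blast
qed

text \<open>A context morphism from \<open>D\<close> to \<open>G\<close>. The type of entry
  \<open>i\<close> lives in the part of \<open>G\<close> behind it, whence the offset
  \<open>Suc i\<close>.\<close>

definition sub_ok :: "axm set \<Rightarrow> ty list \<Rightarrow> (nat \<Rightarrow> trm) \<Rightarrow> ty list \<Rightarrow> bool" where
  "sub_ok T D \<theta> G \<longleftrightarrow> der T D IsCtx \<and>
     (\<forall>i<length G. der T D (HasTy (\<theta> i) (sub_ty (\<lambda>k. \<theta> (k + Suc i)) (G ! i))))"

lemma sub_ok_ctx: "sub_ok T D \<theta> G \<Longrightarrow> der T D IsCtx"
  by (simp add: sub_ok_def)

lemma sub_ok_lift:
  assumes "sub_ok T D \<theta> G" "der T D (IsTy (sub_ty \<theta> \<alpha>))"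
  shows "sub_ok T (sub_ty \<theta> \<alpha> # D) (lift_sub \<theta>) (\<alpha> # G)"
proof -
  have ctx: "der T (sub_ty \<theta> \<alpha> # D) IsCtx" using assms CtxCons by blast
  have "der T (sub_ty \<theta> \<alpha> # D)
          (HasTy (lift_sub \<theta> i) (sub_ty (\<lambda>k. lift_sub \<theta> (k + Suc i)) ((\<alpha> # G) ! i)))"
    if "i < Suc (length G)" for i
  proof (cases i)
    case 0
    show ?thesis using VarR[OF ctx, of 0]
      by (simp add: 0 sub_ty_sub_ty comp_def)
  next
    case (Suc j)
    with that assms(1) have "der T D (HasTy (\<theta> j) (sub_ty (\<lambda>k. \<theta> (k + Suc j)) (G ! j)))"
      by (auto simp: sub_ok_def)
    from Thin[OF this assms(2)] show ?thesis
      by (simp add: Suc sub_ty_sub_ty comp_def)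
  qed
  with ctx show ?thesis by (simp add: sub_ok_def)
qed

lemma sub_ok_tail:
  assumes "sub_ok T D \<theta> (\<alpha> # G)"
  shows "sub_ok T D (\<lambda>k. \<theta> (Suc k)) G"
  using assms by (fastforce simp: sub_ok_def)

lemma sub_ok_cons:
  assumes "sub_ok T D \<theta> G" "der T D (HasTy a (sub_ty \<theta> \<alpha>))"
  shows "sub_ok T D (case_nat a \<theta>) (\<alpha> # G)"
  using assms by (auto simp: sub_ok_def nth_Cons split: nat.split)

text \<open>Rule \<open>LamR\<close> has no premise that \<open>\<alpha>\<close> is a type. To extend the target context in that case,
  the induction on derivations also has to substitute into the entries of the context.\<close>

primrec ctx_stable :: "axm set \<Rightarrow> ty list \<Rightarrow> bool" where
  "ctx_stable T [] = True"
| "ctx_stable T (\<alpha> # G) \<longleftrightarrow>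
     ctx_stable T G \<and> (\<forall>D \<theta>. sub_ok T D \<theta> G \<longrightarrow> der T D (IsTy (sub_ty \<theta> \<alpha>)))"

text \<open>The primitive rules handle one variable at the head of the context. For simultaneous
  substitutions the induction closes: \<open>Thin\<close> amounts to dropping an entry of the
  substitution, \<open>Subst\<close> to adding one.\<close>

lemma der_sub_aux:
  assumes "closed_theory T" "der T G J"
  shows "ctx_stable T G \<and> (\<forall>D \<theta>. sub_ok T D \<theta> G \<longrightarrow> der T D (sub_jdg \<theta> J))"
  using assms(2)
proof (induction rule: der.induct)
  case (Const G c \<alpha>)
  then show ?case using assms(1) der.Const by (auto simp: closed_theory_def)
next
  case (Equation G a b \<alpha>)
  then show ?case using assms(1) der.Equation by (auto simp: closed_theory_def)
next
  case (VarR G i)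
  have "sub_ty \<theta> (sub_ty (shift (Suc i)) \<alpha>) = sub_ty (\<lambda>k. \<theta> (k + Suc i)) \<alpha>" for \<theta> \<alpha>
    by (simp add: sub_ty_sub_ty comp_def shift_def)
  with VarR show ?case by (simp add: sub_ok_def)
next
  case (Thin G J \<alpha>)
  have "sub_jdg \<theta> (sub_jdg (shift 1) J) = sub_jdg (\<lambda>k. \<theta> (Suc k)) J" for \<theta>
    by (simp add: sub_jdg_sub_jdg comp_def)
  with Thin sub_ok_tail show ?case by simp
next
  case (Subst \<alpha> G J a)
  have "sub \<theta> \<circ> single a = case_nat (sub \<theta> a) \<theta>" for \<theta>
    by (auto simp: fun_eq_iff split: nat.split)
  with Subst sub_ok_cons show ?case
    by (auto simp: sub_jdg_sub_jdg)
next
  case (FunF G \<alpha> \<beta>)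
  then show ?case by (fastforce intro: der.FunF sub_ok_lift)
next
  case (FunEq G \<alpha> \<alpha>' \<beta> \<beta>')
  then show ?case by (fastforce intro: der.FunEq sub_ok_lift)
next
  case (LamR \<alpha> G b \<beta>)
  then show ?case by (fastforce intro: der.LamR sub_ok_lift)
next
  case (LamEq \<alpha> G b b' \<beta>)
  then show ?case by (fastforce intro: der.LamEq sub_ok_lift)
next
  case (Beta \<alpha> G b \<beta> a)
  then show ?case by (fastforce simp: sub_ty_single_sub sub_single_sub intro: der.Beta sub_ok_lift)
next
  case (Eta G f \<alpha> \<beta>)
  then show ?case using der.Eta[of T _ "sub _ f"] by (auto)
next
  case (SubstEqTy \<alpha> G \<beta> a a')
  then show ?case by (fastforce simp: sub_ty_single_sub sub_single_sub intro: der.SubstEqTy sub_ok_lift)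
next
  case (SubstEqTm \<alpha> G b \<beta> a a')
  then show ?case by (fastforce simp: sub_ty_single_sub sub_single_sub intro: der.SubstEqTm sub_ok_lift)
next
  case (AppR G f \<alpha> \<beta> a)
  then show ?case by (fastforce simp: sub_ty_single_sub intro: der.AppR)
next
  case (AppEq G f f' \<alpha> \<beta> a a')
  then show ?case by (fastforce simp: sub_ty_single_sub intro: der.AppEq)
next
  case (TyTrans G \<alpha> \<beta> \<delta>)
  then show ?case by simp (blast intro: der.TyTrans)
next
  case (TmTrans G a b \<alpha> c)
  then show ?case by simp (blast intro: der.TmTrans)
next
  case (HasConv G a \<alpha> \<beta>)
  then show ?case by simp (blast intro: der.HasConv)
next
  case (EqConv G a b \<alpha> \<beta>)
  then show ?case by simp (blast intro: der.EqConv)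
qed (auto simp: sub_ok_ctx intro: der.CtxNil der.CtxCons der.SetF der.ElF der.ElEq der.TyRefl der.TmRefl der.TySym der.TmSym)

lemma der_sub:
  "closed_theory T \<Longrightarrow> der T G J \<Longrightarrow> sub_ok T D \<theta> G \<Longrightarrow> der T D (sub_jdg \<theta> J)"
  using der_sub_aux by blast

text \<open>Rules such as \<open>LamR\<close> discharge the head of the context, so the induction
  must provide well-formedness of all tails.\<close>

primrec ctx_tails :: "axm set \<Rightarrow> ty list \<Rightarrow> bool" where
  "ctx_tails T [] \<longleftrightarrow> der T [] IsCtx"
| "ctx_tails T (\<alpha> # G) \<longleftrightarrow> der T (\<alpha> # G) IsCtx \<and> ctx_tails T G"

lemma der_ctx_tails: "der T G J \<Longrightarrow> ctx_tails T G"
  by (induction rule: der.induct) (auto intro: der.CtxNil der.CtxCons)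

lemma der_ctx: "der T G J \<Longrightarrow> der T G IsCtx"
  by (drule der_ctx_tails) (cases G; simp)

lemma der_mono:
  assumes "der T G J" "T \<subseteq> T'"
  shows "der T' G J"
  using assms(1) by induction (use assms(2) in \<open>blast intro: der.intros\<close>)+

section \<open>Derived rules of constructive type theory\<close>

abbreviation PiT :: "trm \<Rightarrow> trm \<Rightarrow> trm" where
  "PiT A B \<equiv> App (App (Con Pi_C) A) (Lam B)"
abbreviation SigT :: "trm \<Rightarrow> trm \<Rightarrow> trm" where
  "SigT A B \<equiv> App (App (Con Sigma_C) A) (Lam B)"
abbreviation PlusT :: "trm \<Rightarrow> trm \<Rightarrow> trm" where
  "PlusT A B \<equiv> App (App (Con Plus_C) A) B"
abbreviation IdT :: "trm \<Rightarrow> trm \<Rightarrow> trm \<Rightarrow> trm" where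
  "IdT A a b \<equiv> App (App (App (Con Id_C) A) a) b"
abbreviation pairT :: "trm \<Rightarrow> trm \<Rightarrow> trm \<Rightarrow> trm \<Rightarrow> trm" where
  "pairT A B a b \<equiv> App (App (App (App (Con Pair_C) A) B) a) b"
abbreviation splitT :: "trm \<Rightarrow> trm \<Rightarrow> trm \<Rightarrow> trm \<Rightarrow> trm \<Rightarrow> trm" where
  "splitT A B C e p \<equiv> App (App (App (App (App (Con Split) A) B) C) e) p"
abbreviation impT :: "trm \<Rightarrow> trm \<Rightarrow> trm" where "impT A B \<equiv> PiT A (wk B)"
abbreviation andT :: "trm \<Rightarrow> trm \<Rightarrow> trm" where "andT A B \<equiv> SigT A (wk B)"

abbreviation (input) split_ty :: "trm \<Rightarrow> trm \<Rightarrow> trm \<Rightarrow> ty" where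
  "split_ty A B C \<equiv> Fun (El A) (Fun (El (App (wk B) (Var 0)))
     (El (App (wk (wk C)) (pairT (wk (wk A)) (wk (wk B)) (Var (Suc 0)) (Var 0)))))"

locale ctt =
  fixes T :: "axm set"
  assumes CTT: "CTT \<subseteq> T" and closed_theory: "closed_theory T"
begin

abbreviation tp :: "ty list \<Rightarrow> trm \<Rightarrow> ty \<Rightarrow> bool" where
  "tp G t \<alpha> \<equiv> der T G (HasTy t \<alpha>)"
text \<open>Proof terms are suppressed wherever only the truth of a proposition matters; they are
  kept track of for the data required by the uniformity principle.\<close>

abbreviation inh :: "ty list \<Rightarrow> trm \<Rightarrow> bool" where
  "inh G A \<equiv> \<exists>t. tp G t (El A)"
abbreviation eqs :: "ty list \<Rightarrow> trm \<Rightarrow> trm \<Rightarrow> bool" where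
  "eqs G A B \<equiv> der T G (EqTm A B SetT)"

lemmas unfold_CTT = CTT_def ctt_finite_def ctt_pi_def ctt_sigma_def ctt_plus_def ctt_id_def
  ctt_univ_def split_arg_def when_arg_def decl_def eqn_def dep_def arr_def el_def set'_def tapp_def
  cn_def closed_def tbound_def tlam_def IdS_def

lemma const: "Decl c \<alpha> \<in> CTT \<Longrightarrow> der T G IsCtx \<Longrightarrow> tp G (Con c) \<alpha>"
  using CTT der.Const by blast

section \<open>Typing rules for the applied constants\<close>

lemma tp_Empty: "der T G IsCtx \<Longrightarrow> tp G (Con Empty_C) SetT"
  and tp_EmptyRec: "der T G IsCtx \<Longrightarrow> tp G (Con EmptyRec)
    (Fun (Fun (El (Con Empty_C)) SetT) (Fun (El (Con Empty_C)) (El (App (Var (Suc 0)) (Var 0)))))"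
  and tp_Unit: "der T G IsCtx \<Longrightarrow> tp G (Con Unit_C) SetT"
  and tp_Star: "der T G IsCtx \<Longrightarrow> tp G (Con Star) (El (Con Unit_C))"
  and tp_Univ: "der T G IsCtx \<Longrightarrow> tp G (Con Univ) SetT"
  and tp_Dec: "der T G IsCtx \<Longrightarrow> tp G (Con Dec) (Fun (El (Con Univ)) SetT)"
  and tp_UEmpty: "der T G IsCtx \<Longrightarrow> tp G (Con UEmpty) (El (Con Univ))"
  and tp_UUnit: "der T G IsCtx \<Longrightarrow> tp G (Con UUnit) (El (Con Univ))"
  and tp_Pi_C: "der T G IsCtx \<Longrightarrow>
    tp G (Con Pi_C) (Fun SetT (Fun (Fun (El (Var 0)) SetT) SetT))"
  and tp_Sigma_C: "der T G IsCtx \<Longrightarrow>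
    tp G (Con Sigma_C) (Fun SetT (Fun (Fun (El (Var 0)) SetT) SetT))"
  and tp_Plus_C: "der T G IsCtx \<Longrightarrow> tp G (Con Plus_C) (Fun SetT (Fun SetT SetT))"
  and tp_Id_C: "der T G IsCtx \<Longrightarrow>
    tp G (Con Id_C) (Fun SetT (Fun (El (Var 0)) (Fun (El (Var (Suc 0))) SetT)))"
  by (rule const; simp add: unfold_CTT)+

lemma tp_App: "tp G f (Fun \<alpha> \<beta>) \<Longrightarrow> tp G a \<alpha> \<Longrightarrow> \<beta>' = sub_ty (single a) \<beta> \<Longrightarrow> tp G (App f a) \<beta>'"
  using der.AppR by simp

lemma ctx_Set: "der T G IsCtx \<Longrightarrow> der T (SetT # G) IsCtx"
  using der.CtxCons der.SetF by blast
lemma ctx_El: "tp G A SetT \<Longrightarrow> der T (El A # G) IsCtx"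
  using der.CtxCons der.ElF by blast

lemma tp_Lambda:
  assumes "tp G A SetT" "tp G B (Fun (El A) SetT)" "tp G b (Fun (El A) (El (App (wk B) (Var 0))))"
  shows "tp G (App (App (App (Con Lambda) A) B) b) (El (App (App (Con Pi_C) A) B))"
proof -
  have "tp G (Con Lambda) (Fun SetT (Fun (Fun (El (Var 0)) SetT)
      (Fun (Fun (El (Var (Suc 0))) (El (App (Var (Suc 0)) (Var 0))))
        (El (App (App (Con Pi_C) (Var (Suc (Suc 0)))) (Var (Suc 0)))))))"
    by (rule const) (use assms(1) in \<open>simp_all add: unfold_CTT der_ctx\<close>)
  from AppR[OF AppR[OF AppR[OF this assms(1), simplified] assms(2), simplified] assms(3)[simplified], simplified]
  show ?thesis .
qed

lemma tp_Ap:
  assumes "tp G A SetT" "tp G B (Fun (El A) SetT)" "tp G f (El (App (App (Con Pi_C) A) B))" "tp G a (El A)"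
  shows "tp G (App (App (App (App (Con Ap) A) B) f) a) (El (App B a))"
proof -
  have "tp G (Con Ap) (Fun SetT (Fun (Fun (El (Var 0)) SetT)
      (Fun (El (App (App (Con Pi_C) (Var (Suc 0))) (Var 0)))
        (Fun (El (Var (Suc (Suc 0)))) (El (App (Var (Suc (Suc 0))) (Var 0)))))))"
    by (rule const) (use assms(1) in \<open>simp_all add: unfold_CTT der_ctx\<close>)
  from AppR[OF AppR[OF AppR[OF AppR[OF this assms(1), simplified] assms(2), simplified] assms(3)[simplified], simplified] assms(4), simplified]
  show ?thesis .
qed

lemma tp_pair:
  assumes "tp G A SetT" "tp G B (Fun (El A) SetT)" "tp G a (El A)" "tp G b (El (App B a))"
  shows "tp G (pairT A B a b) (El (App (App (Con Sigma_C) A) B))"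
proof -
  have "tp G (Con Pair_C) (Fun SetT (Fun (Fun (El (Var 0)) SetT)
      (Fun (El (Var (Suc 0))) (Fun (El (App (Var (Suc 0)) (Var 0)))
        (El (App (App (Con Sigma_C) (Var (Suc (Suc (Suc 0))))) (Var (Suc (Suc 0)))))))))"
    by (rule const) (use assms(1) in \<open>simp_all add: unfold_CTT der_ctx\<close>)
  from AppR[OF AppR[OF AppR[OF AppR[OF this assms(1), simplified] assms(2), simplified] assms(3), simplified] assms(4), simplified]
  show ?thesis .
qed

lemma tp_split:
  assumes "tp G A SetT" "tp G B (Fun (El A) SetT)"
    "tp G C (Fun (El (App (App (Con Sigma_C) A) B)) SetT)"
    "tp G e (split_ty A B C)" "tp G p (El (App (App (Con Sigma_C) A) B))"
  shows "tp G (splitT A B C e p) (El (App C p))"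
proof -
  have "tp G (Con Split) (Fun SetT (Fun (Fun (El (Var 0)) SetT)
      (Fun (Fun (El (App (App (Con Sigma_C) (Var (Suc 0))) (Var 0))) SetT)
       (Fun (split_ty (Var (Suc (Suc 0))) (Var (Suc 0)) (Var 0))
        (Fun (El (App (App (Con Sigma_C) (Var (Suc (Suc (Suc 0))))) (Var (Suc (Suc 0)))))
         (El (App (Var (Suc (Suc 0))) (Var 0))))))))"
    by (rule const) (use assms(1) in \<open>simp_all add: unfold_CTT der_ctx\<close>)
  from AppR[OF AppR[OF AppR[OF AppR[OF AppR[OF this assms(1), simplified] assms(2), simplified] assms(3), simplified] assms(4)[simplified], simplified] assms(5), simplified]
  show ?thesis .
qed

lemma tp_when:
  assumes "tp G A SetT" "tp G B SetT" "tp G C (Fun (El (PlusT A B)) SetT)"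
    "tp G d (Fun (El A) (El (App (wk C) (App (App (App (Con Inl_C) (wk A)) (wk B)) (Var 0)))))"
    "tp G e (Fun (El B) (El (App (wk C) (App (App (App (Con Inr_C) (wk A)) (wk B)) (Var 0)))))"
    "tp G p (El (PlusT A B))"
  shows "\<exists>t. tp G t (El (App C p))"
proof -
  have "tp G (Con When) (Fun SetT (Fun SetT
      (Fun (Fun (El (PlusT (Var (Suc 0)) (Var 0))) SetT)
       (Fun (Fun (El (Var (Suc (Suc 0)))) (El (App (Var (Suc 0)) (App (App (App (Con Inl_C)
            (Var (Suc (Suc (Suc 0))))) (Var (Suc (Suc 0)))) (Var 0)))))
       (Fun (Fun (El (Var (Suc (Suc 0)))) (El (App (Var (Suc (Suc 0))) (App (App (App (Con Inr_C)
            (Var (Suc (Suc (Suc (Suc 0)))))) (Var (Suc (Suc (Suc 0))))) (Var 0)))))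
        (Fun (El (PlusT (Var (Suc (Suc (Suc (Suc 0))))) (Var (Suc (Suc (Suc 0))))))
         (El (App (Var (Suc (Suc (Suc 0)))) (Var 0)))))))))"
    by (rule const) (use assms(1) in \<open>simp_all add: unfold_CTT der_ctx\<close>)
  from AppR[OF AppR[OF AppR[OF AppR[OF AppR[OF AppR[OF this assms(1), simplified] assms(2), simplified] assms(3), simplified] assms(4)[simplified], simplified] assms(5)[simplified], simplified] assms(6), simplified]
  show ?thesis by blast
qed

lemma tp_in:
  assumes "tp G A SetT" "tp G B SetT"
  shows tp_inl: "tp G a (El A) \<Longrightarrow> tp G (App (App (App (Con Inl_C) A) B) a) (El (PlusT A B))"
    and tp_inr: "tp G b (El B) \<Longrightarrow> tp G (App (App (App (Con Inr_C) A) B) b) (El (PlusT A B))"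
proof -
  have 1: "tp G (Con Inl_C) (Fun SetT (Fun SetT (Fun (El (Var (Suc 0)))
      (El (PlusT (Var (Suc (Suc 0))) (Var (Suc 0)))))))"
    and 2: "tp G (Con Inr_C) (Fun SetT (Fun SetT (Fun (El (Var 0))
      (El (PlusT (Var (Suc (Suc 0))) (Var (Suc 0)))))))"
    by (rule const; use assms(1) in \<open>simp_all add: unfold_CTT der_ctx\<close>)+
  show "tp G a (El A) \<Longrightarrow> tp G (App (App (App (Con Inl_C) A) B) a) (El (PlusT A B))"
    using AppR[OF AppR[OF AppR[OF 1 assms(1), simplified] assms(2), simplified], simplified] .
  show "tp G b (El B) \<Longrightarrow> tp G (App (App (App (Con Inr_C) A) B) b) (El (PlusT A B))"
    using AppR[OF AppR[OF AppR[OF 2 assms(1), simplified] assms(2), simplified], simplified] .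
qed

lemma tp_Refl:
  assumes "tp G A SetT" "tp G a (El A)"
  shows "tp G (App (App (Con Refl) A) a) (El (IdT A a a))"
proof -
  have "tp G (Con Refl) (Fun SetT (Fun (El (Var 0)) (El (IdT (Var (Suc 0)) (Var 0) (Var 0)))))"
    by (rule const) (use assms(1) in \<open>simp_all add: unfold_CTT der_ctx\<close>)
  from AppR[OF AppR[OF this assms(1), simplified] assms(2), simplified]
  show ?thesis .
qed

lemma conv: "tp G t (El A) \<Longrightarrow> eqs G A B \<Longrightarrow> tp G t (El B)"
  using der.HasConv der.ElEq by blast
lemma conv_sym: "tp G t (El A) \<Longrightarrow> eqs G B A \<Longrightarrow> tp G t (El B)"
  using conv der.TmSym by blast

lemma beta_eqs: "tp (\<alpha> # G) B SetT \<Longrightarrow> tp G a \<alpha> \<Longrightarrow> eqs G (App (Lam B) a) (sub (single a) B)"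
  using der.Beta[of T \<alpha> G B SetT a] by simp

end

lemma sub_ok_Var: "der T G IsCtx \<Longrightarrow> sub_ok T G Var G"
  using VarR by (auto simp: sub_ok_def shift_def)

lemma sub_ok_shift: "der T G (IsTy \<alpha>) \<Longrightarrow> sub_ok T (\<alpha> # G) (shift (Suc 0)) G"
  using VarR[OF CtxCons, of T G \<alpha> "Suc _"] CtxCons
  by (auto simp: sub_ok_def shift_def)

lemma sub_ok_Nil: "der T G IsCtx \<Longrightarrow> sub_ok T G \<theta> []"
  by (simp add: sub_ok_def)

context ctt begin

lemmas subst = der_sub[OF closed_theory]

text \<open>\<open>Thin\<close> adds a variable at the head only; inserting one beneath the head is
  a lifted simultaneous substitution.\<close>

lemma wk_under:
  assumes "tp (\<alpha> # G) t \<beta>" "der T G (IsTy \<alpha>)" "der T G (IsTy \<gamma>)"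
  shows "tp (sub_ty (shift (Suc 0)) \<alpha> # \<gamma> # G) (sub (lift_sub (shift (Suc 0))) t)
           (sub_ty (lift_sub (shift (Suc 0))) \<beta>)"
  using subst[OF assms(1) sub_ok_lift[OF sub_ok_shift[OF assms(3)]]] Thin[OF assms(2,3)]
  by simp

lemma wk_Set: "tp G A SetT \<Longrightarrow> der T G (IsTy \<gamma>) \<Longrightarrow> tp (\<gamma> # G) (wk A) SetT"
  using Thin[of T G "HasTy A SetT" \<gamma>] by simp
lemma wk_El: "tp G t (El A) \<Longrightarrow> der T G (IsTy \<gamma>) \<Longrightarrow> tp (\<gamma> # G) (wk t) (El (wk A))"
  using Thin[of T G "HasTy t (El A)" \<gamma>] by simp
lemma wk_fam: "tp G t (Fun (El A) SetT) \<Longrightarrow> der T G (IsTy \<gamma>) \<Longrightarrow>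
    tp (\<gamma> # G) (wk t) (Fun (El (wk A)) SetT)"
  using Thin[of T G "HasTy t (Fun (El A) SetT)" \<gamma>] by simp
lemma Var0_El: "der T (El A # G) IsCtx \<Longrightarrow> tp (El A # G) (Var 0) (El (wk A))"
  using VarR[of T "El A # G" 0] by simp
lemma Var1_El: "der T (\<beta> # El A # G) IsCtx \<Longrightarrow> tp (\<beta> # El A # G) (Var (Suc 0)) (El (wk (wk A)))"
  using VarR[of T "\<beta> # El A # G" "Suc 0"]
  by (simp add: sub_sub comp_def shift_def)
lemma Var0_Set: "der T (SetT # G) IsCtx \<Longrightarrow> tp (SetT # G) (Var 0) SetT"
  using VarR[of T "SetT # G" 0] by simp

text \<open>The constants apply families to variables, whereas the rules below speak of the bodies
  of families. This conversion mediates between them.\<close>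

lemma beta_Var0:
  assumes "tp (\<alpha> # G) b \<beta>" "der T G (IsTy \<alpha>)"
  shows "der T (\<alpha> # G) (EqTm (App (wk (Lam b)) (Var 0)) b \<beta>)"
  using der.Beta[OF wk_under[OF assms assms(2)], of "Var 0"]
    VarR[OF der_ctx[OF assms(1)], of 0] by simp

text \<open>Both abstractions are applied to a fresh variable and reduced.\<close>

lemma lam_inj:
  assumes "der T G (EqTm (Lam b) (Lam b') (Fun \<alpha> \<beta>))" "tp (\<alpha> # G) b \<beta>" "tp (\<alpha> # G) b' \<beta>"
    "der T G (IsTy \<alpha>)"
  shows "der T (\<alpha> # G) (EqTm b b' \<beta>)"
proof -
  have "der T (\<alpha> # G) (EqTm (App (wk (Lam b)) (Var 0)) (App (wk (Lam b')) (Var 0)) \<beta>)"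
    using AppEq[OF Thin[OF assms(1,4), simplified] TmRefl[OF VarR[OF der_ctx[OF assms(2)], of 0, simplified]]]
    by simp
  then show ?thesis
    using beta_Var0[OF assms(2,4)] beta_Var0[OF assms(3,4)] der.TmSym der.TmTrans by blast
qed

section \<open>Set formation and the logic of propositions as sets\<close>

lemma Pi_Set: "tp G A SetT \<Longrightarrow> tp G F (Fun (El A) SetT) \<Longrightarrow> tp G (App (App (Con Pi_C) A) F) SetT"
  by (rule tp_App[OF tp_App[OF tp_Pi_C]]) (auto intro: der_ctx)
lemma Sigma_Set: "tp G A SetT \<Longrightarrow> tp G F (Fun (El A) SetT) \<Longrightarrow> tp G (App (App (Con Sigma_C) A) F) SetT"
  by (rule tp_App[OF tp_App[OF tp_Sigma_C]]) (auto intro: der_ctx)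
lemma PiT_Set: "tp G A SetT \<Longrightarrow> tp (El A # G) B SetT \<Longrightarrow> tp G (PiT A B) SetT"
  by (simp add: LamR Pi_Set)
lemma SigT_Set: "tp G A SetT \<Longrightarrow> tp (El A # G) B SetT \<Longrightarrow> tp G (SigT A B) SetT"
  by (simp add: LamR Sigma_Set)
lemma PlusT_Set: "tp G A SetT \<Longrightarrow> tp G B SetT \<Longrightarrow> tp G (PlusT A B) SetT"
  by (rule tp_App[OF tp_App[OF tp_Plus_C]]) (auto intro: der_ctx)
lemma IdT_Set: "tp G A SetT \<Longrightarrow> tp G a (El A) \<Longrightarrow> tp G b (El A) \<Longrightarrow> tp G (IdT A a b) SetT"
  by (rule tp_App[OF tp_App[OF tp_App[OF tp_Id_C]]]) (auto intro: der_ctx)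
lemma impT_Set: "tp G A SetT \<Longrightarrow> tp G B SetT \<Longrightarrow> tp G (impT A B) SetT"
  by (intro PiT_Set wk_Set ElF)
lemma andT_Set: "tp G A SetT \<Longrightarrow> tp G B SetT \<Longrightarrow> tp G (andT A B) SetT"
  by (intro SigT_Set wk_Set ElF)

lemma PiI:
  assumes "tp G A SetT" "tp (El A # G) B SetT" "inh (El A # G) B"
  shows "inh G (PiT A B)"
proof -
  obtain t where "tp (El A # G) t (El B)" using assms(3) by blast
  from conv_sym[OF this beta_Var0[OF assms(2) ElF[OF assms(1)]]]
  show ?thesis using tp_Lambda[OF assms(1) LamR[OF assms(2)] LamR] by blast
qed

lemma PiE:
  assumes "tp G A SetT" "tp (El A # G) B SetT" "inh G (PiT A B)" "tp G a (El A)"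
  shows "inh G (sub (single a) B)"
  using tp_Ap[OF assms(1) LamR[OF assms(2)] _ assms(4)] assms(3) conv[OF _ beta_eqs[OF assms(2,4)]]
  by blast

lemma impI:
  assumes "tp G A SetT" "tp G B SetT" "inh (El A # G) (wk B)"
  shows "inh G (impT A B)"
  using PiI[OF assms(1) wk_Set[OF assms(2) ElF[OF assms(1)]] assms(3)] .

lemma impE:
  assumes "tp G A SetT" "tp G B SetT" "inh G (impT A B)" "inh G A"
  shows "inh G B"
  using PiE[OF assms(1) wk_Set[OF assms(2) ElF[OF assms(1)]] assms(3)] assms(4) by auto

lemma SigI:
  assumes "tp G A SetT" "tp (El A # G) B SetT" "tp G a (El A)" "inh G (sub (single a) B)"
  shows "inh G (SigT A B)"
  using tp_pair[OF assms(1) LamR[OF assms(2)] assms(3)] assms(4) conv_sym[OF _ beta_eqs[OF assms(2,3)]]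
  by blast

lemma andI:
  assumes "tp G A SetT" "tp G B SetT" "inh G A" "inh G B"
  shows "inh G (andT A B)"
  using SigI[OF assms(1) wk_Set[OF assms(2) ElF[OF assms(1)]]] assms(3,4) by auto

lemma pair_ctx:
  assumes A: "tp G A SetT" and F: "tp G F (Fun (El A) SetT)"
  defines "H \<equiv> El (App (wk F) (Var 0)) # El A # G"
  shows "tp (El A # G) (App (wk F) (Var 0)) SetT" "der T H IsCtx"
    "tp H (Var 0) (El (App (wk (wk F)) (Var (Suc 0))))"
    "tp H (Var (Suc 0)) (El (wk (wk A)))"
    "tp H (pairT (wk (wk A)) (wk (wk F)) (Var (Suc 0)) (Var 0))
       (El (App (App (Con Sigma_C) (wk (wk A))) (wk (wk F))))"
proof -
  note c1 = ctx_El[OF A]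
  show 1: "tp (El A # G) (App (wk F) (Var 0)) SetT"
    by (rule tp_App[OF wk_fam[OF F ElF[OF A]] Var0_El[OF c1]]) simp
  show 2: "der T H IsCtx" unfolding H_def by (rule ctx_El[OF 1])
  show 3: "tp H (Var 0) (El (App (wk (wk F)) (Var (Suc 0))))"
    unfolding H_def using Var0_El[OF 2[unfolded H_def]] by simp
  show 4: "tp H (Var (Suc 0)) (El (wk (wk A)))"
    unfolding H_def using Var1_El[OF 2[unfolded H_def]] by simp
  have "tp H (wk (wk A)) SetT" unfolding H_def by (intro wk_Set A ElF 1)
  moreover have "tp H (wk (wk F)) (Fun (El (wk (wk A))) SetT)" unfolding H_def by (intro wk_fam F ElF A 1)
  ultimately show "tp H (pairT (wk (wk A)) (wk (wk F)) (Var (Suc 0)) (Var 0))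
       (El (App (App (Con Sigma_C) (wk (wk A))) (wk (wk F))))"
    using tp_pair 3 4 by blast
qed

lemma tp_split_ty:
  assumes A: "tp G A SetT" and F: "tp G F (Fun (El A) SetT)"
    and C: "tp (El (App (App (Con Sigma_C) A) F) # G) C SetT"
    and t: "tp (El (App (wk F) (Var 0)) # El A # G) t
      (El (sub (single (pairT (wk (wk A)) (wk (wk F)) (Var (Suc 0)) (Var 0)))
          (sub (lift_sub (shift (Suc 0))) (sub (lift_sub (shift (Suc 0))) C))))"
  shows "tp G (Lam (Lam t)) (split_ty A F (Lam C))"
proof -
  note p = pair_ctx[OF A F]
  note S = ElF[OF Sigma_Set[OF A F]]
  note C1 = wk_under[OF C S ElF[OF A], simplified]
  note C2 = wk_under[OF C1 Thin[OF S ElF[OF A], simplified] ElF[OF p(1)], simplified]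
  show ?thesis
    using conv_sym[OF t beta_eqs[OF C2 p(5)]] by (intro LamR) simp
qed

lemma SigE:
  assumes A: "tp G A SetT" and B: "tp (El A # G) B SetT" and C: "tp G C SetT"
    and h: "inh G (SigT A B)" and t: "inh (El B # El A # G) (wk (wk C))"
  shows "inh G C"
proof -
  note F = LamR[OF B]
  note S = ElF[OF SigT_Set[OF A B]]
  note p = pair_ctx[OF A F]
  obtain t where t: "tp (El B # El A # G) t (El (wk (wk C)))" using t by blast
  have eq: "eqs (El A # G) (App (wk (Lam B)) (Var 0)) B"
    by (rule beta_Var0[OF B ElF[OF A]])
  have "tp (El A # G) (Lam t) (Fun (El B) (El (wk (wk C))))" using t by (rule LamR)
  \<comment> \<open>\<open>Split\<close> expects a hypothesis whose type is a redex merely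
    convertible to \<open>B\<close>. The hypothesis is exchanged by abstracting it, converting the
    function type and applying the result to a variable of the new type.\<close>
  moreover have "der T (El A # G) (EqTy (Fun (El B) (El (wk (wk C))))
      (Fun (El (App (wk (Lam B)) (Var 0))) (El (wk (wk C)))))"
    by (intro FunEq ElEq[OF TmSym[OF eq]] TyRefl ElF wk_Set C A B)
  ultimately have "tp (El A # G) (Lam t) (Fun (El (App (wk (Lam B)) (Var 0))) (El (wk (wk C))))"
    by (rule HasConv)
  from AppR[OF Thin[OF this ElF[OF p(1)], simplified], of "Var 0"] Var0_El[OF p(2)]
  have "inh (El (App (wk (Lam B)) (Var 0)) # El A # G) (wk (wk C))" by auto
  then obtain u where "tp (El (App (wk (Lam B)) (Var 0)) # El A # G) u (El (wk (wk C)))" by blast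
  then have "tp G (Lam (Lam u)) (split_ty A (Lam B) (Lam (wk C)))"
    using tp_split_ty[OF A F wk_Set[OF C S]] by simp
  moreover have "tp G (Lam (wk C)) (Fun (El (SigT A B)) SetT)"
    by (intro LamR wk_Set C S)
  moreover obtain p where p: "tp G p (El (SigT A B))" using h by blast
  ultimately have "inh G (App (Lam (wk C)) p)" using tp_split[OF A F] by blast
  then show ?thesis using conv[OF _ beta_eqs[OF wk_Set[OF C S] p]] by auto
qed

lemma PlusE:
  assumes A: "tp G A SetT" and B: "tp G B SetT" and C: "tp G C SetT"
    and h: "inh G (PlusT A B)" and l: "inh (El A # G) (wk C)" and r: "inh (El B # G) (wk C)"
  shows "inh G C"
proof -
  note S = ElF[OF PlusT_Set[OF A B]]
  have C': "tp G (Lam (wk C)) (Fun (El (PlusT A B)) SetT)"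
    by (intro LamR wk_Set C S)
  have *: "eqs (El D # G) (App (wk (Lam (wk C))) q) (wk C)"
    if "tp G D SetT" "tp (El D # G) q (El (wk (PlusT A B)))" for D q
    using beta_eqs[OF wk_Set[OF wk_Set[OF C ElF] Thin[OF S ElF, simplified]]] that by simp
  have 1: "tp (El A # G) (App (App (App (Con Inl_C) (wk A)) (wk B)) (Var 0)) (El (wk (PlusT A B)))"
    using tp_inl[OF wk_Set[OF A ElF[OF A]] wk_Set[OF B ElF[OF A]] Var0_El[OF ctx_El[OF A]]] by simp
  have 2: "tp (El B # G) (App (App (App (Con Inr_C) (wk A)) (wk B)) (Var 0)) (El (wk (PlusT A B)))"
    using tp_inr[OF wk_Set[OF A ElF[OF B]] wk_Set[OF B ElF[OF B]] Var0_El[OF ctx_El[OF B]]] by simp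
  obtain p where p: "tp G p (El (PlusT A B))" using h by blast
  obtain u v where "tp (El A # G) u (El (wk C))" "tp (El B # G) v (El (wk C))" using l r by blast
  with tp_when[OF A B C' LamR[OF conv_sym[OF _ *[OF A 1]]] LamR[OF conv_sym[OF _ *[OF B 2]]] p]
  have "inh G (App (Lam (wk C)) p)" by blast
  then show ?thesis using conv[OF _ beta_eqs[OF wk_Set[OF C S] p]] by auto
qed

lemma EmptyE:
  assumes C: "tp G C SetT" and h: "inh G (Con Empty_C)"
  shows "inh G C"
proof -
  note E = tp_Empty[OF der_ctx[OF C]]
  have C': "tp G (Lam (wk C)) (Fun (El (Con Empty_C)) SetT)"
    by (intro LamR wk_Set C ElF E)
  obtain t where t: "tp G t (El (Con Empty_C))" using h by blast
  from AppR[OF AppR[OF tp_EmptyRec[OF der_ctx[OF C]] C', simplified] t, simplified]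
  show ?thesis using conv[OF _ beta_eqs[OF wk_Set[OF C ElF[OF E]] t]] by auto
qed

end

text \<open>The uniformity principle asks for a function \<open>F\<close> and a proof about its
  values. Extracting both from a proof of a sum takes genuine projections; the elimination
  \<open>SigE\<close> into a fixed set does not give them.\<close>

abbreviation fstT :: "trm \<Rightarrow> trm \<Rightarrow> trm \<Rightarrow> trm" where
  "fstT A F p \<equiv> splitT A F (Lam (wk A)) (Lam (Lam (Var (Suc 0)))) p"
abbreviation sndT :: "trm \<Rightarrow> trm \<Rightarrow> trm \<Rightarrow> trm" where
  "sndT A F p \<equiv> splitT A F (Lam (App (wk F) (fstT (wk A) (wk F) (Var 0)))) (Lam (Lam (Var 0))) p"

context ctt begin

text \<open>The axiom equates closed abstractions. Peeling them off in the context of their arguments is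
  easier than reducing six nested redexes under arbitrary arguments.\<close>

lemma split_eq_ctx:
  defines "D1 \<equiv> [SetT]"
  defines "D2 \<equiv> Fun (El (Var 0)) SetT # D1"
  defines "D3 \<equiv> Fun (El (App (App (Con Sigma_C) (Var (Suc 0))) (Var 0))) SetT # D2"
  defines "D4 \<equiv> split_ty (Var (Suc (Suc 0))) (Var (Suc 0)) (Var 0) # D3"
  defines "D5 \<equiv> El (Var (Suc (Suc (Suc 0)))) # D4"
  defines "D6 \<equiv> El (App (Var (Suc (Suc (Suc 0)))) (Var 0)) # D5"
  defines "a \<equiv> Var (Suc (Suc (Suc (Suc (Suc 0)))))" and "f \<equiv> Var (Suc (Suc (Suc (Suc 0))))"
    and "c \<equiv> Var (Suc (Suc (Suc 0)))" and "e \<equiv> Var (Suc (Suc 0))"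
  shows "der T D6 (EqTm (splitT a f c e (pairT a f (Var (Suc 0)) (Var 0)))
    (App (App e (Var (Suc 0))) (Var 0)) (El (App c (pairT a f (Var (Suc 0)) (Var 0)))))"
proof -
  have t1: "der T [] (IsTy SetT)" by (intro SetF CtxNil)
  have c1: "der T D1 IsCtx" unfolding D1_def by (intro CtxCons t1)
  have v1: "tp D1 (Var 0) SetT" using VarR[OF c1, of 0] by (simp add: D1_def)
  have t2: "der T D1 (IsTy (Fun (El (Var 0)) SetT))"
    by (intro FunF ElF v1 SetF CtxCons)
  have c2: "der T D2 IsCtx" unfolding D2_def by (intro CtxCons t2)
  have v2: "tp D2 (Var (Suc 0)) SetT" "tp D2 (Var 0) (Fun (El (Var (Suc 0))) SetT)"
    using VarR[OF c2, of 0] VarR[OF c2, of "Suc 0"] by (simp_all add: D1_def D2_def shift_def)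
  have t3: "der T D2 (IsTy (Fun (El (App (App (Con Sigma_C) (Var (Suc 0))) (Var 0))) SetT))"
    by (intro FunF ElF Sigma_Set v2 SetF CtxCons)
  have c3: "der T D3 IsCtx" unfolding D3_def by (intro CtxCons t3)
  have v3: "tp D3 (Var (Suc (Suc 0))) SetT" "tp D3 (Var (Suc 0)) (Fun (El (Var (Suc (Suc 0)))) SetT)"
    "tp D3 (Var 0) (Fun (El (App (App (Con Sigma_C) (Var (Suc (Suc 0)))) (Var (Suc 0)))) SetT)"
    using VarR[OF c3, of 0] VarR[OF c3, of "Suc 0"] VarR[OF c3, of "Suc (Suc 0)"]
    by (simp_all add: D1_def D2_def D3_def shift_def)
  note p = pair_ctx[OF v3(1,2), simplified]
  have t4: "der T D3 (IsTy (split_ty (Var (Suc (Suc 0))) (Var (Suc 0)) (Var 0)))"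
    using tp_App[OF wk_fam[OF wk_fam[OF v3(3) ElF[OF v3(1)]] ElF[OF p(1)], simplified] p(5)] p(1)
    by (auto intro!: FunF ElF v3)
  have c4: "der T D4 IsCtx" unfolding D4_def by (intro CtxCons t4)
  have v4: "tp D4 (Var (Suc (Suc (Suc 0)))) SetT"
    using Thin[OF v3(1) t4] by (simp add: D4_def)
  have t5: "der T D4 (IsTy (El (Var (Suc (Suc (Suc 0))))))" by (intro ElF v4)
  have c5: "der T D5 IsCtx" unfolding D5_def by (intro CtxCons t5)
  have v5: "tp D5 (Var (Suc (Suc (Suc 0)))) (Fun (El (Var (Suc (Suc (Suc (Suc 0)))))) SetT)"
    "tp D5 (Var 0) (El (Var (Suc (Suc (Suc (Suc 0))))))"
    using VarR[OF c5, of "Suc (Suc (Suc 0))"] VarR[OF c5, of 0]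
    by (simp_all add: D1_def D2_def D3_def D4_def D5_def shift_def)
  have t6: "der T D5 (IsTy (El (App (Var (Suc (Suc (Suc 0)))) (Var 0))))"
    using tp_App[OF v5] by (simp add: ElF)
  have c6: "der T D6 IsCtx" unfolding D6_def by (intro CtxCons t6)
  have v6: "tp D6 a SetT" "tp D6 f (Fun (El a) SetT)"
    "tp D6 c (Fun (El (App (App (Con Sigma_C) a) f)) SetT)" "tp D6 e (split_ty a f c)"
    "tp D6 (Var (Suc 0)) (El a)" "tp D6 (Var 0) (El (App f (Var (Suc 0))))"
    using VarR[OF c6, of "Suc (Suc (Suc (Suc (Suc 0))))"] VarR[OF c6, of "Suc (Suc (Suc (Suc 0)))"]
      VarR[OF c6, of "Suc (Suc (Suc 0))"] VarR[OF c6, of "Suc (Suc 0)"]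
      VarR[OF c6, of "Suc 0"] VarR[OF c6, of 0]
    by (simp_all add: D1_def D2_def D3_def D4_def D5_def D6_def a_def f_def c_def e_def shift_def)
  have l: "tp D6 (splitT a f c e (pairT a f (Var (Suc 0)) (Var 0)))
      (El (App c (pairT a f (Var (Suc 0)) (Var 0))))"
    by (intro tp_split tp_pair v6)
  have r: "tp D6 (App (App e (Var (Suc 0))) (Var 0))
      (El (App c (pairT a f (Var (Suc 0)) (Var 0))))"
    by (rule tp_App[OF tp_App[OF v6(4,5), OF refl, simplified] v6(6)]) simp
  have "der T [] (EqTm
     (Lam (Lam (Lam (Lam (Lam (Lam (splitT a f c e (pairT a f (Var (Suc 0)) (Var 0)))))))))
     (Lam (Lam (Lam (Lam (Lam (Lam (App (App e (Var (Suc 0))) (Var 0))))))))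
     (Fun (SetT) (Fun (Fun (El (Var 0)) SetT)
       (Fun (Fun (El (App (App (Con Sigma_C) (Var (Suc 0))) (Var 0))) SetT)
        (Fun (split_ty (Var (Suc (Suc 0))) (Var (Suc 0)) (Var 0))
         (Fun (El (Var (Suc (Suc (Suc 0)))))
          (Fun (El (App (Var (Suc (Suc (Suc 0)))) (Var 0)))
           (El (App c (pairT a f (Var (Suc 0)) (Var 0)))))))))))"
    by (rule Equation[OF CtxNil], rule subsetD[OF CTT])
       (simp add: unfold_CTT a_def f_def c_def e_def)
  note eq = this[unfolded D1_def]
  note l6 = l[unfolded D6_def] note l5 = LamR[OF l6] note l4 = LamR[OF l5[unfolded D5_def]]
  note l3 = LamR[OF l4[unfolded D4_def]] note l2 = LamR[OF l3[unfolded D3_def]] note l1 = LamR[OF l2[unfolded D2_def]]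
  note r6 = r[unfolded D6_def] note r5 = LamR[OF r6] note r4 = LamR[OF r5[unfolded D5_def]]
  note r3 = LamR[OF r4[unfolded D4_def]] note r2 = LamR[OF r3[unfolded D3_def]] note r1 = LamR[OF r2[unfolded D2_def]]
  \<comment> \<open>Each line strips one abstraction and moves the equation into the next longer
    context.\<close>
  note e1 = lam_inj[OF eq l1[unfolded D1_def] r1[unfolded D1_def] t1, folded D1_def]
  note e2 = lam_inj[OF e1 l2[unfolded D2_def] r2[unfolded D2_def] t2, folded D2_def]
  note e3 = lam_inj[OF e2 l3[unfolded D3_def] r3[unfolded D3_def] t3, folded D3_def]
  note e4 = lam_inj[OF e3 l4[unfolded D4_def] r4[unfolded D4_def] t4, folded D4_def]
  note e5 = lam_inj[OF e4 l5[unfolded D5_def] r5[unfolded D5_def] t5, folded D5_def]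
  show ?thesis
    using lam_inj[OF e5 l6 r6 t6] unfolding D6_def .
qed

text \<open>One simultaneous substitution replaces the six generic variables by the actual
  arguments.\<close>

lemma split_eq:
  assumes A: "tp G A SetT" and F: "tp G F (Fun (El A) SetT)"
    and C: "tp G C (Fun (El (App (App (Con Sigma_C) A) F)) SetT)"
    and e: "tp G e (split_ty A F C)" and a: "tp G a (El A)" and b: "tp G b (El (App F a))"
  shows "der T G (EqTm (splitT A F C e (pairT A F a b)) (App (App e a) b)
    (El (App C (pairT A F a b))))"
proof -
  have "sub_ok T G (case_nat b (case_nat a (case_nat e (case_nat C (case_nat F (case_nat A Var))))))
    [El (App (Var (Suc (Suc (Suc 0)))) (Var 0)), El (Var (Suc (Suc (Suc 0)))),
     split_ty (Var (Suc (Suc 0))) (Var (Suc 0)) (Var 0),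
     Fun (El (App (App (Con Sigma_C) (Var (Suc 0))) (Var 0))) SetT,
     Fun (El (Var 0)) SetT, SetT]"
    by (intro sub_ok_cons sub_ok_Nil der_ctx[OF A]) (use assms in simp_all)
  from subst[OF split_eq_ctx this] show ?thesis by simp
qed

lemma tp_fst:
  assumes A: "tp G A SetT" and F: "tp G F (Fun (El A) SetT)"
  shows tp_fst_arg: "tp G (Lam (Lam (Var (Suc 0)))) (split_ty A F (Lam (wk A)))"
    and "tp G p (El (App (App (Con Sigma_C) A) F)) \<Longrightarrow> tp G (fstT A F p) (El A)"
proof -
  note S = ElF[OF Sigma_Set[OF A F]]
  note A' = wk_Set[OF A S]
  show 1: "tp G (Lam (Lam (Var (Suc 0)))) (split_ty A F (Lam (wk A)))"
    by (rule tp_split_ty[OF A F A']) (use pair_ctx[OF A F] in simp)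
  show "tp G (fstT A F p) (El A)" if p: "tp G p (El (App (App (Con Sigma_C) A) F))"
    using conv[OF tp_split[OF A F LamR[OF A'] 1 p] beta_eqs[OF A' p]] by simp
qed

text \<open>Needed to type the second projection, whose type mentions the first.\<close>

lemma fst_pair:
  assumes A: "tp G A SetT" and F: "tp G F (Fun (El A) SetT)"
    and a: "tp G a (El A)" and b: "tp G b (El (App F a))"
  shows "der T G (EqTm (fstT A F (pairT A F a b)) a (El A))"
proof -
  note S = ElF[OF Sigma_Set[OF A F]]
  note A' = wk_Set[OF A S]
  note q = tp_pair[OF A F a b]
  have "der T G (EqTm (fstT A F (pairT A F a b)) (App (App (Lam (Lam (Var (Suc 0)))) a) b)
      (El (App (Lam (wk A)) (pairT A F a b))))"
    by (rule split_eq[OF A F LamR[OF A'] tp_fst_arg[OF A F] a b])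
  then have 1: "der T G (EqTm (fstT A F (pairT A F a b)) (App (App (Lam (Lam (Var (Suc 0)))) a) b) (El A))"
    using EqConv ElEq beta_eqs[OF A' q] by fastforce
  note X = pair_ctx[OF A F]
  have L: "tp (El A # G) (Lam (Var (Suc 0))) (Fun (El (App (wk F) (Var 0))) (El (wk (wk A))))"
    by (intro LamR X)
  have 2: "der T G (EqTm (App (App (Lam (Lam (Var (Suc 0)))) a) b) (App (Lam (wk a)) b) (El A))"
    using AppEq[OF Beta[OF L a, simplified] TmRefl[OF b]] by simp
  have 3: "der T G (EqTm (App (Lam (wk a)) b) a (El A))"
    using Beta[OF wk_El[OF a ElF[OF tp_App[OF F a]]], simplified, OF b] by simp
  show ?thesis using 1 2 3 TmTrans by blast
qed

lemma tp_snd: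
  assumes A: "tp G A SetT" and F: "tp G F (Fun (El A) SetT)"
    and p: "tp G p (El (App (App (Con Sigma_C) A) F))"
  shows "tp G (sndT A F p) (El (App F (fstT A F p)))"
proof -
  let ?C = "App (wk F) (fstT (wk A) (wk F) (Var 0))"
  note S = Sigma_Set[OF A F]
  have C: "tp (El (App (App (Con Sigma_C) A) F) # G) ?C SetT"
    using tp_App[OF wk_fam[OF F ElF[OF S]] tp_fst(2)[OF wk_Set[OF A ElF[OF S]] wk_fam[OF F ElF[OF S]]]]
      Var0_El[OF ctx_El[OF S]] by simp
  note X = pair_ctx[OF A F]
  let ?H = "El (App (wk F) (Var 0)) # El A # G"
  have A2: "tp ?H (wk (wk A)) SetT" by (intro wk_Set ElF A X)
  have F2: "tp ?H (wk (wk F)) (Fun (El (wk (wk A))) SetT)" by (intro wk_fam ElF F A X)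
  \<comment> \<open>At a pair, the motive asks for an element over its first projection, while the
    second component lies over the first component itself; \<open>fst_pair\<close> identifies the
    two.\<close>
  have "eqs ?H (App (wk (wk F)) (fstT (wk (wk A)) (wk (wk F)) (pairT (wk (wk A)) (wk (wk F)) (Var (Suc 0)) (Var 0))))
      (App (wk (wk F)) (Var (Suc 0)))"
    using AppEq[OF TmRefl[OF F2] fst_pair[OF A2 F2 X(4,3)]] by simp
  from conv_sym[OF X(3) this]
  have "tp G (Lam (Lam (Var 0))) (split_ty A F (Lam ?C))"
    using tp_split_ty[OF A F C] by simp
  from conv[OF tp_split[OF A F LamR[OF C] this p] beta_eqs[OF C p]]
  show ?thesis by simp
qed

lemma andE:
  assumes "tp G A SetT" "tp G B SetT" "inh G (andT A B)"
  shows "inh G A" "inh G B"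
proof -
  note B = wk_Set[OF assms(2) ElF[OF assms(1)]]
  obtain p where p: "tp G p (El (andT A B))" using assms(3) by blast
  note q = tp_fst(2)[OF assms(1) LamR[OF B] p]
  then show "inh G A" by blast
  show "inh G B"
    using conv[OF tp_snd[OF assms(1) LamR[OF B] p] beta_eqs[OF B q]] by auto
qed

section \<open>Decoding in the universe\<close>

lemma eqs_Dec: "der T G IsCtx \<Longrightarrow> eqs G (App (Con Dec) (Con UEmpty)) (Con Empty_C)"
  "der T G IsCtx \<Longrightarrow> eqs G (App (Con Dec) (Con UUnit)) (Con Unit_C)"
  by (rule Equation, assumption, rule subsetD[OF CTT], simp add: unfold_CTT)+

lemma Dec_Set: "tp G u (El (Con Univ)) \<Longrightarrow> tp G (App (Con Dec) u) SetT"
  by (rule tp_App[OF tp_Dec]) (auto intro: der_ctx)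

end

locale ctt_gup = ctt +
  assumes GUP: "GUP_CTT \<subseteq> T"
begin

lemma tp_gup:
  assumes I: "tp G I SetT" and R: "tp G R (Fun SetT (Fun (El (wk I)) SetT))"
    and F: "tp G F (Fun SetT (El (wk I)))"
    and r: "tp G r (Fun SetT (El (App (App (wk R) (Var 0)) (App (wk F) (Var 0)))))"
  obtains w where "tp G w (El I)" "inh (SetT # G) (App (App (wk R) (Var 0)) (wk w))"
    "\<And>P. tp G P SetT \<Longrightarrow> inh G (App (App R P) w)"
proof -
  note c = der_ctx[OF I]
  have GW: "tp G (Con GupWitness) (Fun SetT (Fun (Fun SetT (Fun (El (Var (Suc 0))) SetT))
      (Fun (Fun SetT (El (Var (Suc (Suc 0)))))
       (Fun (Fun SetT (El (App (App (Var (Suc (Suc 0))) (Var 0)) (App (Var (Suc 0)) (Var 0)))))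
        (El (Var (Suc (Suc (Suc 0)))))))))"
    by (rule der.Const[OF c], rule subsetD[OF GUP]) (simp add: GUP_CTT_def unfold_CTT)
  have GP: "tp G (Con GupProof) (Fun SetT (Fun (Fun SetT (Fun (El (Var (Suc 0))) SetT))
      (Fun (Fun SetT (El (Var (Suc (Suc 0)))))
       (Fun (Fun SetT (El (App (App (Var (Suc (Suc 0))) (Var 0)) (App (Var (Suc 0)) (Var 0)))))
        (Fun SetT (El (App (App (Var (Suc (Suc (Suc 0)))) (Var 0))
          (App (App (App (App (Con GupWitness) (Var (Suc (Suc (Suc (Suc 0)))))) (Var (Suc (Suc (Suc 0)))))
            (Var (Suc (Suc 0)))) (Var (Suc 0))))))))))"
    by (rule der.Const[OF c], rule subsetD[OF GUP]) (simp add: GUP_CTT_def unfold_CTT)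
  let ?w = "App (App (App (App (Con GupWitness) I) R) F) r"
  have w: "tp G ?w (El I)"
    using AppR[OF AppR[OF AppR[OF AppR[OF GW I, simplified] R, simplified] F, simplified] r, simplified] .
  obtain q where q: "tp G q (Fun SetT (El (App (App (wk R) (Var 0)) (wk ?w))))"
    using AppR[OF AppR[OF AppR[OF AppR[OF GP I, simplified] R, simplified] F, simplified] r, simplified]
    by auto
  have "tp (SetT # G) (App (wk q) (Var 0)) (El (App (App (wk R) (Var 0)) (wk ?w)))"
    using AppR[OF Thin[OF q SetF[OF c], simplified] Var0_Set[OF ctx_Set[OF c]]] by simp
  moreover have "tp G (App q P) (El (App (App R P) ?w))" if "tp G P SetT" for P
    using tp_App[OF q that refl] by simp
  ultimately show ?thesis using that w by blast
qed

text \<open>It is enough to prove existence for one variable proposition. Abstracting that variable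
  from the two projections of the proof \<open>h\<close> yields the function and the proof that the
  principle takes as arguments.\<close>

lemma gup:
  assumes I: "tp G I SetT" and B: "tp (El (wk I) # SetT # G) B SetT"
    and h: "inh (SetT # G) (SigT (wk I) B)"
  obtains w where "tp G w (El I)" "inh (SetT # G) (sub (single (wk w)) B)"
    "\<And>P. tp G P SetT \<Longrightarrow> inh G (sub (single w) (sub (lift_sub (single P)) B))"
proof -
  note c = der_ctx[OF I]
  note S = SetF[OF c]
  note cS = ctx_Set[OF c]
  note I' = wk_Set[OF I S]
  obtain h where h: "tp (SetT # G) h (El (SigT (wk I) B))" using h by blast
  note LB = LamR[OF B]
  let ?f = "fstT (wk I) (Lam B) h"
  let ?R = "Lam (Lam B)" and ?F = "Lam ?f" and ?r = "Lam (sndT (wk I) (Lam B) h)"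
  note f = tp_fst(2)[OF I' LB h]
  have R: "tp G ?R (Fun SetT (Fun (El (wk I)) SetT))" by (intro LamR B)
  have F: "tp G ?F (Fun SetT (El (wk I)))" by (rule LamR[OF f])
  have "der T (SetT # G) (EqTm (App (wk ?R) (Var 0)) (Lam B) (Fun (El (wk I)) SetT))"
    by (rule beta_Var0[OF LB S])
  moreover have "der T (SetT # G) (EqTm (App (wk ?F) (Var 0)) ?f (El (wk I)))"
    by (rule beta_Var0[OF f S])
  ultimately have "eqs (SetT # G) (App (App (wk ?R) (Var 0)) (App (wk ?F) (Var 0))) (App (Lam B) ?f)"
    using AppEq by fastforce
  from LamR[OF conv_sym[OF tp_snd[OF I' LB h] this]]
  have r: "tp G ?r (Fun SetT (El (App (App (wk ?R) (Var 0)) (App (wk ?F) (Var 0)))))" .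
  obtain w where w: "tp G w (El I)" and q: "inh (SetT # G) (App (App (wk ?R) (Var 0)) (wk w))"
    and qP: "\<And>P. tp G P SetT \<Longrightarrow> inh G (App (App ?R P) w)"
    using tp_gup[OF I R F r] by blast
  have w': "tp (SetT # G) (wk w) (El (wk I))" by (rule wk_El[OF w S])
  have "eqs (SetT # G) (App (App (wk ?R) (Var 0)) (wk w)) (App (Lam B) (wk w))"
    using AppEq[OF beta_Var0[OF LB S] TmRefl[OF w']] by simp
  then have "inh (SetT # G) (sub (single (wk w)) B)"
    using q conv beta_eqs[OF B w'] by blast
  moreover have "inh G (sub (single w) (sub (lift_sub (single P)) B))" if P: "tp G P SetT" for P
  proof -
    have ok: "sub_ok T G (single P) (SetT # G)"
      unfolding single_def by (rule sub_ok_cons[OF sub_ok_Var[OF c]]) (simp add: P)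
    have B': "tp (El I # G) (sub (lift_sub (single P)) B) SetT"
      using subst[OF B sub_ok_lift[OF ok]] ElF[OF I] by simp
    have "eqs G (App (App ?R P) w) (App (Lam (sub (lift_sub (single P)) B)) w)"
      using AppEq[OF Beta[OF LB P, simplified] TmRefl[OF w]] by simp
    then show ?thesis using qP[OF P] conv beta_eqs[OF B' w] by blast
  qed
  ultimately show ?thesis using that w by blast
qed

end

section \<open>Formal spaces in type theory\<close>

locale ctt_space = ctt_gup +
  fixes s r :: trm
  assumes s: "tp [] s SetT" and r: "tp [] r (Fun (El s) (Fun (Fun (El s) SetT) SetT))"
begin

lemma sub_s [simp]: "sub \<theta> s = s" and sub_r [simp]: "sub \<theta> r = r"
  using der_closed s r by blast+

abbreviation subset :: ty where "subset \<equiv> Fun (El s) SetT"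
abbreviation cov :: "trm \<Rightarrow> trm \<Rightarrow> trm" where "cov a U \<equiv> App (App r a) U"
abbreviation emptyU :: trm where "emptyU \<equiv> Lam (Con Empty_C)"
text \<open>These are definitions and not abbreviations so that \<open>sub_ops\<close> can move
  substitutions through them without unfolding their de Bruijn bodies.\<close>

definition singleU :: "trm \<Rightarrow> trm" where "singleU a = Lam (IdT s (Var 0) (wk a))"
definition below :: "trm \<Rightarrow> trm \<Rightarrow> trm" where
  "below U d = SigT s (andT (App (wk U) (Var 0)) (cov (wk d) (singleU (Var 0))))"
definition downU :: "trm \<Rightarrow> trm \<Rightarrow> trm" where
  "downU U V = Lam (andT (below (wk U) (Var 0)) (below (wk V) (Var 0)))"
definition pseudoU :: "trm \<Rightarrow> trm" where
  "pseudoU U = Lam (PiT s (impT (App (downU (singleU (Var (Suc 0))) (wk (wk U))) (Var 0))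
     (cov (Var 0) emptyU)))"
definition unionU :: "trm \<Rightarrow> trm \<Rightarrow> trm" where
  "unionU U V = Lam (PlusT (App (wk U) (Var 0)) (App (wk V) (Var 0)))"
definition subU :: "trm \<Rightarrow> trm \<Rightarrow> trm" where
  "subU U V = PiT s (impT (App (wk U) (Var 0)) (App (wk V) (Var 0)))"

lemma sub_ops [simp]:
  "sub \<theta> (singleU a) = singleU (sub \<theta> a)"
  "sub \<theta> (below U d) = below (sub \<theta> U) (sub \<theta> d)"
  "sub \<theta> (downU U V) = downU (sub \<theta> U) (sub \<theta> V)"
  "sub \<theta> (pseudoU U) = pseudoU (sub \<theta> U)"
  "sub \<theta> (unionU U V) = unionU (sub \<theta> U) (sub \<theta> V)"
  "sub \<theta> (subU U V) = subU (sub \<theta> U) (sub \<theta> V)"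
proof -
  show 1: "sub \<theta> (singleU a) = singleU (sub \<theta> a)" for \<theta> a by (simp add: singleU_def)
  show 2: "sub \<theta> (below U d) = below (sub \<theta> U) (sub \<theta> d)" for \<theta> U d by (simp add: below_def 1)
  show 3: "sub \<theta> (downU U V) = downU (sub \<theta> U) (sub \<theta> V)" for \<theta> U V by (simp add: downU_def 2)
  show "sub \<theta> (pseudoU U) = pseudoU (sub \<theta> U)" by (simp add: pseudoU_def 1 3)
qed (simp_all add: unionU_def subU_def)

section \<open>Typing of the operations on subsets\<close>

lemma tp_s: "der T G IsCtx \<Longrightarrow> tp G s SetT"
  using subst[OF s sub_ok_Nil, of G] by simp
lemma ty_s: "der T G IsCtx \<Longrightarrow> der T G (IsTy (El s))"
  using tp_s ElF by blast
lemma tp_cov: "tp G a (El s) \<Longrightarrow> tp G U subset \<Longrightarrow> tp G (cov a U) SetT"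
  by (rule tp_App[OF tp_App]) (use subst[OF r sub_ok_Nil, of G] der_ctx in auto)

lemma ctx_s: "der T G IsCtx \<Longrightarrow> der T (El s # G) IsCtx"
  by (intro CtxCons ty_s)
lemma Var0_s: "der T G IsCtx \<Longrightarrow> tp (El s # G) (Var 0) (El s)"
  using Var0_El[of s G] ctx_s by simp
lemma VarSuc_s: "tp G (Var n) (El s) \<Longrightarrow> der T G (IsTy \<gamma>) \<Longrightarrow> tp (\<gamma> # G) (Var (Suc n)) (El s)"
  using wk_El[of G "Var n" s \<gamma>] by simp
lemma wk_s: "tp G a (El s) \<Longrightarrow> der T G (IsTy \<gamma>) \<Longrightarrow> tp (\<gamma> # G) (wk a) (El s)"
  using wk_El[of G a s \<gamma>] by simp
lemma wk_subset: "tp G U subset \<Longrightarrow> der T G (IsTy \<gamma>) \<Longrightarrow> tp (\<gamma> # G) (wk U) subset"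
  using wk_fam[of G U s \<gamma>] by simp

lemma tp_mem: "tp G U subset \<Longrightarrow> tp G a (El s) \<Longrightarrow> tp G (App U a) SetT"
  by (rule tp_App) auto
lemma tp_emptyU: "der T G IsCtx \<Longrightarrow> tp G emptyU subset"
  by (intro LamR tp_Empty ctx_s)
lemma tp_const: "tp G P SetT \<Longrightarrow> tp G (Lam (wk P)) subset"
  by (intro LamR wk_Set ty_s der_ctx[of T G "HasTy P SetT"])
lemma tp_singleU: assumes "tp G a (El s)" shows "tp G (singleU a) subset"
proof -
  note c = der_ctx[OF assms]
  show ?thesis
    unfolding singleU_def by (intro LamR IdT_Set tp_s ctx_s c Var0_s wk_s assms ty_s)
qed

lemma below_body:
  assumes "tp G U subset" "tp G d (El s)"
  shows "tp (El s # G) (App (wk U) (Var 0)) SetT"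
    "tp (El s # G) (cov (wk d) (singleU (Var 0))) SetT"
proof -
  note c = der_ctx[OF assms(1)]
  show "tp (El s # G) (App (wk U) (Var 0)) SetT"
    "tp (El s # G) (cov (wk d) (singleU (Var 0))) SetT"
    by (intro tp_mem wk_subset assms ty_s c Var0_s tp_cov tp_singleU wk_s)+
qed

lemma tp_below:
  assumes "tp G U subset" "tp G d (El s)"
  shows "tp G (below U d) SetT"
  unfolding below_def by (intro SigT_Set tp_s der_ctx[OF assms(1)] andT_Set below_body[OF assms])

lemma downU_body:
  assumes "tp G U subset"
  shows "tp (El s # G) (below (wk U) (Var 0)) SetT"
proof -
  note c = der_ctx[OF assms]
  show ?thesis by (intro tp_below wk_subset ty_s c Var0_s assms)
qed

lemma tp_downU: "tp G U subset \<Longrightarrow> tp G V subset \<Longrightarrow> tp G (downU U V) subset"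
  unfolding downU_def by (intro LamR andT_Set downU_body)

lemma tp_subU:
  assumes "tp G U subset" "tp G V subset"
  shows "tp (El s # G) (App (wk U) (Var 0)) SetT" "tp (El s # G) (App (wk V) (Var 0)) SetT"
    "tp G (subU U V) SetT"
proof -
  note c = der_ctx[OF assms(1)]
  show *: "tp (El s # G) (App (wk U) (Var 0)) SetT" "tp (El s # G) (App (wk V) (Var 0)) SetT"
    by (intro tp_mem wk_subset assms ty_s c Var0_s)+
  show "tp G (subU U V) SetT" unfolding subU_def by (intro PiT_Set tp_s c impT_Set *)
qed

lemma tp_unionU: "tp G U subset \<Longrightarrow> tp G V subset \<Longrightarrow> tp G (unionU U V) subset"
  unfolding unionU_def using tp_subU by (intro LamR PlusT_Set)

lemma pseudoU_inner:
  assumes "tp G U subset" "tp G a (El s)"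
  shows "tp (El s # G) (App (downU (singleU (wk a)) (wk U)) (Var 0)) SetT"
    "tp (El s # G) (cov (Var 0) emptyU) SetT"
proof -
  note c = der_ctx[OF assms(1)]
  show "tp (El s # G) (App (downU (singleU (wk a)) (wk U)) (Var 0)) SetT"
    "tp (El s # G) (cov (Var 0) emptyU) SetT"
    by (intro tp_mem tp_cov tp_downU tp_singleU wk_s wk_subset tp_emptyU assms Var0_s ty_s ctx_s c)+
qed

lemma pseudoU_body:
  assumes "tp G U subset"
  shows "tp (El s # G) (PiT s (impT (App (downU (singleU (Var (Suc 0))) (wk (wk U))) (Var 0))
     (cov (Var 0) emptyU))) SetT"
proof -
  note c = der_ctx[OF assms]
  note i = pseudoU_inner[OF wk_subset[OF assms ty_s[OF c]] Var0_s[OF c], simplified]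
  show ?thesis by (intro PiT_Set impT_Set i tp_s ctx_s c)
qed

lemma tp_pseudoU: "tp G U subset \<Longrightarrow> tp G (pseudoU U) subset"
  unfolding pseudoU_def by (intro LamR pseudoU_body)

section \<open>Membership in singletons, refinements and pseudocomplements\<close>

lemma inh_beta:
  assumes "tp (\<alpha> # G) B SetT" "tp G a \<alpha>"
  shows "inh G (App (Lam B) a) \<longleftrightarrow> inh G (sub (single a) B)"
  using conv conv_sym beta_eqs[OF assms] by blast

lemma inh_eqs: "eqs G A B \<Longrightarrow> inh G A \<longleftrightarrow> inh G B"
  using conv conv_sym by blast

lemma wk_inh: "inh G A \<Longrightarrow> der T G (IsTy \<gamma>) \<Longrightarrow> inh (\<gamma> # G) (wk A)"
  using wk_El by blast
lemma hyp: "tp G A SetT \<Longrightarrow> inh (El A # G) (wk A)"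
  using Var0_El ctx_El by blast

lemma mem_single:
  assumes "tp G a (El s)" shows "inh G (App (singleU a) a)"
proof -
  note c = der_ctx[OF assms]
  have "tp (El s # G) (IdT s (Var 0) (wk a)) SetT"
    by (intro IdT_Set tp_s ctx_s c Var0_s wk_s assms ty_s)
  from inh_beta[OF this assms] show ?thesis
    unfolding singleU_def using tp_Refl[OF tp_s[OF c] assms] by auto
qed

lemma belowI:
  assumes "tp G U subset" "tp G d (El s)" "tp G u (El s)" "inh G (App U u)"
    "inh G (cov d (singleU u))"
  shows "inh G (below U d)"
  unfolding below_def
proof (rule SigI)
  note c = der_ctx[OF assms(1)]
  show "tp G s SetT" by (rule tp_s[OF c])
  show "tp (El s # G) (andT (App (wk U) (Var 0)) (cov (wk d) (singleU (Var 0)))) SetT"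
    by (intro andT_Set below_body[OF assms(1,2)])
  show "tp G u (El s)" by fact
  have "inh G (andT (App U u) (cov d (singleU u)))"
    by (intro andI tp_mem tp_cov tp_singleU assms)
  then show "inh G (sub (single u) (andT (App (wk U) (Var 0)) (cov (wk d) (singleU (Var 0)))))"
    by simp
qed

lemma mem_downU:
  assumes "tp G U subset" "tp G V subset" "tp G d (El s)"
  shows "inh G (App (downU U V) d) \<longleftrightarrow> inh G (andT (below U d) (below V d))"
  unfolding downU_def
  using inh_beta[OF andT_Set[OF downU_body downU_body], OF assms] by simp

lemma mem_unionU:
  assumes "tp G U subset" "tp G V subset" "tp G x (El s)"
  shows "inh G (App (unionU U V) x) \<longleftrightarrow> inh G (PlusT (App U x) (App V x))"
  unfolding unionU_def
  using inh_beta[OF PlusT_Set[OF tp_subU(1,2)[OF assms(1,2)]] assms(3)] by simp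

lemma mem_pseudoU:
  assumes "tp G U subset" "tp G x (El s)"
  shows "inh G (App (pseudoU U) x) \<longleftrightarrow>
    inh G (PiT s (impT (App (downU (singleU (wk x)) (wk U)) (Var 0)) (cov (Var 0) emptyU)))"
  unfolding pseudoU_def using inh_beta[OF pseudoU_body, OF assms] by simp

lemma pseudoUI:
  assumes "tp G U subset" "tp G x (El s)"
    and "inh (El (App (downU (singleU (wk x)) (wk U)) (Var 0)) # El s # G) (cov (Var (Suc 0)) emptyU)"
  shows "inh G (App (pseudoU U) x)"
proof -
  note c = der_ctx[OF assms(1)]
  show ?thesis
    unfolding mem_pseudoU[OF assms(1,2)]
    by (intro PiI tp_s c impT_Set impI pseudoU_inner[OF assms(1,2)]) (use assms(3) in simp)
qed

lemma pseudoUE: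
  assumes "tp G U subset" "tp G x (El s)" "inh G (App (pseudoU U) x)"
    "tp G d (El s)" "inh G (App (downU (singleU x) U) d)"
  shows "inh G (cov d emptyU)"
proof -
  note c = der_ctx[OF assms(1)]
  have "inh G (impT (App (downU (singleU x) U) d) (cov d emptyU))"
    using PiE[OF tp_s[OF c] impT_Set[OF pseudoU_inner[OF assms(1,2)]]
        assms(3)[unfolded mem_pseudoU[OF assms(1,2)]] assms(4)] by simp
  then show ?thesis
    by (rule impE[rotated 2]) (use assms(5) in \<open>auto intro!: tp_mem tp_downU tp_singleU tp_cov tp_emptyU assms c\<close>)
qed

lemma mem_empty:
  assumes "tp G x (El s)" "inh G (App emptyU x)" shows "inh G (Con Empty_C)"
proof -
  note c = der_ctx[OF assms(1)]
  show ?thesis using inh_beta[OF tp_Empty[OF ctx_s[OF c]] assms(1)] assms(2) by simp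
qed

lemma below_empty:
  assumes d: "tp G d (El s)" and h: "inh G (below emptyU d)"
  shows "inh G (Con Empty_C)"
proof -
  note c = der_ctx[OF d]
  note b = below_body[OF tp_emptyU[OF c] d]
  let ?A = "App (wk emptyU) (Var 0)" and ?B = "cov (wk d) (singleU (Var 0))"
  note ab = andT_Set[OF b]
  have "inh (El (andT ?A ?B) # El s # G) (wk ?A)"
    using andE(1)[OF wk_Set[OF b(1)] wk_Set[OF b(2)], OF ElF[OF ab] ElF[OF ab]] hyp[OF ab] by simp
  then have "inh (El (andT ?A ?B) # El s # G) (Con Empty_C)"
    using mem_empty[OF VarSuc_s[OF Var0_s[OF c] ElF[OF ab]]] by simp
  with SigE[OF tp_s[OF c] ab tp_Empty[OF c] h[unfolded below_def]] show ?thesis by simp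
qed

text \<open>A common refinement with the empty subset would lie below one of its elements, so the
  required cover follows ex falso.\<close>

lemma mem_pseudo_empty:
  assumes x: "tp G x (El s)"
  shows "inh G (App (pseudoU emptyU) x)"
proof (rule pseudoUI[OF tp_emptyU[OF der_ctx[OF x]] x])
  note c = der_ctx[OF x]
  let ?A = "App (downU (singleU (wk x)) (wk emptyU)) (Var 0)"
  let ?G = "El ?A # El s # G"
  note A = pseudoU_inner(1)[OF tp_emptyU[OF c] x]
  note c' = ctx_El[OF A]
  have v: "tp ?G (Var (Suc 0)) (El s)" by (intro VarSuc_s Var0_s c ElF A)
  have S: "tp ?G (singleU (wk (wk x))) subset" by (intro tp_singleU wk_s x ty_s c ElF A)
  have "inh ?G (App (downU (singleU (wk (wk x))) emptyU) (Var (Suc 0)))"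
    using hyp[OF A] by simp
  then have "inh ?G (andT (below (singleU (wk (wk x))) (Var (Suc 0))) (below emptyU (Var (Suc 0))))"
    using mem_downU[OF S tp_emptyU[OF c'] v] by blast
  then have "inh ?G (Con Empty_C)"
    using andE(2)[OF tp_below[OF S v] tp_below[OF tp_emptyU[OF c'] v]] below_empty[OF v] by blast
  then show "inh ?G (cov (Var (Suc 0)) emptyU)"
    by (rule EmptyE[rotated]) (intro tp_cov v tp_emptyU c')
qed

end

text \<open>Assumed in every context, because the uniformity argument takes place under a variable
  proposition.\<close>

locale ctt_reflexive_space = ctt_space +
  assumes refl: "\<And>G a U. tp G a (El s) \<Longrightarrow> tp G U subset \<Longrightarrow> inh G (App U a) \<Longrightarrow> inh G (cov a U)"
begin

lemma cov_single: "tp G a (El s) \<Longrightarrow> inh G (cov a (singleU a))"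
  by (intro refl tp_singleU mem_single)

lemma pseudo_disjoint:
  assumes U: "tp G U subset" and x: "tp G x (El s)"
    and 1: "inh G (App U x)" and 2: "inh G (App (pseudoU U) x)"
  shows "inh G (cov x emptyU)"
proof (rule pseudoUE[OF U x 2 x])
  note S = tp_singleU[OF x]
  show "inh G (App (downU (singleU x) U) x)"
    unfolding mem_downU[OF S U x]
    by (intro andI tp_below S U x belowI[OF S x x] belowI[OF U x x] mem_single cov_single 1)
qed

end

text \<open>\<open>K\<close> stands for the identity in the Boolean case and for the double
  pseudocomplement in the De Morgan case. \<open>K_empty\<close> is what the first disjunct yields
  for the false proposition.\<close>

locale ctt_split_space = ctt_reflexive_space +
  fixes K :: "trm \<Rightarrow> trm"
  assumes sub_K [simp]: "\<And>\<theta> U. sub \<theta> (K U) = K (sub \<theta> U)"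
    and tp_K: "\<And>G U. tp G U subset \<Longrightarrow> tp G (K U) subset"
    and K_empty: "\<And>G x. tp G x (El s) \<Longrightarrow> inh G (App (K emptyU) x) \<Longrightarrow> inh G (cov x emptyU)"
begin

text \<open>The uniformity principle for the universe: the codes of the unit set and the empty set are
  told apart by decoding them.\<close>

lemma uniform_split:
  assumes x: "tp G x (El s)"
    and h: "inh (SetT # G) (PlusT (App (K (Lam (Var (Suc 0)))) (wk x)) (App (pseudoU (Lam (Var (Suc 0)))) (wk x)))"
  shows "inh G (cov x emptyU)"
proof -
  note c = der_ctx[OF x]
  note S = SetF[OF c] note cS = ctx_Set[OF c]
  note goal = tp_cov[OF x tp_emptyU[OF c]]
  \<comment> \<open>\<open>Lam (wk P)\<close> is the subset of all elements for which
    \<open>P\<close> holds. A code \<open>u\<close> with inhabited decoding selects the first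
    disjunct, one with empty decoding the second.\<close>
  define L where "L u P y = andT (App (Con Dec) u) (App (K (Lam (wk P))) y)" for u P y
  define R where "R u P y = andT (impT (App (Con Dec) u) (Con Empty_C)) (App (pseudoU (Lam (wk P))) y)" for u P y
  have sub_L [simp]: "sub \<theta> (L u P y) = L (sub \<theta> u) (sub \<theta> P) (sub \<theta> y)" for \<theta> u P y
    by (simp add: L_def)
  have sub_R [simp]: "sub \<theta> (R u P y) = R (sub \<theta> u) (sub \<theta> P) (sub \<theta> y)" for \<theta> u P y
    by (simp add: R_def)
  have tpL: "tp D (App (Con Dec) u) SetT" "tp D (impT (App (Con Dec) u) (Con Empty_C)) SetT"
    "tp D (App (K (Lam (wk P))) y) SetT" "tp D (App (pseudoU (Lam (wk P))) y) SetT"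
    "tp D (L u P y) SetT" "tp D (R u P y) SetT"
    if "tp D u (El (Con Univ))" "tp D P SetT" "tp D y (El s)" for D u P y
  proof -
    note cD = der_ctx[OF that(1)]
    show *: "tp D (App (Con Dec) u) SetT" "tp D (impT (App (Con Dec) u) (Con Empty_C)) SetT"
      "tp D (App (K (Lam (wk P))) y) SetT" "tp D (App (pseudoU (Lam (wk P))) y) SetT"
      by (intro Dec_Set impT_Set tp_Empty tp_mem tp_K tp_pseudoU tp_const that cD)+
    show "tp D (L u P y) SetT" "tp D (R u P y) SetT"
      unfolding L_def R_def by (intro andT_Set *)+
  qed
  note U = tp_Univ[OF c] note U1 = tp_Univ[OF cS]
  let ?B = "PlusT (L (Var 0) (Var (Suc 0)) (wk (wk x))) (R (Var 0) (Var (Suc 0)) (wk (wk x)))"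
  have v1: "tp (El (Con Univ) # SetT # G) (Var (Suc 0)) SetT"
    using wk_Set[OF Var0_Set[OF cS] ElF[OF U1]] by simp
  have v0: "tp (El (Con Univ) # SetT # G) (Var 0) (El (Con Univ))"
    using Var0_El[OF ctx_El[OF U1]] by simp
  have xx: "tp (El (Con Univ) # SetT # G) (wk (wk x)) (El s)"
    by (intro wk_s x S ElF U1)
  have B: "tp (El (Con Univ) # SetT # G) ?B SetT"
    by (intro PlusT_Set tpL v0 v1 xx)
  have Sig: "inh (SetT # G) (SigT (Con Univ) ?B)"
  proof (rule PlusE[OF _ _ _ h])
    let ?A1 = "App (K (Lam (Var (Suc 0)))) (wk x)" and ?A2 = "App (pseudoU (Lam (Var (Suc 0)))) (wk x)"
    have P: "tp (SetT # G) (Lam (Var (Suc 0))) subset" using tp_const[OF Var0_Set[OF cS]] by simp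
    show A1: "tp (SetT # G) ?A1 SetT" and A2: "tp (SetT # G) ?A2 SetT"
      by (intro tp_mem tp_K tp_pseudoU P wk_s x S)+
    show Sg: "tp (SetT # G) (SigT (Con Univ) ?B) SetT" by (intro SigT_Set U1 B)
    \<comment> \<open>The witness in the universe is the code of the unit set under the first
      disjunct and that of the empty set under the second.\<close>
    have step: "inh (El A # SetT # G) (wk (SigT (Con Univ) ?B))"
      if A: "tp (SetT # G) A SetT" and u: "tp (El A # SetT # G) u (El (Con Univ))"
        and q: "inh (El A # SetT # G) (L u (Var (Suc 0)) (wk (wk x))) \<or>
                inh (El A # SetT # G) (R u (Var (Suc 0)) (wk (wk x)))" for A u
    proof -
      let ?D = "El A # SetT # G"
      note t = ElF[OF A]
      have x2: "tp ?D (wk (wk x)) (El s)" by (intro wk_s x S t)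
      have P2: "tp ?D (Var (Suc 0)) SetT" using wk_Set[OF Var0_Set[OF cS] t] by simp
      have "inh ?D (PlusT (L u (Var (Suc 0)) (wk (wk x))) (R u (Var (Suc 0)) (wk (wk x))))"
        using q tp_inl[OF tpL(5,6)[OF u P2 x2]] tp_inr[OF tpL(5,6)[OF u P2 x2]] by blast
      moreover have "tp (El (Con Univ) # ?D) (sub (lift_sub (shift (Suc 0))) ?B) SetT"
        using wk_under[OF B ElF[OF U1] t] by simp
      ultimately show ?thesis
        using SigI[OF tp_Univ[OF der_ctx[OF u]] _ u, of "sub (lift_sub (shift (Suc 0))) ?B"] by simp
    qed
    show "inh (El ?A1 # SetT # G) (wk (SigT (Con Univ) ?B))"
    proof (rule step[OF A1])
      note c1 = ctx_El[OF A1]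
      show u: "tp (El ?A1 # SetT # G) (Con UUnit) (El (Con Univ))" by (rule tp_UUnit[OF c1])
      have "inh (El ?A1 # SetT # G) (App (Con Dec) (Con UUnit))"
        using inh_eqs[OF eqs_Dec(2)[OF c1]] tp_Star[OF c1] by blast
      moreover have "inh (El ?A1 # SetT # G) (App (K (Lam (wk (Var (Suc 0))))) (wk (wk x)))"
        using hyp[OF A1] by simp
      moreover have "tp (El ?A1 # SetT # G) (Var (Suc 0)) SetT" "tp (El ?A1 # SetT # G) (wk (wk x)) (El s)"
        using wk_Set[OF Var0_Set[OF cS] ElF[OF A1]] wk_s[OF wk_s[OF x S] ElF[OF A1]] by simp_all
      ultimately show "inh (El ?A1 # SetT # G) (L (Con UUnit) (Var (Suc 0)) (wk (wk x))) \<or>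
          inh (El ?A1 # SetT # G) (R (Con UUnit) (Var (Suc 0)) (wk (wk x)))"
        unfolding L_def using andI[OF tpL(1,3)[OF u]] by blast
    qed
    show "inh (El ?A2 # SetT # G) (wk (SigT (Con Univ) ?B))"
    proof (rule step[OF A2])
      note c1 = ctx_El[OF A2]
      show u: "tp (El ?A2 # SetT # G) (Con UEmpty) (El (Con Univ))" by (rule tp_UEmpty[OF c1])
      have v: "tp (El ?A2 # SetT # G) (Var (Suc 0)) SetT" "tp (El ?A2 # SetT # G) (wk (wk x)) (El s)"
        using wk_Set[OF Var0_Set[OF cS] ElF[OF A2]] wk_s[OF wk_s[OF x S] ElF[OF A2]] by simp_all
      note D = Dec_Set[OF u]
      note c2 = ctx_El[OF D]
      have "inh (El (App (Con Dec) (Con UEmpty)) # El ?A2 # SetT # G) (Con Empty_C)"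
        using inh_eqs[OF eqs_Dec(1)[OF c2]] hyp[OF D] by simp
      then have "inh (El ?A2 # SetT # G) (impT (App (Con Dec) (Con UEmpty)) (Con Empty_C))"
        by (intro impI D tp_Empty c1) simp
      moreover have "inh (El ?A2 # SetT # G) (App (pseudoU (Lam (wk (Var (Suc 0))))) (wk (wk x)))"
        using hyp[OF A2] by simp
      ultimately show "inh (El ?A2 # SetT # G) (L (Con UEmpty) (Var (Suc 0)) (wk (wk x))) \<or>
          inh (El ?A2 # SetT # G) (R (Con UEmpty) (Var (Suc 0)) (wk (wk x)))"
        unfolding R_def using andI[OF tpL(2,4)[OF u v]] by blast
    qed
  qed
  have B': "tp (El (wk (Con Univ)) # SetT # G) ?B SetT" using B by simp
  have Sig': "inh (SetT # G) (SigT (wk (Con Univ)) ?B)" using Sig by simp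
  obtain u where u: "tp G u (El (Con Univ))"
    and q': "\<And>P. tp G P SetT \<Longrightarrow> inh G (sub (single u) (sub (lift_sub (single P)) ?B))"
    using gup[OF U B' Sig'] by blast
  have q: "inh G (PlusT (L u P x) (R u P x))" if "tp G P SetT" for P
    using q'[OF that] by simp
  note E = tp_Empty[OF c] and N = tp_Unit[OF c]
  show ?thesis
  \<comment> \<open>The uniform code is tested at the false proposition: its first alternative gives
    the goal, its second shows that the decoding of \<open>u\<close> is empty.\<close>
  proof (rule PlusE[OF tpL(5,6)[OF u E x] goal q[OF E]])
    let ?A = "L u (Con Empty_C) x"
    note A = tpL(5)[OF u E x]
    note t = ElF[OF A]
    note cA = ctx_El[OF A]
    have "inh (El ?A # G) (App (K emptyU) (wk x))"
      using andE(2)[OF wk_Set[OF tpL(1)[OF u E x] t] wk_Set[OF tpL(3)[OF u E x] t]] hyp[OF A]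
      by (simp add: L_def)
    then show "inh (El ?A # G) (wk (cov x emptyU))"
      using K_empty[OF wk_s[OF x t]] by simp
  next
    let ?A = "R u (Con Empty_C) x"
    note A = tpL(6)[OF u E x]
    note t = ElF[OF A]
    note cA = ctx_El[OF A]
    have x1: "tp (El ?A # G) (wk x) (El s)" by (rule wk_s[OF x t])
    have u1: "tp (El ?A # G) (wk u) (El (Con Univ))" using wk_El[OF u t] by simp
    note E1 = tp_Empty[OF cA] note N1 = tp_Unit[OF cA]
    have neg: "inh (El ?A # G) (impT (App (Con Dec) (wk u)) (Con Empty_C))"
      using andE(1)[OF wk_Set[OF tpL(2)[OF u E x] t] wk_Set[OF tpL(4)[OF u E x] t]] hyp[OF A]
      by (simp add: R_def)
    have goal1: "tp (El ?A # G) (cov (wk x) emptyU) SetT" by (intro tp_cov x1 tp_emptyU cA)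
    have "inh (El ?A # G) (PlusT (L (wk u) (Con Unit_C) (wk x)) (R (wk u) (Con Unit_C) (wk x)))"
      using wk_inh[OF q[OF N] t] by simp
    \<comment> \<open>At the true proposition the first alternative contradicts the emptiness just
      found. The second puts the element into the full subset and into its pseudocomplement.\<close>
    then have "inh (El ?A # G) (cov (wk x) emptyU)"
    proof (rule PlusE[OF tpL(5,6)[OF u1 N1 x1] goal1])
      let ?A' = "L (wk u) (Con Unit_C) (wk x)"
      note A' = tpL(5)[OF u1 N1 x1]
      note t' = ElF[OF A']
      note D = wk_Set[OF tpL(1)[OF u1 N1 x1] t']
      have "inh (El ?A' # El ?A # G) (wk (App (Con Dec) (wk u)))"
        using andE(1)[OF D wk_Set[OF tpL(3)[OF u1 N1 x1] t']] hyp[OF A'] by (simp add: L_def)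
      then have "inh (El ?A' # El ?A # G) (Con Empty_C)"
        using impE[OF D tp_Empty[OF ctx_El[OF A']]] wk_inh[OF neg t'] by simp
      then show "inh (El ?A' # El ?A # G) (wk (cov (wk x) emptyU))"
        by (rule EmptyE[OF wk_Set[OF goal1 t']])
    next
      let ?A' = "R (wk u) (Con Unit_C) (wk x)"
      note A' = tpL(6)[OF u1 N1 x1]
      note t' = ElF[OF A']
      note c' = ctx_El[OF A']
      have x': "tp (El ?A' # El ?A # G) (wk (wk x)) (El s)" by (rule wk_s[OF x1 t'])
      have Un: "tp (El ?A' # El ?A # G) (Lam (Con Unit_C)) subset"
        using tp_const[OF tp_Unit[OF c']] by simp
      have "inh (El ?A' # El ?A # G) (App (pseudoU (Lam (Con Unit_C))) (wk (wk x)))"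
        using andE(2)[OF wk_Set[OF tpL(2)[OF u1 N1 x1] t'] wk_Set[OF tpL(4)[OF u1 N1 x1] t']] hyp[OF A']
        by (simp add: R_def)
      moreover have "inh (El ?A' # El ?A # G) (App (Lam (Con Unit_C)) (wk (wk x)))"
        using inh_beta[OF tp_Unit[OF ctx_s[OF c']] x'] tp_Star[OF c'] by auto
      ultimately show "inh (El ?A' # El ?A # G) (wk (cov (wk x) emptyU))"
        using pseudo_disjoint[OF Un x'] by simp
    qed
    then show "inh (El ?A # G) (wk (cov x emptyU))" by simp
  qed
qed

end

locale ctt_axiom_set = ctt_space +
  fixes i c :: trm
  assumes i: "tp [] i subset" and c: "tp [] c (Fun (El s) (Fun (El (App i (Var 0))) subset))"
begin

lemma sub_i [simp]: "sub \<theta> i = i" and sub_c [simp]: "sub \<theta> c = c"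
  using der_closed i c by blast+

lemma tp_i: "tp G a (El s) \<Longrightarrow> tp G (App i a) SetT"
  using subst[OF i sub_ok_Nil, of G] der_ctx by (intro tp_mem) auto
lemma tp_c: "tp G a (El s) \<Longrightarrow> tp G j (El (App i a)) \<Longrightarrow> tp G (App (App c a) j) subset"
  by (rule tp_App[OF tp_App]) (use subst[OF c sub_ok_Nil, of G] der_ctx in auto)

lemma tp_axiom_subset:
  assumes a: "tp G a (El s)" and U: "tp G U subset"
  shows "tp (El (App i a) # G) (subU (App (App c (wk a)) (Var 0)) (wk U)) SetT"
proof -
  note I = tp_i[OF a]
  note t = ElF[OF I]
  show ?thesis
    by (intro tp_subU tp_c wk_s a t wk_subset U) (use Var0_El[OF ctx_El[OF I]] in simp)
qed

end

locale ctt_presented_space = ctt_split_space T s r K + ctt_axiom_set T s r i c for T s r K i c +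
  assumes trans: "\<And>G a U V. tp G a (El s) \<Longrightarrow> tp G U subset \<Longrightarrow> tp G V subset \<Longrightarrow>
      inh G (cov a U) \<Longrightarrow>
      inh G (PiT s (impT (App (wk U) (Var 0)) (cov (Var 0) (wk V)))) \<Longrightarrow> inh G (cov a V)"
    and presented: "\<And>G a U. tp G a (El s) \<Longrightarrow> tp G U subset \<Longrightarrow>
      inh G (cov a U) \<longleftrightarrow> inh G (SigT (App i a) (subU (App (App c (wk a)) (Var 0)) (wk U)))"
    and split: "\<And>G a U. tp G a (El s) \<Longrightarrow> tp G U subset \<Longrightarrow>
      inh G (cov a (unionU (K U) (pseudoU U)))"
begin

theorem cov_empty:
  assumes a: "tp G a (El s)"
  shows "inh G (cov a emptyU)"
proof -
  note cG = der_ctx[OF a]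
  note S = SetF[OF cG] note cS = ctx_Set[OF cG]
  note I = tp_i[OF a]
  \<comment> \<open>The subset given by the variable proposition at the head of the context; under
    the abstraction that variable has index 1.\<close>
  let ?N = "Lam (Var (Suc 0))"
  let ?U = "unionU (K ?N) (pseudoU ?N)"
  have N: "tp (SetT # G) ?N subset" using tp_const[OF Var0_Set[OF cS]] by simp
  have U: "tp (SetT # G) ?U subset" by (intro tp_unionU tp_K tp_pseudoU N)
  note a1 = wk_s[OF a S]
  let ?B = "subU (App (App c (wk (wk a))) (Var 0)) (wk ?U)"
  have 1: "inh (SetT # G) (SigT (wk (App i a)) ?B)"
    using presented[OF a1 U] split[OF a1 N] by simp
  have 2: "tp (El (wk (App i a)) # SetT # G) ?B SetT"
    using tp_axiom_subset[OF a1 U] by simp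
  \<comment> \<open>The index \<open>j\<close> is typed in \<open>G\<close>, without the variable
    proposition: one axiom serves all propositions.\<close>
  obtain j where j: "tp G j (El (App i a))"
    and "inh (SetT # G) (sub (single (wk j)) ?B)"
    by (rule gup[OF I 2 1]) (rule that)
  then have q: "inh (SetT # G) (subU (App (App c (wk a)) (wk j)) ?U)" by simp
  let ?C = "App (App c a) j"
  note C = tp_c[OF a j]
  note body = tp_subU[OF C C]
  have mem: "tp (El s # G) (App (wk ?C) (Var 0)) SetT" by (rule body)
  \<comment> \<open>The axiom covers \<open>a\<close>, being contained in itself.\<close>
  have "inh G (subU ?C ?C)"
    unfolding subU_def by (intro PiI tp_s cG impT_Set impI body hyp)
  then have "inh G (sub (single j) (subU (App (App c (wk a)) (Var 0)) (wk ?C)))" by simp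
  then have aC: "inh G (cov a ?C)"
    using SigI[OF I tp_axiom_subset[OF a C] j] presented[OF a C] by blast
  let ?D = "El (App (wk ?C) (Var 0)) # El s # G"
  note t1 = ty_s[OF cG] note t2 = ElF[OF mem] note c2 = ctx_El[OF mem]
  let ?x = "Var (Suc 0)"
  have x: "tp ?D ?x (El s)" by (intro VarSuc_s Var0_s cG t2)
  have "inh ?D (cov ?x emptyU)"
  proof (rule uniform_split[OF x])
    let ?E = "SetT # ?D"
    note tS = SetF[OF c2]
    note cE = ctx_Set[OF c2]
    obtain qt where "tp (SetT # G) qt (El (subU (App (App c (wk a)) (wk j)) ?U))" using q by blast
    \<comment> \<open>\<open>uniform_split\<close> wants the variable proposition at the head, above
      the element and its membership proof. Both are inserted beneath it, one at a time.\<close>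
    note w1 = wk_under[OF this S t1]
    have "der T (El s # G) (IsTy SetT)" by (rule SetF[OF ctx_s[OF cG]])
    from wk_under[OF w1[simplified] this t2]
    have sub: "inh ?E (subU (App (App c (wk (wk (wk a)))) (wk (wk (wk j)))) ?U)"
      by auto
    have y: "tp ?E (wk ?x) (El s)" by (rule wk_s[OF x tS])
    have N': "tp ?E ?N subset" using tp_const[OF Var0_Set[OF cE]] by simp
    have U': "tp ?E ?U subset" by (intro tp_unionU tp_K tp_pseudoU N')
    let ?C' = "App (App c (wk (wk (wk a)))) (wk (wk (wk j)))"
    have C': "tp ?E ?C' subset"
      using wk_subset[OF wk_subset[OF wk_subset[OF C t1] t2] tS] by simp
    have "inh ?E (impT (App ?C' (wk ?x)) (App ?U (wk ?x)))"
      using PiE[OF tp_s[OF cE] impT_Set[OF tp_subU(1,2)[OF C' U']] sub[unfolded subU_def] y] by simp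
    moreover have "inh ?E (App ?C' (wk ?x))"
      using wk_inh[OF hyp[OF mem] tS] by simp
    ultimately have "inh ?E (App ?U (wk ?x))"
      using impE[OF tp_mem[OF C' y] tp_mem[OF U' y]] by blast
    then show "inh ?E (PlusT (App (K ?N) (wk ?x)) (App (pseudoU ?N) (wk ?x)))"
      using mem_unionU[OF tp_K[OF N'] tp_pseudoU[OF N'] y] by blast
  qed
  then have "inh G (PiT s (impT (App (wk ?C) (Var 0)) (cov (Var 0) (wk emptyU))))"
    by (intro PiI tp_s cG impT_Set impI mem tp_cov Var0_s) (auto intro!: tp_emptyU ctx_s cG)
  from trans[OF a C tp_emptyU[OF cG] aC this] show ?thesis .
qed

end


theorem ctt_not_set_presented:
  assumes T: "CTT_star T" and S: "ctt_case_i T s r \<or> ctt_case_ii T s r"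
  shows "\<not> ctt_set_presented T s r"
proof
  assume P: "ctt_set_presented T s r"
  let ?T = "T \<union> GUP_CTT"
  note unf = dep_def arr_def el_def set'_def tapp_def cn_def closed_def tbound_def tlam_def IdS_def
    PiS_def SigmaS_def imp_S_def and_S_def or_S_def not_S_def iff_S_def subset_ty_def sub_S_def
    empty_S_def single_S_def union_S_def cov_S_def down_S_def pseudo_S_def Let_def inhabited_def
    eval_nat_numeral
  interpret ctt_gup ?T
    using T by unfold_locales (auto simp: CTT_star_def closed_theory_Un_GUP)
  have up: "tp [] t \<alpha>" if "der T [] (HasTy t \<alpha>)" for t \<alpha>
    using der_mono[OF that] by blast
  \<comment> \<open>A closed proof can be used in any context, by way of the empty context
    morphism.\<close>
  have up': "tp G t \<alpha>" if "der T [] (HasTy t \<alpha>)" "der ?T G IsCtx" for G t \<alpha>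
    using subst[OF up[OF that(1)] sub_ok_Nil[OF that(2), of Var]] by simp
  have fs: "ctt_formal_space T s r" and nt: "ctt_non_trivial T s r"
    using S by (auto simp: ctt_case_i_def ctt_case_ii_def)
  obtain i c where i: "der T [] (HasTy i (Fun (El s) SetT))"
    and c: "der T [] (HasTy c (Fun (El s) (Fun (El (App i (Var 0))) (Fun (El s) SetT))))"
    and P: "inhabited T (\<^bold>\<Pi>a\<^bold>:el (closed s). \<^bold>\<Pi>U\<^bold>:subset_ty (closed s).
       el (iff_S (closed r \<cdot> a \<cdot> U) (SigmaS (closed i \<cdot> a) (\<lambda>j. sub_S (closed s) (closed c \<cdot> a \<cdot> j) U))))"
    using P unfolding ctt_set_presented_def by (auto simp: unf)
  interpret ctt_axiom_set ?T s r i c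
    using fs i c by unfold_locales (auto simp: ctt_formal_space_def unf intro!: up)
  note ops = singleU_def below_def downU_def pseudoU_def unionU_def subU_def
  \<comment> \<open>The hypotheses are recovered as closed proof terms with explicit de Bruijn
    types; applied to arguments in an arbitrary context, they meet the assumptions of the
    locales.\<close>
  obtain t1 where t1: "der T [] (HasTy t1 (Fun (El s) (Fun subset
      (El (impT (App (Var 0) (Var (Suc 0))) (cov (Var (Suc 0)) (Var 0)))))))"
    using fs by (auto simp: ctt_formal_space_def unf)
  obtain t2 where t2: "der T [] (HasTy t2 (Fun (El s) (Fun subset (Fun subset
      (El (impT (cov (Var (Suc (Suc 0))) (Var (Suc 0)))
        (impT (PiT s (impT (App (Var (Suc (Suc 0))) (Var 0)) (cov (Var 0) (Var (Suc 0)))))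
          (cov (Var (Suc (Suc 0))) (Var 0)))))))))"
    using fs by (auto simp: ctt_formal_space_def unf)
  obtain t3 where t3: "der T [] (HasTy t3 (El (impT (PiT s (cov (Var 0) emptyU)) (Con Empty_C))))"
    using nt by (auto simp: ctt_non_trivial_def unf)
  let ?S = "SigT (App i (Var (Suc 0))) (subU (App (App c (Var (Suc (Suc 0)))) (Var 0)) (Var (Suc 0)))"
  obtain t4 where t4: "der T [] (HasTy t4 (Fun (El s) (Fun subset (El (andT
      (impT (cov (Var (Suc 0)) (Var 0)) ?S) (impT ?S (cov (Var (Suc 0)) (Var 0))))))))"
    using P by (auto simp: unf ops)
  have refl0: "inh G (cov a U)" if a: "tp G a (El s)" and U: "tp G U subset" and h: "inh G (App U a)" for G a U
  proof -
    note X = AppR[OF AppR[OF up'[OF t1 der_ctx[OF a]] a, simplified] U, simplified]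
    show ?thesis
      by (rule impE[OF tp_mem[OF U a] tp_cov[OF a U] _ h]) (use X in auto)
  qed
  interpret ctt_reflexive_space ?T s r
    by unfold_locales (rule refl0)
  have trans: "inh G (cov a V)" if a: "tp G a (El s)" and U: "tp G U subset" and V: "tp G V subset"
    and h: "inh G (cov a U)" "inh G (PiT s (impT (App (wk U) (Var 0)) (cov (Var 0) (wk V))))" for G a U V
  proof -
    note cG = der_ctx[OF a]
    note X = AppR[OF AppR[OF AppR[OF up'[OF t2 der_ctx[OF a]] a, simplified] U, simplified] V, simplified]
    have tU: "tp G (PiT s (impT (App (wk U) (Var 0)) (cov (Var 0) (wk V)))) SetT"
      by (intro PiT_Set tp_s cG impT_Set tp_subU(1)[OF U V] tp_cov Var0_s wk_subset V ty_s)
    have "inh G (impT (PiT s (impT (App (wk U) (Var 0)) (cov (Var 0) (wk V)))) (cov a V))"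
      by (rule impE[OF tp_cov[OF a U] impT_Set[OF tU tp_cov[OF a V]] _ h(1)]) (use X in auto)
    then show ?thesis by (rule impE[OF tU tp_cov[OF a V] _ h(2)])
  qed
  have pres: "inh G (cov a U) \<longleftrightarrow> inh G (SigT (App i a) (subU (App (App c (wk a)) (Var 0)) (wk U)))"
    if a: "tp G a (El s)" and U: "tp G U subset" for G a U
  proof -
    let ?R = "SigT (App i a) (subU (App (App c (wk a)) (Var 0)) (wk U))"
    note X = AppR[OF AppR[OF up'[OF t4 der_ctx[OF a]] a, simplified] U, simplified]
    have A: "tp G (cov a U) SetT" and B: "tp G ?R SetT"
      by (intro tp_cov a U SigT_Set tp_i tp_axiom_subset)+
    have "inh G (andT (impT (cov a U) ?R) (impT ?R (cov a U)))" using X by auto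
    from andE[OF impT_Set[OF A B] impT_Set[OF B A] this] show ?thesis
      using impE[OF A B] impE[OF B A] by blast
  qed
  \<comment> \<open>Only the empty cover of every element is left to show, as non-triviality then
    inhabits the empty set in the consistent theory.\<close>
  have concl: False if "\<And>G a. tp G a (El s) \<Longrightarrow> inh G (cov a emptyU)"
  proof -
    note c0 = CtxNil[of ?T]
    have A: "tp (El s # []) (cov (Var 0) emptyU) SetT" by (intro tp_cov Var0_s tp_emptyU ctx_s c0)
    have "inh [] (PiT s (cov (Var 0) emptyU))"
      by (intro PiI tp_s c0 A that Var0_s)
    then have "inh [] (Con Empty_C)"
      using impE[OF PiT_Set[OF tp_s[OF c0] A] tp_Empty[OF c0]] up[OF t3] by blast
    with T show False
      by (simp add: CTT_star_def ctt_consistent_def unf)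
  qed
  show False
    using S
  proof
    assume "ctt_case_i T s r"
    then obtain t where t: "der T [] (HasTy t (Fun subset
       (El (PiT s (cov (Var 0) (unionU (Var (Suc 0)) (pseudoU (Var (Suc 0)))))))))"
      by (auto simp: ctt_case_i_def ctt_boolean_def unf ops)
    interpret ctt_presented_space ?T s r "\<lambda>U. U" i c
    proof unfold_locales
      show "inh G (cov x emptyU)" if x: "tp G x (El s)" and h: "inh G (App emptyU x)" for G x
        by (rule EmptyE[OF tp_cov[OF x tp_emptyU[OF der_ctx[OF x]]] mem_empty[OF x h]])
      show "inh G (cov a (unionU U (pseudoU U)))" if a: "tp G a (El s)" and U: "tp G U subset" for G a U
      proof -
        note cG = der_ctx[OF a]
        note X = AppR[OF up'[OF t cG] U, simplified]
        have "tp (El s # G) (cov (Var 0) (unionU (wk U) (pseudoU (wk U)))) SetT"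
          by (intro tp_cov Var0_s cG tp_unionU tp_pseudoU wk_subset U ty_s)
        from PiE[OF tp_s[OF cG] this _ a] X show ?thesis by auto
      qed
      show "inh G (cov a V)" if "tp G a (El s)" "tp G U subset" "tp G V subset"
        "inh G (cov a U)" "inh G (PiT s (impT (App (wk U) (Var 0)) (cov (Var 0) (wk V))))" for G a U V
        using that by (rule trans)
      show "inh G (cov a U) \<longleftrightarrow> inh G (SigT (App i a) (subU (App (App c (wk a)) (Var 0)) (wk U)))"
        if "tp G a (El s)" "tp G U subset" for G a U
        using that by (rule pres)
    qed simp_all
    show False by (rule concl[OF cov_empty])
  next
    assume "ctt_case_ii T s r"
    then obtain t where t: "der T [] (HasTy t (Fun subset
       (El (PiT s (cov (Var 0) (unionU (pseudoU (pseudoU (Var (Suc 0)))) (pseudoU (Var (Suc 0)))))))))"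
      by (auto simp: ctt_case_ii_def ctt_de_morgan_def unf ops)
    interpret ctt_presented_space ?T s r "\<lambda>U. pseudoU (pseudoU U)" i c
    proof unfold_locales
      show "inh G (cov x emptyU)" if x: "tp G x (El s)"
        and h: "inh G (App (pseudoU (pseudoU emptyU)) x)" for G x
        \<comment> \<open>The pseudocomplement of the empty subset contains every \<open>x\<close>,
          so membership in its pseudocomplement makes \<open>x\<close> negligible.\<close>
        by (rule pseudo_disjoint[OF tp_pseudoU[OF tp_emptyU[OF der_ctx[OF x]]] x mem_pseudo_empty[OF x] h])
      show "inh G (cov a (unionU (pseudoU (pseudoU U)) (pseudoU U)))"
        if a: "tp G a (El s)" and U: "tp G U subset" for G a U
      proof -
        note cG = der_ctx[OF a]
        note X = AppR[OF up'[OF t cG] U, simplified]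
        have "tp (El s # G) (cov (Var 0) (unionU (pseudoU (pseudoU (wk U))) (pseudoU (wk U)))) SetT"
          by (intro tp_cov Var0_s cG tp_unionU tp_pseudoU wk_subset U ty_s)
        from PiE[OF tp_s[OF cG] this _ a] X show ?thesis by auto
      qed
      show "inh G (cov a V)" if "tp G a (El s)" "tp G U subset" "tp G V subset"
        "inh G (cov a U)" "inh G (PiT s (impT (App (wk U) (Var 0)) (cov (Var 0) (wk V))))" for G a U V
        using that by (rule trans)
      show "inh G (cov a U) \<longleftrightarrow> inh G (SigT (App i a) (subU (App (App c (wk a)) (Var 0)) (wk U)))"
        if "tp G a (El s)" "tp G U subset" for G a U
        using that by (rule pres)
    qed (simp, (rule tp_pseudoU)+)
    show False by (rule concl[OF cov_empty])
  qed
qed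

theorem theorem4p4:
  shows "(\<forall>T \<sigma> \<gamma>. CZF_star T \<longrightarrow> czf_case_i T \<sigma> \<gamma> \<or> czf_case_ii T \<sigma> \<gamma> \<longrightarrow>
            \<not> czf_proves_of T \<sigma> \<gamma> set_presented) \<and>
         (\<forall>T s r. CTT_star T \<longrightarrow> ctt_case_i T s r \<or> ctt_case_ii T s r \<longrightarrow>
            \<not> ctt_set_presented T s r)"
  using czf_not_set_presented ctt_not_set_presented by blast

end
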